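(* Let $\mu(x)$ be a global Keisler measure which is $irgs$ (over some small model $M$). Then for every $L$-formula $\varphi(x;y)$, $$\mathbb P_\mu(\mathbf O^\varphi)=\mathbb P_\mu(\mathbf I^\varphi)=\mathbb P_\mu(\mathbf L^\varphi)=0.$$ Consequently, $\mathbb P_\mu(\mathbf O)=\mathbb P_\mu(\mathbf I)=\mathbb P_\mu(\mathbf L)=0$.
   Context: **Classical setting.** $T$ is a complete first-order theory in a countable language $L$, $\mathcal U$ is its monster model, and small models $M$ satisfy $M\preceq\mathcal U$. Partitioned formulas $\varphi(x;y)$ have $|x|=1$ and $y$ a finite tuple. A global (Keisler) measure $\mu(x)$ is a finitely additive probability measure on $L(\mathcal U)$-formulas in $x$, identified with a regular Borel probability measure on $S_x(\mathcal U)$. It is definable over $M$ if it is $M$-invariant and for each $L$-formula $\varphi(x;y)$ the map $S_y(M)\to[0,1]$, $\mathrm{tp}(b/M)\mapsto\mu(\varphi(x;b))$, is continuous. **The measure $\mathbb P_\mu$ and model-theoretic events.** Let $\mathbf x=(x_1,x_2,\dots)$. $\mathbb P_\mu=\mu^{(\omega)}$ is the infinite iterated Morley product of $\mu$ with itself, a regular Borel probability measure on $S_{\mathbf x}(\mathcal U)$. For a formula $\varphi(\bar x)$ with $\bar x\subset\mathbf x$ finite, $[\varphi(\bar x)]\subseteq S_{\mathbf x}(\mathcal U)$ is the corresponding clopen set. For an $L$-formula $\varphi(x;y)$ set $\mathbf O^\varphi=\bigcap_{k\ge1}[O^\varphi_k]$, $\mathbf I^\varphi=\bigcap_{k\ge1}[I^\varphi_k]$,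 $\mathbf L^\varphi=\bigcap_{k\ge1}[L^\varphi_k]$, where - $O_k^\varphi(x_1,\dots,x_k)$ says there is an order of length $k$ for $\varphi$: there exist $y_1,\dots,y_k$ such that, for all $i,j\le k$, $\varphi(x_i;y_j)$ holds if and only if $i>j$; - $I_k^\varphi(x_1,\dots,x_k)$ says $\varphi$ shatters $x_1,\dots,x_k$: for every $I\subseteq\{1,\dots,k\}$ there is $y_I$ with $\bigwedge_{i\in I}\varphi(x_i;y_I)\wedge\bigwedge_{i\notin I}\neg\varphi(x_i;y_I)$; - $L_k^\varphi(x_1,\dots,x_k)$ says that the sets defined in the variable $y$ form a strict chain: $\varphi(x_1;y)\subsetneq\varphi(x_2;y)\subsetneq\cdots\subsetneq\varphi(x_k;y)$. Also $\mathbf O=\bigcup_{\varphi\in L}\mathbf O^\varphi$, $\mathbf I=\bigcup_{\varphi\in L}\mathbf I^\varphi$, $\mathbf L=\bigcup_{\varphi\in L}\mathbf L^\varphi$. **Randomization.** For an atomless probability space $(\Omega,\mathcal B,\mathcal P)$, $M_0^\Omega$ is the set of measurable functions $\Omega\to M$ with finite range, written $f=\sum_{i\le n}a_i^{A_i}$ ($f=a_i$ on $A_i$, $(A_i)$ a measurable partition of $\Omega$). For a classical formula $\varphi$, $\llbracket\varphi(f_1,\dots,f_n)\rrbracket=\{\omega: M\models\varphi(f_1(\omega),\dots,f_n(\omega))\}$ and $\mathbb P\llbracket\varphi(\bar f)\rrbracket=\mathcal P(\llbracket\varphi(\bar f)\rrbracket)$. The metric is $d(f,g)=\mathbb P\llbracket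 f\ne g\rrbracket$; $M^\Omega$ is the completion. $a\in M$ is identified with the constant function $a^\Omega$. $T^R$ is the (complete, continuous) theory of these structures (Ben Yaacov–Keisler randomization); it has quantifier elimination, so types are determined by the values of $\mathbb P\llbracket\varphi\rrbracket$, $\varphi$ a classical formula. $\mathcal C$ is the monster model of $T^R$, with $M^\Omega\preceq\mathcal U^\Omega\preceq\mathcal C$. A global random type is an element of $S_x(\mathcal C)$; for such $p$, $\mathbb P^{p}\llbracket\varphi(x;g)\rrbracket$ denotes the value that $p$ assigns to $\mathbb P\llbracket\varphi(x;g)\rrbracket$. **Generic stability (continuous logic).** A type $p\in S_x(\mathcal C)$ invariant over $N\preceq\mathcal C$ is generically stable over $N$ if there do not exist a formula $\varphi(x;y)$, a Morley sequence $(a_i)_{i<\omega}$ in $p$ over $N$ (i.e. $a_i\models p|_{Na_{<i}}$), a sequence $(b_i)_{i<\omega}$ in $\mathcal C^y$ and reals $r<s$ such that $\varphi(a_i;b_j)\le r$ if $i\le j$ and $\varphi(a_i;b_j)\ge s$ if $i>j$. **Canonical random extension $r_\mu$ and $irgs$.** Let $\mu$ be a global measure definable over $M$. The type $r_\mu\in S_x(\mathcal C)$ is defined by $\mathbb P^{r_\mu}\llbracket\varphi(x;g)\rrbracket=\sum_{i=1}^k\mathcal P(A_i)\,\mu(\varphi(x;a_i))$ for $g=\sum_{i=1}^k a_i^{A_i}$ in $M_0^\Omega$, and for arbitrary $g$ in $\mathcal C$ by $\mathbb P^{r_\mu}\llbracket\varphi(x;g)\rrbracket=\lim_j\mathbb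 P^{r_\mu}\llbracket\varphi(x;g_j)\rrbracket$, where $(g_j)$ is any net in $M_0^\Omega$ with $\mathrm{tp}(g_j/M_0^\Omega)\to\mathrm{tp}(g/M_0^\Omega)$ (this is known to be well defined). The measure $\mu$ is $irgs$ over $M$ if it is definable over $M$ and $r_\mu$ is generically stable over $M^\Omega$ (for some atomless probability space $(\Omega,\mathcal P)$). *)

theory Defs
  imports "HOL-Analysis.Analysis" "HOL-Probability.Probability"
begin

unbundle cardinal_syntax

section \<open>Classical first-order logic\<close>

text \<open>
  Formulas with constants from a type \<open>'c\<close>.  Constants serve as names for parameters: the
  \<open>L(A)\<close>-formulas are those whose constants lie in \<open>A\<close>, and the \<open>L\<close>-formulas those without constants.
\<close>

datatype ('f, 'c) trm = Var nat | Cst 'c | Fn 'f "('f, 'c) trm list"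

datatype ('f, 'r, 'c) fm =
    FEq "('f, 'c) trm" "('f, 'c) trm"
  | FRel 'r "('f, 'c) trm list"
  | FNeg "('f, 'r, 'c) fm"
  | FConj "('f, 'r, 'c) fm" "('f, 'r, 'c) fm"
  | FEx nat "('f, 'r, 'c) fm"

fun tvars :: "('f, 'c) trm \<Rightarrow> nat set" where
  "tvars (Var i) = {i}"
| "tvars (Cst c) = {}"
| "tvars (Fn f ts) = (\<Union>t\<in>set ts. tvars t)"

fun fv :: "('f, 'r, 'c) fm \<Rightarrow> nat set" where
  "fv (FEq s t) = tvars s \<union> tvars t"
| "fv (FRel R ts) = (\<Union>t\<in>set ts. tvars t)"
| "fv (FNeg \<phi>) = fv \<phi>"
| "fv (FConj \<phi> \<psi>) = fv \<phi> \<union> fv \<psi>"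
| "fv (FEx i \<phi>) = fv \<phi> - {i}"

text \<open>
  A language together with a structure for it whose universe is the whole type \<open>'u\<close>; a pair
  \<open>(f, n)\<close> in \<open>funs\<close> is an \<open>n\<close>-ary function symbol of the language, and similarly for \<open>rels\<close>.
\<close>

record ('f, 'r, 'u) model =
  funs :: "('f \<times> nat) set"
  rels :: "('r \<times> nat) set"
  fn :: "'f \<Rightarrow> 'u list \<Rightarrow> 'u"
  rl :: "'r \<Rightarrow> 'u list \<Rightarrow> bool"

definition countable_language :: "('f, 'r, 'u) model \<Rightarrow> bool" where
  "countable_language U \<longleftrightarrow> countable (funs U) \<and> countable (rels U)"

fun trm_over :: "('f, 'r, 'u) model \<Rightarrow> 'u set \<Rightarrow> ('f, 'u) trm \<Rightarrow> bool" where
  "trm_over U A (Var i) \<longleftrightarrow> True"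
| "trm_over U A (Cst c) \<longleftrightarrow> c \<in> A"
| "trm_over U A (Fn f ts) \<longleftrightarrow> (f, length ts) \<in> funs U \<and> (\<forall>t\<in>set ts. trm_over U A t)"

fun fm_over :: "('f, 'r, 'u) model \<Rightarrow> 'u set \<Rightarrow> ('f, 'r, 'u) fm \<Rightarrow> bool" where
  "fm_over U A (FEq s t) \<longleftrightarrow> trm_over U A s \<and> trm_over U A t"
| "fm_over U A (FRel R ts) \<longleftrightarrow> (R, length ts) \<in> rels U \<and> (\<forall>t\<in>set ts. trm_over U A t)"
| "fm_over U A (FNeg \<phi>) \<longleftrightarrow> fm_over U A \<phi>"
| "fm_over U A (FConj \<phi> \<psi>) \<longleftrightarrow> fm_over U A \<phi> \<and> fm_over U A \<psi>"
| "fm_over U A (FEx i \<phi>) \<longleftrightarrow> fm_over U A \<phi>"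

abbreviation L_formula :: "('f, 'r, 'u) model \<Rightarrow> ('f, 'r, 'u) fm \<Rightarrow> bool" where
  "L_formula U \<phi> \<equiv> fm_over U {} \<phi>"

fun tval :: "('f, 'r, 'u) model \<Rightarrow> (nat \<Rightarrow> 'u) \<Rightarrow> ('f, 'u) trm \<Rightarrow> 'u" where
  "tval U v (Var i) = v i"
| "tval U v (Cst c) = c"
| "tval U v (Fn f ts) = fn U f (map (tval U v) ts)"

text \<open>Satisfaction in the substructure with universe \<open>D\<close>.\<close>

fun sat :: "('f, 'r, 'u) model \<Rightarrow> 'u set \<Rightarrow> ('f, 'r, 'u) fm \<Rightarrow> (nat \<Rightarrow> 'u) \<Rightarrow> bool" where
  "sat U D (FEq s t) v \<longleftrightarrow> tval U v s = tval U v t"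
| "sat U D (FRel R ts) v \<longleftrightarrow> rl U R (map (tval U v) ts)"
| "sat U D (FNeg \<phi>) v \<longleftrightarrow> \<not> sat U D \<phi> v"
| "sat U D (FConj \<phi> \<psi>) v \<longleftrightarrow> sat U D \<phi> v \<and> sat U D \<psi> v"
| "sat U D (FEx i \<phi>) v \<longleftrightarrow> (\<exists>c\<in>D. sat U D \<phi> (v(i := c)))"

abbreviation true_in :: "('f, 'r, 'u) model \<Rightarrow> ('f, 'r, 'u) fm \<Rightarrow> (nat \<Rightarrow> 'u) \<Rightarrow> bool" where
  "true_in U \<phi> v \<equiv> sat U UNIV \<phi> v"

definition elem_sub :: "('f, 'r, 'u) model \<Rightarrow> 'u set \<Rightarrow> bool" where
  "elem_sub U M \<longleftrightarrow> M \<noteq> {} \<and>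
     (\<forall>f xs. (f, length xs) \<in> funs U \<longrightarrow> set xs \<subseteq> M \<longrightarrow> fn U f xs \<in> M) \<and>
     (\<forall>\<phi> v. L_formula U \<phi> \<longrightarrow> range v \<subseteq> M \<longrightarrow> (sat U M \<phi> v \<longleftrightarrow> true_in U \<phi> v))"


section \<open>Definable sets, types and the monster model\<close>

text \<open>
  \<open>L(A)\<close>-formulas in the variables \<open>V\<close> are identified with the sets they define.  A subset of
  \<open>U\<^sup>V\<close> is represented by the corresponding cylinder of assignments \<open>nat \<Rightarrow> 'u\<close>.
\<close>

definition Def :: "('f, 'r, 'u) model \<Rightarrow> 'u set \<Rightarrow> nat set \<Rightarrow> (nat \<Rightarrow> 'u) set set" where
  "Def U A V = {{a. true_in U \<phi> a} | \<phi>. fm_over U A \<phi> \<and> fv \<phi> \<subseteq> V}"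

text \<open>The space \<open>S\<^sub>V(A)\<close>: complete finitely satisfiable sets of \<open>L(A)\<close>-formulas in the variables \<open>V\<close>.\<close>

definition types :: "('f, 'r, 'u) model \<Rightarrow> 'u set \<Rightarrow> nat set \<Rightarrow> (nat \<Rightarrow> 'u) set set set" where
  "types U A V = {p. p \<subseteq> Def U A V \<and>
     (\<forall>F. finite F \<longrightarrow> F \<subseteq> p \<longrightarrow> \<Inter>F \<noteq> {}) \<and> (\<forall>D\<in>Def U A V. D \<in> p \<or> - D \<in> p)}"

definition tp :: "('f, 'r, 'u) model \<Rightarrow> 'u set \<Rightarrow> nat set \<Rightarrow> (nat \<Rightarrow> 'u) \<Rightarrow> (nat \<Rightarrow> 'u) set set" where
  "tp U A V b = {D \<in> Def U A V. b \<in> D}"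

definition clopen ::
    "('f, 'r, 'u) model \<Rightarrow> 'u set \<Rightarrow> nat set \<Rightarrow> (nat \<Rightarrow> 'u) set \<Rightarrow> (nat \<Rightarrow> 'u) set set set" where
  "clopen U A V D = {p \<in> types U A V. D \<in> p}"

definition type_space ::
    "('f, 'r, 'u) model \<Rightarrow> 'u set \<Rightarrow> nat set \<Rightarrow> (nat \<Rightarrow> 'u) set set topology" where
  "type_space U A V = topology_generated_by (clopen U A V ` Def U A V)"

definition small :: "'k rel \<Rightarrow> 'a set \<Rightarrow> bool" where
  "small \<kappa> A \<longleftrightarrow> |A| <o \<kappa>"

definition uncountable_cardinal :: "'k rel \<Rightarrow> bool" where
  "uncountable_cardinal \<kappa> \<longleftrightarrow> Card_order \<kappa> \<and> natLeq <o \<kappa>"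

definition saturated :: "('f, 'r, 'u) model \<Rightarrow> 'k rel \<Rightarrow> bool" where
  "saturated U \<kappa> \<longleftrightarrow> (\<forall>A q. small \<kappa> A \<longrightarrow> q \<subseteq> Def U A {0} \<longrightarrow>
     (\<forall>F. finite F \<longrightarrow> F \<subseteq> q \<longrightarrow> \<Inter>F \<noteq> {}) \<longrightarrow> \<Inter>q \<noteq> {})"

definition automorphism :: "('f, 'r, 'u) model \<Rightarrow> ('u \<Rightarrow> 'u) \<Rightarrow> bool" where
  "automorphism U \<sigma> \<longleftrightarrow> bij \<sigma> \<and>
     (\<forall>f xs. (f, length xs) \<in> funs U \<longrightarrow> \<sigma> (fn U f xs) = fn U f (map \<sigma> xs)) \<and>
     (\<forall>R xs. (R, length xs) \<in> rels U \<longrightarrow> (rl U R (map \<sigma> xs) \<longleftrightarrow> rl U R xs))"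

definition strongly_homogeneous :: "('f, 'r, 'u) model \<Rightarrow> 'k rel \<Rightarrow> bool" where
  "strongly_homogeneous U \<kappa> \<longleftrightarrow> (\<forall>A h. small \<kappa> A \<longrightarrow>
     (\<forall>\<phi> v. L_formula U \<phi> \<longrightarrow> range v \<subseteq> A \<longrightarrow> (true_in U \<phi> (h \<circ> v) \<longleftrightarrow> true_in U \<phi> v)) \<longrightarrow>
     (\<exists>\<sigma>. automorphism U \<sigma> \<and> (\<forall>a\<in>A. \<sigma> a = h a)))"

text \<open>
  \<open>U\<close> is a monster model of the complete theory \<open>T = Th(U)\<close>, and ``small'' means of cardinality
  below \<open>\<kappa>\<close>.
\<close>

definition monster :: "('f, 'r, 'u) model \<Rightarrow> 'k rel \<Rightarrow> bool" where
  "monster U \<kappa> \<longleftrightarrow> uncountable_cardinal \<kappa> \<and> saturated U \<kappa> \<and> strongly_homogeneous U \<kappa>"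


section \<open>Keisler measures\<close>

text \<open>
  A partitioned formula \<open>\<phi>(x;y)\<close> is a formula \<open>\<phi>\<close> with a distinguished variable \<open>x\<close>; the tuple
  \<open>y\<close> consists of the remaining free variables.  The parameter tuple \<open>b\<close> in \<open>\<phi>(x;b)\<close> is given by
  an assignment, whose value at \<open>x\<close> is ignored.
\<close>

definition fiber :: "('f, 'r, 'u) model \<Rightarrow> ('f, 'r, 'u) fm \<Rightarrow> nat \<Rightarrow> (nat \<Rightarrow> 'u) \<Rightarrow> 'u set" where
  "fiber U \<phi> x b = {a. true_in U \<phi> (b(x := a))}"

text \<open>
  A global measure in one variable is a function on the algebra of definable subsets of \<open>U\<close>, so
  that \<open>\<mu>(\<phi>(x;b))\<close> is \<open>\<mu> (fiber U \<phi> x b)\<close> whatever the name of the variable \<open>x\<close>.  The values of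
  \<open>\<mu>\<close> on other sets are irrelevant.
\<close>

definition definable_sets :: "('f, 'r, 'u) model \<Rightarrow> 'u set set" where
  "definable_sets U = {fiber U \<phi> x b | \<phi> x b. fm_over U UNIV \<phi>}"

definition keisler_measure :: "('f, 'r, 'u) model \<Rightarrow> ('u set \<Rightarrow> real) \<Rightarrow> bool" where
  "keisler_measure U \<mu> \<longleftrightarrow> (\<forall>X\<in>definable_sets U. 0 \<le> \<mu> X) \<and> \<mu> UNIV = 1 \<and>
     (\<forall>X\<in>definable_sets U. \<forall>Y\<in>definable_sets U. X \<inter> Y = {} \<longrightarrow> \<mu> (X \<union> Y) = \<mu> X + \<mu> Y)"

definition invariant_over ::
    "('f, 'r, 'u) model \<Rightarrow> 'u set \<Rightarrow> ('u set \<Rightarrow> real) \<Rightarrow> bool" where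
  "invariant_over U M \<mu> \<longleftrightarrow> (\<forall>\<phi> x b b'. L_formula U \<phi> \<longrightarrow>
     tp U M (fv \<phi> - {x}) b = tp U M (fv \<phi> - {x}) b' \<longrightarrow> \<mu> (fiber U \<phi> x b) = \<mu> (fiber U \<phi> x b'))"

definition definable_over ::
    "('f, 'r, 'u) model \<Rightarrow> 'k rel \<Rightarrow> 'u set \<Rightarrow> ('u set \<Rightarrow> real) \<Rightarrow> bool" where
  "definable_over U \<kappa> M \<mu> \<longleftrightarrow> small \<kappa> M \<and> elem_sub U M \<and> invariant_over U M \<mu> \<and>
     (\<forall>\<phi> x. L_formula U \<phi> \<longrightarrow>
       (\<exists>F. continuous_map (type_space U M (fv \<phi> - {x})) euclideanreal F \<and>
            (\<forall>b. F (tp U M (fv \<phi> - {x}) b) = \<mu> (fiber U \<phi> x b))))"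


section \<open>The measure \<open>\<mu>\<^sup>(\<^sup>\<omega>\<^sup>)\<close>\<close>

definition borel_of :: "'a topology \<Rightarrow> 'a measure" where
  "borel_of X = sigma (topspace X) {S. openin X S}"

definition regular_borel_prob :: "'a topology \<Rightarrow> 'a measure \<Rightarrow> bool" where
  "regular_borel_prob X P \<longleftrightarrow> prob_space P \<and> space P = topspace X \<and> sets P = sets (borel_of X) \<and>
     (\<forall>B\<in>sets P. \<forall>\<epsilon>>0. \<exists>K G. closedin X K \<and> openin X G \<and> K \<subseteq> B \<and> B \<subseteq> G \<and>
        measure P (G - K) < \<epsilon>)"

text \<open>Pushforward of a measure on a space of types along the restriction map to \<open>S\<^sub>V(A)\<close>.\<close>

definition marginal :: "('f, 'r, 'u) model \<Rightarrow> 'u set \<Rightarrow> nat set \<Rightarrow>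
    (nat \<Rightarrow> 'u) set set measure \<Rightarrow> (nat \<Rightarrow> 'u) set set measure" where
  "marginal U A V P = distr P (borel_of (type_space U A V)) (\<lambda>p. p \<inter> Def U A V)"

text \<open>
  For \<open>q\<close> a type over \<open>N\<close> in the free variables of \<open>\<phi>\<close> other than \<open>x\<close>, this is \<open>\<mu>(\<phi>(x;b))\<close> for
  some (equivalently any, if \<open>\<mu>\<close> is \<open>N\<close>-invariant) realization \<open>b\<close> of \<open>q\<close>.
\<close>

definition fiber_measure :: "('f, 'r, 'u) model \<Rightarrow> ('u set \<Rightarrow> real) \<Rightarrow> ('f, 'r, 'u) fm \<Rightarrow> nat \<Rightarrow>
    (nat \<Rightarrow> 'u) set set \<Rightarrow> real" where
  "fiber_measure U \<mu> \<phi> x q = \<mu> (fiber U \<phi> x (SOME b. b \<in> \<Inter>q))"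

text \<open>
  \<open>\<rho> = \<mu>(x) \<otimes> \<nu>\<close> where \<open>\<nu>\<close> is a measure in the variables \<open>V\<close> and \<open>x \<notin> V\<close>:
  \<open>(\<mu> \<otimes> \<nu>)(\<phi>)\<close> is the integral over \<open>S\<^sub>V(N)\<close>, with respect to the restriction of \<open>\<nu>\<close> to \<open>N\<close>,
  of the function \<open>tp(b/N) \<mapsto> \<mu>(\<phi>(x;b))\<close>, for any small model \<open>N\<close> containing the parameters of
  \<open>\<phi>\<close> over which \<open>\<mu>\<close> is definable.
\<close>

definition is_morley_product :: "('f, 'r, 'u) model \<Rightarrow> 'k rel \<Rightarrow> ('u set \<Rightarrow> real) \<Rightarrow> nat \<Rightarrow> nat set \<Rightarrow>
    (nat \<Rightarrow> 'u) set set measure \<Rightarrow> (nat \<Rightarrow> 'u) set set measure \<Rightarrow> bool" where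
  "is_morley_product U \<kappa> \<mu> x V \<nu> \<rho> \<longleftrightarrow>
     (\<forall>N \<phi>. definable_over U \<kappa> N \<mu> \<longrightarrow> fm_over U N \<phi> \<longrightarrow> fv \<phi> \<subseteq> insert x V \<longrightarrow>
        measure \<rho> (clopen U UNIV (insert x V) {a. true_in U \<phi> a}) =
        (\<integral>q. fiber_measure U \<mu> \<phi> x q \<partial>marginal U N V \<nu>))"

text \<open>
  The variables \<open>x\<^sub>1, x\<^sub>2, \<dots>\<close> are the variables with index at least \<open>1\<close>.  The regular Borel
  probability measure \<open>\<mu>\<^sup>(\<^sup>\<omega>\<^sup>)\<close> is characterized by its finite marginals: the first is \<open>\<mu>(x\<^sub>1)\<close>, and
  \<open>\<mu>\<^sup>(\<^sup>n\<^sup>+\<^sup>1\<^sup>)(x\<^sub>1,\<dots>,x\<^sub>n\<^sub>+\<^sub>1) = \<mu>(x\<^sub>n\<^sub>+\<^sub>1) \<otimes> \<mu>\<^sup>(\<^sup>n\<^sup>)(x\<^sub>1,\<dots>,x\<^sub>n)\<close>.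
\<close>

definition is_morley_power_omega :: "('f, 'r, 'u) model \<Rightarrow> 'k rel \<Rightarrow> ('u set \<Rightarrow> real) \<Rightarrow>
    (nat \<Rightarrow> 'u) set set measure \<Rightarrow> bool" where
  "is_morley_power_omega U \<kappa> \<mu> P \<longleftrightarrow> regular_borel_prob (type_space U UNIV {1..}) P \<and>
     (\<forall>\<phi>. fm_over U UNIV \<phi> \<longrightarrow> fv \<phi> \<subseteq> {1} \<longrightarrow>
        measure (marginal U UNIV {1} P) (clopen U UNIV {1} {a. true_in U \<phi> a}) =
        \<mu> {a. true_in U \<phi> (\<lambda>_. a)}) \<and>
     (\<forall>n\<ge>1. is_morley_product U \<kappa> \<mu> (Suc n) {1..n}
        (marginal U UNIV {1..n} P) (marginal U UNIV (insert (Suc n) {1..n}) P))"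


section \<open>Model-theoretic events\<close>

text \<open>
  The following are the subsets of \<open>U\<^sup>k\<close> defined by \<open>O\<^sub>k\<close>, \<open>I\<^sub>k\<close>, \<open>L\<^sub>k\<close>; that they are \<open>\<emptyset>\<close>-definable is
  verified in \<open>order_set_Def\<close>, \<open>shatter_set_Def\<close>, \<open>chain_set_Def\<close> below.
\<close>

definition order_set ::
    "('f, 'r, 'u) model \<Rightarrow> ('f, 'r, 'u) fm \<Rightarrow> nat \<Rightarrow> nat \<Rightarrow> (nat \<Rightarrow> 'u) set" where
  "order_set U \<phi> x k = {a. \<exists>b :: nat \<Rightarrow> nat \<Rightarrow> 'u. \<forall>i\<in>{1..k}. \<forall>j\<in>{1..k}.
     true_in U \<phi> ((b j)(x := a i)) \<longleftrightarrow> i > j}"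

definition shatter_set ::
    "('f, 'r, 'u) model \<Rightarrow> ('f, 'r, 'u) fm \<Rightarrow> nat \<Rightarrow> nat \<Rightarrow> (nat \<Rightarrow> 'u) set" where
  "shatter_set U \<phi> x k = {a. \<forall>I\<subseteq>{1..k}. \<exists>b :: nat \<Rightarrow> 'u. \<forall>i\<in>{1..k}.
     true_in U \<phi> (b(x := a i)) \<longleftrightarrow> i \<in> I}"

definition chain_set ::
    "('f, 'r, 'u) model \<Rightarrow> ('f, 'r, 'u) fm \<Rightarrow> nat \<Rightarrow> nat \<Rightarrow> (nat \<Rightarrow> 'u) set" where
  "chain_set U \<phi> x k = {a. \<forall>i\<in>{1..<k}.
     {b :: nat \<Rightarrow> 'u. true_in U \<phi> (b(x := a i))} \<subset> {b. true_in U \<phi> (b(x := a (Suc i)))}}"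

abbreviation event ::
    "('f, 'r, 'u) model \<Rightarrow> (nat \<Rightarrow> 'u) set \<Rightarrow> (nat \<Rightarrow> 'u) set set set" where
  "event U D \<equiv> clopen U UNIV {1..} D"

definition O_event ::
    "('f, 'r, 'u) model \<Rightarrow> ('f, 'r, 'u) fm \<Rightarrow> nat \<Rightarrow> (nat \<Rightarrow> 'u) set set set" where
  "O_event U \<phi> x = (\<Inter>k\<in>{1..}. event U (order_set U \<phi> x k))"

definition I_event ::
    "('f, 'r, 'u) model \<Rightarrow> ('f, 'r, 'u) fm \<Rightarrow> nat \<Rightarrow> (nat \<Rightarrow> 'u) set set set" where
  "I_event U \<phi> x = (\<Inter>k\<in>{1..}. event U (shatter_set U \<phi> x k))"

definition L_event ::
    "('f, 'r, 'u) model \<Rightarrow> ('f, 'r, 'u) fm \<Rightarrow> nat \<Rightarrow> (nat \<Rightarrow> 'u) set set set" where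
  "L_event U \<phi> x = (\<Inter>k\<in>{1..}. event U (chain_set U \<phi> x k))"


subsection \<open>Definability of the events\<close>

lemma finite_tvars: "finite (tvars t)"
  by (induction t) auto

lemma finite_fv: "finite (fv \<phi>)"
  by (induction \<phi>) (auto simp: finite_tvars)

lemma tval_cong: "(\<And>i. i \<in> tvars t \<Longrightarrow> v i = w i) \<Longrightarrow> tval U v t = tval U w t"
proof (induction t)
  case (Fn f ts)
  have "map (tval U v) ts = map (tval U w) ts"
    using Fn by (intro map_cong refl) auto
  then show ?case by (simp only: tval.simps)
qed auto

lemma sat_cong: "(\<And>i. i \<in> fv \<phi> \<Longrightarrow> v i = w i) \<Longrightarrow> sat U D \<phi> v \<longleftrightarrow> sat U D \<phi> w"
proof (induction \<phi> arbitrary: v w)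
  case (FEq s t)
  then show ?case using tval_cong[of s v w U] tval_cong[of t v w U] by simp
next
  case (FRel R ts)
  have "map (tval U v) ts = map (tval U w) ts"
    using FRel by (auto intro!: tval_cong)
  then show ?case by (simp only: sat.simps)
next
  case (FNeg \<phi>)
  then show ?case by (metis fv.simps(3) sat.simps(3))
next
  case (FConj \<phi> \<psi>)
  then show ?case by (metis UnCI fv.simps(4) sat.simps(4))
next
  case (FEx i \<phi>)
  have "sat U D \<phi> (v(i := c)) \<longleftrightarrow> sat U D \<phi> (w(i := c))" for c
    by (rule FEx.IH) (use FEx.prems in auto)
  then show ?case by simp
qed

fun tsubst :: "(nat \<Rightarrow> nat) \<Rightarrow> ('f, 'c) trm \<Rightarrow> ('f, 'c) trm" where
  "tsubst r (Var i) = Var (r i)"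
| "tsubst r (Cst c) = Cst c"
| "tsubst r (Fn f ts) = Fn f (map (tsubst r) ts)"

lemma tval_tsubst: "tval U v (tsubst r t) = tval U (\<lambda>i. v (r i)) t"
proof (induction t)
  case (Fn f ts)
  then have "map (tval U v \<circ> tsubst r) ts = map (tval U (\<lambda>i. v (r i))) ts"
    by simp
  then show ?case by (simp only: tval.simps tsubst.simps map_map)
qed auto

lemma trm_over_tsubst: "trm_over U A t \<Longrightarrow> trm_over U A (tsubst r t)"
  by (induction t) auto

lemma ex_subst:
  assumes "fm_over U A \<phi>"
  shows "\<exists>\<psi>. fm_over U A \<psi> \<and> (\<forall>v. true_in U \<psi> v \<longleftrightarrow> true_in U \<phi> (\<lambda>i. v (r i)))"
  using assms
proof (induction \<phi> arbitrary: r)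
  case (FEq s t)
  then show ?case
    by (intro exI[of _ "FEq (tsubst r s) (tsubst r t)"]) (auto simp: tval_tsubst trm_over_tsubst)
next
  case (FRel R ts)
  have "map (tval U v \<circ> tsubst r) ts = map (tval U (\<lambda>i. v (r i))) ts" for v
    by (simp add: tval_tsubst)
  then have "true_in U (FRel R (map (tsubst r) ts)) v \<longleftrightarrow> true_in U (FRel R ts) (\<lambda>i. v (r i))" for v
    by (simp only: sat.simps map_map)
  moreover have "fm_over U A (FRel R (map (tsubst r) ts))"
    using FRel by (auto simp: trm_over_tsubst)
  ultimately show ?case by blast
next
  case (FNeg \<phi>)
  then obtain \<psi> where "fm_over U A \<psi>" "\<forall>v. true_in U \<psi> v \<longleftrightarrow> true_in U \<phi> (\<lambda>i. v (r i))"
    by fastforce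
  then show ?case by (intro exI[of _ "FNeg \<psi>"]) simp
next
  case (FConj \<phi>1 \<phi>2)
  then obtain \<psi>1 \<psi>2 where "fm_over U A \<psi>1" "\<forall>v. true_in U \<psi>1 v \<longleftrightarrow> true_in U \<phi>1 (\<lambda>i. v (r i))"
      "fm_over U A \<psi>2" "\<forall>v. true_in U \<psi>2 v \<longleftrightarrow> true_in U \<phi>2 (\<lambda>i. v (r i))"
    by (metis fm_over.simps(4))
  then show ?case by (intro exI[of _ "FConj \<psi>1 \<psi>2"]) simp
next
  case (FEx j \<phi>)
  obtain z where z: "z \<notin> r ` fv \<phi>"
    using ex_new_if_finite[OF infinite_UNIV_nat] finite_fv by blast
  obtain \<psi> where \<psi>: "fm_over U A \<psi>"
      "\<forall>v. true_in U \<psi> v \<longleftrightarrow> true_in U \<phi> (\<lambda>i. v ((r(j := z)) i))"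
    using FEx.IH[of "r(j := z)"] FEx.prems by auto
  have "true_in U \<phi> (\<lambda>i. (v(z := c)) ((r(j := z)) i)) \<longleftrightarrow> true_in U \<phi> ((\<lambda>i. v (r i))(j := c))" for v c
    by (rule sat_cong) (use z in auto)
  with \<psi> show ?case by (intro exI[of _ "FEx z \<psi>"]) simp
qed

lemma Def_subst: "D \<in> Def U A UNIV \<Longrightarrow> {a. (\<lambda>i. a (r i)) \<in> D} \<in> Def U A UNIV"
  unfolding Def_def using ex_subst by fastforce

lemma Def_UNIV: "UNIV \<in> Def U A V"
  unfolding Def_def
  by (intro CollectI exI[of _ "FEx 0 (FEq (Var 0) (Var 0))"]) auto

lemma Def_Compl:
  assumes "D \<in> Def U A V"
  shows "- D \<in> Def U A V"
proof -
  obtain \<phi> where "fm_over U A \<phi>" "fv \<phi> \<subseteq> V" "D = {a. true_in U \<phi> a}"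
    using assms unfolding Def_def by auto
  then show ?thesis
    unfolding Def_def by (intro CollectI exI[of _ "FNeg \<phi>"]) auto
qed

lemma Def_Int:
  assumes "D \<in> Def U A V" "E \<in> Def U A V"
  shows "D \<inter> E \<in> Def U A V"
proof -
  obtain \<phi> \<psi> where "fm_over U A \<phi>" "fv \<phi> \<subseteq> V" "D = {a. true_in U \<phi> a}"
      "fm_over U A \<psi>" "fv \<psi> \<subseteq> V" "E = {a. true_in U \<psi> a}"
    using assms unfolding Def_def by auto
  then show ?thesis
    unfolding Def_def by (intro CollectI exI[of _ "FConj \<phi> \<psi>"]) auto
qed

lemma Def_INT: "finite I \<Longrightarrow> (\<And>i. i \<in> I \<Longrightarrow> D i \<in> Def U A V) \<Longrightarrow> (\<Inter>i\<in>I. D i) \<in> Def U A V"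
  by (induction I rule: finite_induct) (auto simp: Def_UNIV Def_Int)

lemma Def_Ex:
  assumes "D \<in> Def U A (insert i V)"
  shows "{a. \<exists>c. a(i := c) \<in> D} \<in> Def U A (V - {i})"
proof -
  obtain \<phi> where "fm_over U A \<phi>" "fv \<phi> \<subseteq> insert i V" "D = {a. true_in U \<phi> a}"
    using assms unfolding Def_def by auto
  then show ?thesis
    unfolding Def_def by (intro CollectI exI[of _ "FEx i \<phi>"]) auto
qed

lemma Def_Ex_block:
  assumes "finite W" "D \<in> Def U A V"
  shows "{a. \<exists>b. override_on a b W \<in> D} \<in> Def U A (V - W)"
  using assms
proof (induction W rule: finite_induct)
  case (insert i W)
  have "{a. \<exists>b. override_on a b (insert i W) \<in> D} =
      {a. \<exists>c. a(i := c) \<in> {a. \<exists>b. override_on a b W \<in> D}}"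
  proof (intro set_eqI iffI; clarsimp)
    fix a b assume "override_on a b (insert i W) \<in> D"
    moreover have "override_on a b (insert i W) = override_on (a(i := b i)) b W"
      by (auto simp: override_on_def fun_eq_iff)
    ultimately show "\<exists>c b. override_on (a(i := c)) b W \<in> D" by metis
  next
    fix a c b assume "override_on (a(i := c)) b W \<in> D"
    moreover have "override_on (a(i := c)) b W = override_on a (b(i := c)) (insert i W)"
      using insert.hyps by (auto simp: override_on_def fun_eq_iff)
    ultimately show "\<exists>b. override_on a b (insert i W) \<in> D" by metis
  qed
  moreover have "{a. \<exists>c. a(i := c) \<in> {a. \<exists>b. override_on a b W \<in> D}} \<in> Def U A (V - W - {i})"
  proof (rule Def_Ex)
    have "Def U A (V - W) \<subseteq> Def U A (insert i (V - W))"
      unfolding Def_def by blast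
    then show "{a. \<exists>b. override_on a b W \<in> D} \<in> Def U A (insert i (V - W))"
      using insert by blast
  qed
  moreover have "V - W - {i} = V - insert i W" by auto
  ultimately show ?case by simp
qed (auto simp: override_on_def)

lemma Def_support:
  assumes "D \<in> Def U A UNIV" and supp: "\<And>a b. (\<And>i. i \<in> V \<Longrightarrow> a i = b i) \<Longrightarrow> a \<in> D \<Longrightarrow> b \<in> D"
  shows "D \<in> Def U A V"
proof -
  obtain \<phi> where \<phi>: "fm_over U A \<phi>" "D = {a. true_in U \<phi> a}"
    using assms(1) unfolding Def_def by auto
  have "D \<in> Def U A (fv \<phi>)" unfolding Def_def using \<phi> by auto
  then have "{a. \<exists>b. override_on a b (fv \<phi> - V) \<in> D} \<in> Def U A (fv \<phi> - (fv \<phi> - V))"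
    by (intro Def_Ex_block) (auto simp: finite_fv)
  moreover have "{a. \<exists>b. override_on a b (fv \<phi> - V) \<in> D} = D"
  proof (intro set_eqI iffI; clarsimp)
    fix a b assume "override_on a b (fv \<phi> - V) \<in> D"
    then show "a \<in> D" by (rule supp[rotated]) (auto simp: override_on_def)
  next
    fix a assume "a \<in> D"
    then show "\<exists>b. override_on a b (fv \<phi> - V) \<in> D"
      by (intro exI[of _ a]) (simp add: override_on_def)
  qed
  moreover have "Def U A (fv \<phi> - (fv \<phi> - V)) \<subseteq> Def U A V"
    unfolding Def_def by blast
  ultimately show ?thesis by auto
qed

lemma Def_Ex_all:
  assumes "{c. Q (\<lambda>n. c (2 * n)) (\<lambda>n. c (2 * n + 1))} \<in> Def U A UNIV"
  shows "{a. \<exists>b. Q a b} \<in> Def U A UNIV"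
proof -
  let ?D = "{c. Q (\<lambda>n. c (2 * n)) (\<lambda>n. c (2 * n + 1))}"
  obtain \<phi> where \<phi>: "fm_over U A \<phi>" "?D = {a. true_in U \<phi> a}"
    using assms unfolding Def_def by auto
  have Q: "Q a b \<longleftrightarrow> true_in U \<phi> (\<lambda>n. if even n then a (n div 2) else b (n div 2))" (is "_ \<longleftrightarrow> true_in U \<phi> ?c") for a b
  proof -
    have "Q a b \<longleftrightarrow> ?c \<in> ?D" by simp
    then show ?thesis by (simp only: \<phi>(2) mem_Collect_eq)
  qed
  define W where "W = {n \<in> fv \<phi>. odd n}"
  have "finite W" unfolding W_def by (rule finite_subset[OF _ finite_fv[of \<phi>]]) auto
  then have "{c. \<exists>b. override_on c b W \<in> ?D} \<in> Def U A (UNIV - W)"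
    by (intro Def_Ex_block assms)
  then have "{c. \<exists>b. override_on c b W \<in> ?D} \<in> Def U A UNIV"
    unfolding Def_def by blast
  then have "{a. (\<lambda>n. a (n div 2)) \<in> {c. \<exists>b. override_on c b W \<in> ?D}} \<in> Def U A UNIV"
    by (rule Def_subst)
  moreover have "{a. (\<lambda>n. a (n div 2)) \<in> {c. \<exists>b. override_on c b W \<in> ?D}} = {a. \<exists>b. Q a b}"
  proof (intro set_eqI iffI; clarsimp simp only: mem_Collect_eq)
    fix a b
    assume "Q (\<lambda>n. override_on (\<lambda>n. a (n div 2)) b W (2 * n)) (\<lambda>n. override_on (\<lambda>n. a (n div 2)) b W (2 * n + 1))"
    moreover have "(\<lambda>n. override_on (\<lambda>n. a (n div 2)) b W (2 * n)) = a"
      by (auto simp: override_on_def W_def)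
    ultimately show "\<exists>b. Q a b" by auto
  next
    fix a b assume "Q a b"
    let ?b = "\<lambda>n. b (n div 2)"
    have "true_in U \<phi> (override_on (\<lambda>n. a (n div 2)) ?b W) \<longleftrightarrow>
        true_in U \<phi> (\<lambda>n. if even n then a (n div 2) else b (n div 2))"
      by (rule sat_cong) (auto simp: override_on_def W_def)
    with \<open>Q a b\<close> have "override_on (\<lambda>n. a (n div 2)) ?b W \<in> ?D"
      unfolding \<phi>(2) using Q by simp
    then show "\<exists>b. Q (\<lambda>n. override_on (\<lambda>n. a (n div 2)) b W (2 * n)) (\<lambda>n. override_on (\<lambda>n. a (n div 2)) b W (2 * n + 1))"
      by auto
  qed
  ultimately show ?thesis by simp
qed

lemma Def_true_in:
  assumes "fm_over U A \<phi>"
  shows "{c. true_in U \<phi> (\<lambda>i. c (r i))} \<in> Def U A UNIV"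
proof -
  have "{a. true_in U \<phi> a} \<in> Def U A UNIV" unfolding Def_def using assms by auto
  from Def_subst[OF this, of r] show ?thesis by simp
qed

lemma Def_iff: "{c. Q c} \<in> Def U A V \<Longrightarrow> {c. Q c \<longleftrightarrow> B} \<in> Def U A V"
  using Def_Compl[of "{c. Q c}" U A V] by (cases B) (auto simp: Collect_neg_eq)

lemma upd_eq: "(\<lambda>l. b l)(x := c) = (\<lambda>l. if l = x then c else b l)"
  by (auto simp: fun_eq_iff)

lemma order_set_Def:
  fixes U :: "('f, 'r, 'u) model"
  assumes "L_formula U \<phi>"
  shows "order_set U \<phi> x k \<in> Def U {} {1..k}"
proof (rule Def_support)
  let ?Q = "\<lambda>a b. \<forall>i\<in>{1..k}. \<forall>j\<in>{1..k}.
     true_in U \<phi> (\<lambda>l. if l = x then a i else b (prod_encode (j, l))) \<longleftrightarrow> i > j"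
  have "{c. ?Q (\<lambda>n. c (2 * n)) (\<lambda>n. c (2 * n + 1))} = (\<Inter>i\<in>{1..k}. \<Inter>j\<in>{1..k}.
     {c. true_in U \<phi> (\<lambda>l. c (if l = x then 2 * i else 2 * prod_encode (j, l) + 1)) \<longleftrightarrow> i > j})"
    by (auto simp: if_distrib cong: if_cong)
  also have "\<dots> \<in> Def U {} UNIV"
    by (intro Def_INT Def_iff Def_true_in assms) auto
  finally have "{a. \<exists>b. ?Q a b} \<in> Def U {} UNIV"
    by (rule Def_Ex_all)
  moreover have "order_set U \<phi> x k = {a. \<exists>b. ?Q a b}"
  proof (intro set_eqI iffI; clarsimp simp only: order_set_def mem_Collect_eq)
    fix a and b :: "nat \<Rightarrow> nat \<Rightarrow> 'u"
    assume "\<forall>i\<in>{1..k}. \<forall>j\<in>{1..k}. true_in U \<phi> ((b j)(x := a i)) \<longleftrightarrow> i > j"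
    then have "?Q a (\<lambda>n. b (fst (prod_decode n)) (snd (prod_decode n)))"
      by (simp add: upd_eq prod_encode_inverse cong: if_cong)
    then show "\<exists>b. ?Q a b"
      by (intro exI[of _ "\<lambda>n. b (fst (prod_decode n)) (snd (prod_decode n))"])
  next
    fix a and b :: "nat \<Rightarrow> 'u"
    assume "?Q a b"
    then show "\<exists>b. \<forall>i\<in>{1..k}. \<forall>j\<in>{1..k}. true_in U \<phi> ((b j)(x := a i)) \<longleftrightarrow> i > j"
      by (intro exI[of _ "\<lambda>j l. b (prod_encode (j, l))"]) (simp add: upd_eq)
  qed
  ultimately show "order_set U \<phi> x k \<in> Def U {} UNIV" by simp
qed (auto simp: order_set_def)

lemma shatter_set_Def:
  fixes U :: "('f, 'r, 'u) model"
  assumes "L_formula U \<phi>"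
  shows "shatter_set U \<phi> x k \<in> Def U {} {1..k}"
proof (rule Def_support)
  have "{a. \<exists>b :: nat \<Rightarrow> 'u. \<forall>i\<in>{1..k}. true_in U \<phi> (b(x := a i)) \<longleftrightarrow> i \<in> I} \<in> Def U {} UNIV" for I
  proof (rule Def_Ex_all)
    have "{c. \<forall>i\<in>{1..k}. true_in U \<phi> ((\<lambda>n. c (2 * n + 1))(x := c (2 * i))) \<longleftrightarrow> i \<in> I} =
      (\<Inter>i\<in>{1..k}. {c. true_in U \<phi> (\<lambda>l. c (if l = x then 2 * i else 2 * l + 1)) \<longleftrightarrow> i \<in> I})"
      by (auto simp: upd_eq if_distrib cong: if_cong)
    also have "\<dots> \<in> Def U {} UNIV"
      by (intro Def_INT Def_iff Def_true_in assms) auto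
    finally show "{c. \<forall>i\<in>{1..k}. true_in U \<phi> ((\<lambda>n. c (2 * n + 1))(x := c (2 * i))) \<longleftrightarrow> i \<in> I}
      \<in> Def U {} UNIV" .
  qed
  then have "(\<Inter>I\<in>Pow {1..k}. {a. \<exists>b :: nat \<Rightarrow> 'u. \<forall>i\<in>{1..k}. true_in U \<phi> (b(x := a i)) \<longleftrightarrow> i \<in> I})
      \<in> Def U {} UNIV"
    by (intro Def_INT) auto
  moreover have "shatter_set U \<phi> x k =
      (\<Inter>I\<in>Pow {1..k}. {a. \<exists>b :: nat \<Rightarrow> 'u. \<forall>i\<in>{1..k}. true_in U \<phi> (b(x := a i)) \<longleftrightarrow> i \<in> I})"
    unfolding shatter_set_def by blast
  ultimately show "shatter_set U \<phi> x k \<in> Def U {} UNIV" by simp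
qed (auto simp: shatter_set_def)

lemma chain_set_Def:
  fixes U :: "('f, 'r, 'u) model"
  assumes "L_formula U \<phi>"
  shows "chain_set U \<phi> x k \<in> Def U {} {1..k}"
proof (rule Def_support)
  have E: "{a. \<exists>b :: nat \<Rightarrow> 'u. true_in U \<phi> (b(x := a i)) \<and> \<not> true_in U \<phi> (b(x := a j))}
      \<in> Def U {} UNIV" for i j
  proof (rule Def_Ex_all)
    have "{c. true_in U \<phi> ((\<lambda>n. c (2 * n + 1))(x := c (2 * i))) \<and>
           \<not> true_in U \<phi> ((\<lambda>n. c (2 * n + 1))(x := c (2 * j)))} =
      {c. true_in U \<phi> (\<lambda>l. c (if l = x then 2 * i else 2 * l + 1))} \<inter>
      - {c. true_in U \<phi> (\<lambda>l. c (if l = x then 2 * j else 2 * l + 1))}"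
      by (auto simp: upd_eq if_distrib cong: if_cong)
    also have "\<dots> \<in> Def U {} UNIV"
      by (intro Def_Int Def_Compl Def_true_in assms)
    finally show "{c. true_in U \<phi> ((\<lambda>n. c (2 * n + 1))(x := c (2 * i))) \<and>
           \<not> true_in U \<phi> ((\<lambda>n. c (2 * n + 1))(x := c (2 * j)))} \<in> Def U {} UNIV" .
  qed
  have "chain_set U \<phi> x k = (\<Inter>i\<in>{1..<k}.
      - {a. \<exists>b :: nat \<Rightarrow> 'u. true_in U \<phi> (b(x := a i)) \<and> \<not> true_in U \<phi> (b(x := a (Suc i)))} \<inter>
      {a. \<exists>b :: nat \<Rightarrow> 'u. true_in U \<phi> (b(x := a (Suc i))) \<and> \<not> true_in U \<phi> (b(x := a i))})"
    unfolding chain_set_def psubset_eq by blast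
  also have "\<dots> \<in> Def U {} UNIV"
    by (intro Def_INT Def_Int Def_Compl E) auto
  finally show "chain_set U \<phi> x k \<in> Def U {} UNIV" .
qed (auto simp: chain_set_def)


section \<open>Continuous logic for randomizations\<close>

text \<open>
  A structure in the language of randomizations with universe the whole type \<open>'c\<close> is given by the
  values \<open>Pr \<phi> v\<close> of the predicates \<open>\<bbbP>\<lbrakk>\<phi>(v)\<rbrakk>\<close>, one for each classical \<open>L\<close>-formula \<open>\<phi>\<close>.
  The metric is the predicate for \<open>v\<^sub>0 \<noteq> v\<^sub>1\<close>.
\<close>

type_synonym ('f, 'r, 'u, 'c) rstruct = "('f, 'r, 'u) fm \<Rightarrow> (nat \<Rightarrow> 'c) \<Rightarrow> real"

definition rdist :: "('f, 'r, 'u, 'c) rstruct \<Rightarrow> 'c \<Rightarrow> 'c \<Rightarrow> real" where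
  "rdist Pr c c' = Pr (FNeg (FEq (Var 0) (Var 1))) (\<lambda>i. if i = 0 then c else c')"

definition rstructure :: "('f, 'r, 'u) model \<Rightarrow> ('f, 'r, 'u, 'c) rstruct \<Rightarrow> bool" where
  "rstructure U Pr \<longleftrightarrow> Metric_space UNIV (rdist Pr) \<and> Metric_space.mcomplete UNIV (rdist Pr) \<and>
     (\<forall>\<phi> v. L_formula U \<phi> \<longrightarrow> Pr \<phi> v \<in> {0..1}) \<and>
     (\<forall>\<phi> v w. L_formula U \<phi> \<longrightarrow> \<bar>Pr \<phi> v - Pr \<phi> w\<bar> \<le> (\<Sum>i\<in>fv \<phi>. rdist Pr (v i) (w i)))"

text \<open>
  An \<open>n\<close>-ary connective \<open>[0,1]\<^sup>n \<rightarrow> [0,1]\<close> is represented by a continuous function of infinitely many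
  arguments, the unused ones being filled up with \<open>0\<close>.
\<close>

datatype ('f, 'r, 'u) cfm =
    CProb "('f, 'r, 'u) fm"
  | CConn "(nat \<Rightarrow> real) \<Rightarrow> real" "('f, 'r, 'u) cfm list"
  | CSup nat "('f, 'r, 'u) cfm"
  | CInf nat "('f, 'r, 'u) cfm"

fun cfm_wf :: "('f, 'r, 'u) model \<Rightarrow> ('f, 'r, 'u) cfm \<Rightarrow> bool" where
  "cfm_wf U (CProb \<phi>) \<longleftrightarrow> L_formula U \<phi>"
| "cfm_wf U (CConn u \<psi>s) \<longleftrightarrow> continuous_on {t. \<forall>i. t i \<in> {0..1}} u \<and>
     (\<forall>t. (\<forall>i. t i \<in> {0..1}) \<longrightarrow> u t \<in> {0..1}) \<and> (\<forall>\<psi>\<in>set \<psi>s. cfm_wf U \<psi>)"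
| "cfm_wf U (CSup i \<psi>) \<longleftrightarrow> cfm_wf U \<psi>"
| "cfm_wf U (CInf i \<psi>) \<longleftrightarrow> cfm_wf U \<psi>"

fun cfv :: "('f, 'r, 'u) cfm \<Rightarrow> nat set" where
  "cfv (CProb \<phi>) = fv \<phi>"
| "cfv (CConn u \<psi>s) = (\<Union>\<psi>\<in>set \<psi>s. cfv \<psi>)"
| "cfv (CSup i \<psi>) = cfv \<psi> - {i}"
| "cfv (CInf i \<psi>) = cfv \<psi> - {i}"

text \<open>Value of a formula in the substructure with universe \<open>N\<close>.\<close>

fun cval :: "('f, 'r, 'u, 'c) rstruct \<Rightarrow> 'c set \<Rightarrow> ('f, 'r, 'u) cfm \<Rightarrow> (nat \<Rightarrow> 'c) \<Rightarrow> real" where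
  "cval Pr N (CProb \<phi>) v = Pr \<phi> v"
| "cval Pr N (CConn u \<psi>s) v = u (\<lambda>i. if i < length \<psi>s then map (\<lambda>\<psi>. cval Pr N \<psi> v) \<psi>s ! i else 0)"
| "cval Pr N (CSup i \<psi>) v = (SUP c\<in>N. cval Pr N \<psi> (v(i := c)))"
| "cval Pr N (CInf i \<psi>) v = (INF c\<in>N. cval Pr N \<psi> (v(i := c)))"

abbreviation cvalue :: "('f, 'r, 'u, 'c) rstruct \<Rightarrow> ('f, 'r, 'u) cfm \<Rightarrow> (nat \<Rightarrow> 'c) \<Rightarrow> real" where
  "cvalue Pr \<psi> v \<equiv> cval Pr UNIV \<psi> v"

definition celem_sub :: "('f, 'r, 'u) model \<Rightarrow> ('f, 'r, 'u, 'c) rstruct \<Rightarrow> 'c set \<Rightarrow> bool" where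
  "celem_sub U Pr N \<longleftrightarrow> N \<noteq> {} \<and> closedin (Metric_space.mtopology UNIV (rdist Pr)) N \<and>
     (\<forall>\<psi> v. cfm_wf U \<psi> \<longrightarrow> range v \<subseteq> N \<longrightarrow> cval Pr N \<psi> v = cvalue Pr \<psi> v)"

text \<open>
  The predicates \<open>c \<mapsto> \<psi>(c;g)\<close> of one variable with parameters \<open>g\<close> from \<open>A\<close>.
\<close>

definition cdef :: "('f, 'r, 'u) model \<Rightarrow> ('f, 'r, 'u, 'c) rstruct \<Rightarrow> 'c set \<Rightarrow> ('c \<Rightarrow> real) set" where
  "cdef U Pr A = {(\<lambda>c. cvalue Pr \<psi> (g(x := c))) | \<psi> x g. cfm_wf U \<psi> \<and> g ` (cfv \<psi> - {x}) \<subseteq> A}"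

definition csaturated :: "('f, 'r, 'u) model \<Rightarrow> ('f, 'r, 'u, 'c) rstruct \<Rightarrow> 'k rel \<Rightarrow> bool" where
  "csaturated U Pr \<kappa> \<longleftrightarrow> (\<forall>A q. small \<kappa> A \<longrightarrow> q \<subseteq> cdef U Pr A \<longrightarrow>
     (\<forall>F. finite F \<longrightarrow> F \<subseteq> q \<longrightarrow> (\<forall>\<epsilon>>0. \<exists>c. \<forall>D\<in>F. D c \<le> \<epsilon>)) \<longrightarrow> (\<exists>c. \<forall>D\<in>q. D c = 0))"

definition cstrongly_homogeneous ::
    "('f, 'r, 'u) model \<Rightarrow> ('f, 'r, 'u, 'c) rstruct \<Rightarrow> 'k rel \<Rightarrow> bool" where
  "cstrongly_homogeneous U Pr \<kappa> \<longleftrightarrow> (\<forall>A h. small \<kappa> A \<longrightarrow>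
     (\<forall>\<psi> v. cfm_wf U \<psi> \<longrightarrow> range v \<subseteq> A \<longrightarrow> cvalue Pr \<psi> (h \<circ> v) = cvalue Pr \<psi> v) \<longrightarrow>
     (\<exists>\<sigma>. bij \<sigma> \<and> (\<forall>\<phi> v. L_formula U \<phi> \<longrightarrow> Pr \<phi> (\<sigma> \<circ> v) = Pr \<phi> v) \<and> (\<forall>a\<in>A. \<sigma> a = h a)))"

definition cmonster :: "('f, 'r, 'u) model \<Rightarrow> ('f, 'r, 'u, 'c) rstruct \<Rightarrow> 'k rel \<Rightarrow> bool" where
  "cmonster U Pr \<kappa> \<longleftrightarrow> uncountable_cardinal \<kappa> \<and> rstructure U Pr \<and> csaturated U Pr \<kappa> \<and>
     cstrongly_homogeneous U Pr \<kappa>"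

text \<open>
  A global type in one variable assigns a value to every predicate with parameters; consistency
  amounts to approximate finite satisfiability.  As for measures, values on functions that are not
  such predicates are irrelevant.
\<close>

definition global_ctype ::
    "('f, 'r, 'u) model \<Rightarrow> ('f, 'r, 'u, 'c) rstruct \<Rightarrow> (('c \<Rightarrow> real) \<Rightarrow> real) \<Rightarrow> bool" where
  "global_ctype U Pr p \<longleftrightarrow> (\<forall>F. finite F \<longrightarrow> F \<subseteq> cdef U Pr UNIV \<longrightarrow>
     (\<forall>\<epsilon>>0. \<exists>c. \<forall>D\<in>F. \<bar>D c - p D\<bar> < \<epsilon>))"

definition crealizes :: "('f, 'r, 'u) model \<Rightarrow> ('f, 'r, 'u, 'c) rstruct \<Rightarrow> 'c \<Rightarrow>
    (('c \<Rightarrow> real) \<Rightarrow> real) \<Rightarrow> 'c set \<Rightarrow> bool" where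
  "crealizes U Pr c p A \<longleftrightarrow> (\<forall>D\<in>cdef U Pr A. D c = p D)"

text \<open>The subtuples of \<open>g\<close> and \<open>g'\<close> indexed by \<open>Y\<close> have the same type over \<open>N\<close>.\<close>

definition same_ctype :: "('f, 'r, 'u) model \<Rightarrow> ('f, 'r, 'u, 'c) rstruct \<Rightarrow> 'c set \<Rightarrow> nat set \<Rightarrow>
    (nat \<Rightarrow> 'c) \<Rightarrow> (nat \<Rightarrow> 'c) \<Rightarrow> bool" where
  "same_ctype U Pr N Y g g' \<longleftrightarrow> (\<forall>\<theta> u. cfm_wf U \<theta> \<longrightarrow> range u \<subseteq> N \<longrightarrow>
     cvalue Pr \<theta> (override_on u g Y) = cvalue Pr \<theta> (override_on u g' Y))"

definition cinvariant_over :: "('f, 'r, 'u) model \<Rightarrow> ('f, 'r, 'u, 'c) rstruct \<Rightarrow> 'c set \<Rightarrow>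
    (('c \<Rightarrow> real) \<Rightarrow> real) \<Rightarrow> bool" where
  "cinvariant_over U Pr N p \<longleftrightarrow> (\<forall>\<psi> x g g'. cfm_wf U \<psi> \<longrightarrow> same_ctype U Pr N (cfv \<psi> - {x}) g g' \<longrightarrow>
     p (\<lambda>c. cvalue Pr \<psi> (g(x := c))) = p (\<lambda>c. cvalue Pr \<psi> (g'(x := c))))"

definition morley_sequence :: "('f, 'r, 'u) model \<Rightarrow> ('f, 'r, 'u, 'c) rstruct \<Rightarrow> 'c set \<Rightarrow>
    (('c \<Rightarrow> real) \<Rightarrow> real) \<Rightarrow> (nat \<Rightarrow> 'c) \<Rightarrow> bool" where
  "morley_sequence U Pr N p a \<longleftrightarrow> (\<forall>i. crealizes U Pr (a i) p (N \<union> a ` {..<i}))"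

definition generically_stable :: "('f, 'r, 'u) model \<Rightarrow> ('f, 'r, 'u, 'c) rstruct \<Rightarrow> 'c set \<Rightarrow>
    (('c \<Rightarrow> real) \<Rightarrow> real) \<Rightarrow> bool" where
  "generically_stable U Pr N p \<longleftrightarrow>
     global_ctype U Pr p \<and> celem_sub U Pr N \<and> cinvariant_over U Pr N p \<and>
     \<not> (\<exists>\<psi> x a (b :: nat \<Rightarrow> nat \<Rightarrow> 'c) r s. cfm_wf U \<psi> \<and> morley_sequence U Pr N p a \<and> r < s \<and>
          (\<forall>i j. (i \<le> j \<longrightarrow> cvalue Pr \<psi> ((b j)(x := a i)) \<le> r) \<and>
                 (i > j \<longrightarrow> cvalue Pr \<psi> ((b j)(x := a i)) \<ge> s)))"


section \<open>Randomizations and the canonical random extension\<close>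

definition atomless :: "'w measure \<Rightarrow> bool" where
  "atomless \<Omega> \<longleftrightarrow> (\<forall>A\<in>sets \<Omega>. measure \<Omega> A > 0 \<longrightarrow>
     (\<exists>B\<in>sets \<Omega>. B \<subseteq> A \<and> 0 < measure \<Omega> B \<and> measure \<Omega> B < measure \<Omega> A))"

definition simple_rvs :: "'w measure \<Rightarrow> 'u set \<Rightarrow> ('w \<Rightarrow> 'u) set" where
  "simple_rvs \<Omega> M = {f. f ` space \<Omega> \<subseteq> M \<and> finite (f ` space \<Omega>) \<and>
     (\<forall>a. {\<omega>\<in>space \<Omega>. f \<omega> = a} \<in> sets \<Omega>)}"

text \<open>
  The embedding \<open>e\<close> of \<open>U\<^sub>0\<^sup>\<Omega>\<close> into the structure given by \<open>Pr\<close> is an isometry (up to almost sure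
  equality), so in view of completeness \<open>M\<^sup>\<Omega>\<close> is the closure of the image of \<open>M\<^sub>0\<^sup>\<Omega>\<close>.
\<close>

definition randomization ::
    "('f, 'r, 'u, 'c) rstruct \<Rightarrow> 'w measure \<Rightarrow> (('w \<Rightarrow> 'u) \<Rightarrow> 'c) \<Rightarrow> 'u set \<Rightarrow> 'c set" where
  "randomization Pr \<Omega> e M = (Metric_space.mtopology UNIV (rdist Pr)) closure_of (e ` simple_rvs \<Omega> M)"

text \<open>
  \<open>U\<^sup>\<Omega> \<preceq> \<C>\<close>; in particular \<open>\<C>\<close> is a model of the complete theory \<open>T\<^sup>R = Th(U\<^sup>\<Omega>)\<close>.
\<close>

definition randomization_embedding :: "('f, 'r, 'u) model \<Rightarrow> ('f, 'r, 'u, 'c) rstruct \<Rightarrow>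
    'w measure \<Rightarrow> (('w \<Rightarrow> 'u) \<Rightarrow> 'c) \<Rightarrow> bool" where
  "randomization_embedding U Pr \<Omega> e \<longleftrightarrow>
     (\<forall>\<phi> f. L_formula U \<phi> \<longrightarrow> (\<forall>i. f i \<in> simple_rvs \<Omega> UNIV) \<longrightarrow>
        Pr \<phi> (\<lambda>i. e (f i)) = measure \<Omega> {\<omega>\<in>space \<Omega>. true_in U \<phi> (\<lambda>i. f i \<omega>)}) \<and>
     celem_sub U Pr (randomization Pr \<Omega> e UNIV)"

text \<open>
  The first clause prescribes the value of \<open>\<bbbP>\<lbrakk>\<phi>(x;g)\<rbrakk>\<close> for tuples \<open>g\<close> from \<open>M\<^sub>0\<^sup>\<Omega>\<close> of the form
  \<open>\<Sum>\<^sub>i a\<^sub>i\<^sup>A\<^sup>i\<close>, the second one for arbitrary tuples \<open>g\<close> as a limit along nets of tuples \<open>h\<close> from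
  \<open>M\<^sub>0\<^sup>\<Omega>\<close> with \<open>tp(h/M\<^sub>0\<^sup>\<Omega>) \<rightarrow> tp(g/M\<^sub>0\<^sup>\<Omega>)\<close>.  Nets are replaced by filters on the set of tuples.
  By quantifier elimination for \<open>T\<^sup>R\<close>, this determines the type \<open>p = r\<^sub>\<mu>\<close>.
\<close>

definition is_canonical_extension :: "('f, 'r, 'u) model \<Rightarrow> ('f, 'r, 'u, 'c) rstruct \<Rightarrow>
    'w measure \<Rightarrow> (('w \<Rightarrow> 'u) \<Rightarrow> 'c) \<Rightarrow> 'u set \<Rightarrow> ('u set \<Rightarrow> real) \<Rightarrow> (('c \<Rightarrow> real) \<Rightarrow> real) \<Rightarrow> bool" where
  "is_canonical_extension U Pr \<Omega> e M \<mu> p \<longleftrightarrow> global_ctype U Pr p \<and>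
     (\<forall>\<phi> x h (k :: nat) A a. L_formula U \<phi> \<longrightarrow> (\<forall>l. h l \<in> simple_rvs \<Omega> M) \<longrightarrow>
        (\<forall>i<k. A i \<in> sets \<Omega>) \<longrightarrow> disjoint_family_on A {..<k} \<longrightarrow> (\<Union>i<k. A i) = space \<Omega> \<longrightarrow>
        (\<forall>i<k. \<forall>\<omega>\<in>A i. \<forall>l\<in>fv \<phi> - {x}. h l \<omega> = a i l) \<longrightarrow> (\<forall>i<k. \<forall>l\<in>fv \<phi> - {x}. a i l \<in> M) \<longrightarrow>
        p (\<lambda>c. Pr \<phi> ((\<lambda>l. e (h l))(x := c))) = (\<Sum>i<k. measure \<Omega> (A i) * \<mu> (fiber U \<phi> x (a i)))) \<and>
     (\<forall>\<phi> x g F. L_formula U \<phi> \<longrightarrow> F \<noteq> bot \<longrightarrow>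
        (\<forall>\<^sub>F h in F. \<forall>l. h l \<in> simple_rvs \<Omega> M) \<longrightarrow>
        (\<forall>\<theta> u. cfm_wf U \<theta> \<longrightarrow> range u \<subseteq> e ` simple_rvs \<Omega> M \<longrightarrow>
           ((\<lambda>h. cvalue Pr \<theta> (override_on u (\<lambda>l. e (h l)) (fv \<phi> - {x}))) \<longlongrightarrow>
              cvalue Pr \<theta> (override_on u g (fv \<phi> - {x}))) F) \<longrightarrow>
        ((\<lambda>h. p (\<lambda>c. Pr \<phi> ((\<lambda>l. e (h l))(x := c)))) \<longlongrightarrow> p (\<lambda>c. Pr \<phi> (g(x := c)))) F)"

text \<open>
  The probability space \<open>\<Omega>\<close>, the monster model of \<open>T\<^sup>R\<close> and the embedding into it, which the notion
  ``\<open>irgs\<close> over \<open>M\<close>'' quantifies existentially, are explicit arguments here.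
\<close>

definition irgs_over :: "('f, 'r, 'u) model \<Rightarrow> 'k rel \<Rightarrow> 'w measure \<Rightarrow> ('f, 'r, 'u, 'c) rstruct \<Rightarrow>
    'l rel \<Rightarrow> (('w \<Rightarrow> 'u) \<Rightarrow> 'c) \<Rightarrow> 'u set \<Rightarrow> ('u set \<Rightarrow> real) \<Rightarrow> bool" where
  "irgs_over U \<kappa> \<Omega> Pr \<kappa>' e M \<mu> \<longleftrightarrow> definable_over U \<kappa> M \<mu> \<and>
     prob_space \<Omega> \<and> atomless \<Omega> \<and> cmonster U Pr \<kappa>' \<and> randomization_embedding U Pr \<Omega> e \<and>
     small \<kappa>' (randomization Pr \<Omega> e M) \<and>
     (\<exists>p. is_canonical_extension U Pr \<Omega> e M \<mu> p \<and>
          generically_stable U Pr (randomization Pr \<Omega> e M) p)"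

end

theory Submission
  imports Defs "HOL-Analysis.Function_Metric"
begin

text \<open>
  The point is that a Morley sequence \<open>a\<^sub>1, a\<^sub>2, \<dots>\<close> of \<open>r\<^sub>\<mu>\<close> reproduces \<open>\<mu>\<^sup>(\<^sup>\<omega>\<^sup>)\<close>: for every formula
  \<open>\<theta>(x\<^sub>1,\<dots>,x\<^sub>n)\<close> over \<open>M\<close>, the number \<open>\<bbbP>\<lbrakk>\<theta>(a\<^sub>1,\<dots>,a\<^sub>n)\<rbrakk>\<close> is the \<open>\<mu>\<^sup>(\<^sup>\<omega>\<^sup>)\<close>-measure of \<open>[\<theta>]\<close>
  (\<open>morley_power_distribution\<close>).  Suppose that the event that \<open>x\<^sub>1,\<dots>,x\<^sub>k\<close> carry an
  order for \<open>\<phi>\<close> for every \<open>k\<close> has measure \<open>\<epsilon> > 0\<close>.  Then \<open>a\<^sub>1,\<dots>,a\<^sub>k\<close> satisfy \<open>O\<^sub>k\<close> with probability at least \<open>\<epsilon>\<close>, for all \<open>k\<close>.  Witnesses of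
  existential formulas can be chosen measurably in a randomization (\<open>fullness\<close>), so for each \<open>j\<close>
  there is a random tuple \<open>b\<close> such that, on the event \<open>\<lbrakk>O\<^sub>k(a\<^sub>1,\<dots>,a\<^sub>k)\<rbrakk>\<close>, \<open>\<phi>(a\<^sub>i;b)\<close> holds exactly for
  \<open>i > j\<close>.  Outside of this event \<open>\<phi>(a\<^sub>i;b)\<close> is out of control, and it could well spoil the gap
  between the probabilities for \<open>i \<le> j\<close> and for \<open>i > j\<close>.  The remedy is to let the parameters encode
  the event: replace \<open>\<phi>(x;y)\<close> by \<open>\<theta>(x;y,z,z') = \<phi>(x;y) \<and> z = z'\<close> and choose \<open>z \<noteq> z'\<close> outside of the
  event.  Then \<open>\<bbbP>\<lbrakk>\<theta>(a\<^sub>i;b,z,z')\<rbrakk>\<close> is \<open>0\<close> for \<open>i \<le> j\<close> and at least \<open>\<epsilon>\<close> for \<open>j < i \<le> k\<close>; by saturation one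
  choice of parameters works for all \<open>k\<close>.  This contradicts the generic stability of \<open>r\<^sub>\<mu>\<close>
  (\<open>order_event_null\<close>).  The other two kinds of events are contained in those of orders, and there
  are only countably many formulas.
  
  The identity between the two distributions is proved by induction on \<open>n\<close>.  By definability of \<open>\<mu>\<close>
  and compactness of the type space, \<open>b \<mapsto> \<mu>(\<theta>(x;b))\<close> is within any given \<open>\<epsilon>\<close> of a step function
  whose steps are definable over \<open>M\<close> (\<open>definable_over_step_approx\<close>).  Up to \<open>\<epsilon>\<close>, the Morley product
  integral (\<open>integral_step_approx\<close>) and the value of \<open>r\<^sub>\<mu>\<close> (\<open>p_step_approx\<close>) are therefore the same
  linear combination of the probabilities of the steps, which involve \<open>n\<close> variables only.  For
  \<open>r\<^sub>\<mu>\<close> this is a computation with finite sums at tuples of simple random variables, and it extends to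
  all tuples because every type over \<open>M\<^sub>0\<^sup>\<Omega>\<close> is a limit of types of tuples from \<open>M\<^sub>0\<^sup>\<Omega>\<close> (\<open>simple_net\<close>).
  
  A technical point pervades the proof.  The predicates \<open>\<bbbP>\<lbrakk>\<phi>\<rbrakk>\<close> for different \<open>\<phi>\<close>, even for \<open>\<phi>\<close> and a
  formula \<open>\<phi>'\<close> obtained from it by renaming variables, are unrelated primitives, and formulas of the
  randomization language express their relations only at a common assignment.  So when an element
  \<open>c\<close> is moved from the variable \<open>x\<^sub>i\<close> to the variable \<open>x\<^sub>j\<close>, it has to be replaced by a \<open>d\<close> with
  \<open>\<bbbP>\<lbrakk>x\<^sub>i \<noteq> x\<^sub>j\<rbrakk>(c,d) = 0\<close>.  Such a \<open>d\<close>, called a twin of \<open>c\<close>, exists by fullness and saturation, and it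
  can be substituted for \<open>c\<close> in all formulas (\<open>Pr_rename\<close>, \<open>renaming_exists\<close>).
\<close>

section \<open>Definable sets, substitution and parameters\<close>

lemma trm_over_mono: "trm_over U A t \<Longrightarrow> A \<subseteq> B \<Longrightarrow> trm_over U B t"
  by (induction t) auto

lemma fm_over_mono: "fm_over U A \<phi> \<Longrightarrow> A \<subseteq> B \<Longrightarrow> fm_over U B \<phi>"
  by (induction \<phi>) (auto intro: trm_over_mono)

lemma Def_mono: "A \<subseteq> B \<Longrightarrow> V \<subseteq> W \<Longrightarrow> Def U A V \<subseteq> Def U B W"
  unfolding Def_def using fm_over_mono by blast

lemma Def_cong:
  assumes "D \<in> Def U A V" "\<And>i. i \<in> V \<Longrightarrow> a i = b i"
  shows "a \<in> D \<longleftrightarrow> b \<in> D"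
proof -
  obtain \<phi> where "fv \<phi> \<subseteq> V" "D = {a. true_in U \<phi> a}"
    using assms(1) unfolding Def_def by auto
  then show ?thesis using sat_cong[of \<phi> a b U UNIV] assms(2) by auto
qed

lemma Def_obtain:
  assumes "D \<in> Def U A V"
  obtains \<phi> where "fm_over U A \<phi>" "fv \<phi> \<subseteq> V" "\<And>a. true_in U \<phi> a \<longleftrightarrow> a \<in> D"
  using assms unfolding Def_def by auto

lemma Def_formula: "fm_over U A \<phi> \<Longrightarrow> {a. true_in U \<phi> a} \<in> Def U A UNIV"
  unfolding Def_def by auto

lemma Def_empty: "{} \<in> Def U A V"
  using Def_Compl[OF Def_UNIV] by simp

lemma Def_Un: "D \<in> Def U A V \<Longrightarrow> E \<in> Def U A V \<Longrightarrow> D \<union> E \<in> Def U A V"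
  using Def_Compl[OF Def_Int[OF Def_Compl Def_Compl], of D U A V E] by simp

lemma Def_UN: "finite I \<Longrightarrow> (\<And>i. i \<in> I \<Longrightarrow> D i \<in> Def U A V) \<Longrightarrow> (\<Union>i\<in>I. D i) \<in> Def U A V"
  by (induction I rule: finite_induct) (auto simp: Def_empty Def_Un)

lemma ex_subst_fv:
  fixes U :: "('f, 'r, 'u) model"
  assumes "fm_over U A \<phi>"
  obtains \<psi> where "fm_over U A \<psi>" "fv \<psi> \<subseteq> r ` fv \<phi>"
    "\<And>v. true_in U \<psi> v \<longleftrightarrow> true_in U \<phi> (\<lambda>i. v (r i))"
proof -
  have "{v. true_in U \<phi> (\<lambda>i. v (r i))} \<in> Def U A (r ` fv \<phi>)"
  proof (rule Def_support[OF Def_true_in[OF assms]])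
    fix a b :: "nat \<Rightarrow> 'u"
    assume ab: "\<And>i. i \<in> r ` fv \<phi> \<Longrightarrow> a i = b i" "a \<in> {v. true_in U \<phi> (\<lambda>i. v (r i))}"
    then show "b \<in> {v. true_in U \<phi> (\<lambda>i. v (r i))}"
      using sat_cong[of \<phi> "\<lambda>i. a (r i)" "\<lambda>i. b (r i)"] by auto
  qed
  then show ?thesis using that by (elim Def_obtain) auto
qed

fun tinst :: "(nat \<Rightarrow> 'c) \<Rightarrow> nat set \<Rightarrow> ('f, 'c) trm \<Rightarrow> ('f, 'c) trm" where
  "tinst b W (Var i) = (if i \<in> W then Cst (b i) else Var i)"
| "tinst b W (Cst c) = Cst c"
| "tinst b W (Fn f ts) = Fn f (map (tinst b W) ts)"

lemma tval_tinst: "tval U v (tinst b W t) = tval U (override_on v b W) t"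
proof (induction t)
  case (Fn f ts)
  then have "map (tval U v \<circ> tinst b W) ts = map (tval U (override_on v b W)) ts"
    by simp
  then show ?case by (simp only: tval.simps tinst.simps map_map)
qed (auto simp: override_on_def)

lemma trm_over_tinst: "trm_over U A t \<Longrightarrow> trm_over U (A \<union> b ` W) (tinst b W t)"
  by (induction t) auto

lemma ex_inst:
  assumes "fm_over U A \<phi>"
  shows "\<exists>\<psi>. fm_over U (A \<union> b ` W) \<psi> \<and> (\<forall>v. true_in U \<psi> v \<longleftrightarrow> true_in U \<phi> (override_on v b W))"
  using assms
proof (induction \<phi> arbitrary: W)
  case (FEq s t)
  then show ?case
    by (intro exI[of _ "FEq (tinst b W s) (tinst b W t)"]) (auto simp: tval_tinst trm_over_tinst)
next
  case (FRel R ts)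
  have "map (tval U v \<circ> tinst b W) ts = map (tval U (override_on v b W)) ts" for v
    by (simp add: tval_tinst)
  then have "true_in U (FRel R (map (tinst b W) ts)) v \<longleftrightarrow> true_in U (FRel R ts) (override_on v b W)" for v
    by (simp only: sat.simps map_map)
  moreover have "fm_over U (A \<union> b ` W) (FRel R (map (tinst b W) ts))"
    using FRel by (auto simp: trm_over_tinst)
  ultimately show ?case by blast
next
  case (FNeg \<phi>)
  then obtain \<psi> where "fm_over U (A \<union> b ` W) \<psi>" "\<forall>v. true_in U \<psi> v \<longleftrightarrow> true_in U \<phi> (override_on v b W)"
    by fastforce
  then show ?case by (intro exI[of _ "FNeg \<psi>"]) simp
next
  case (FConj \<phi>1 \<phi>2)
  then obtain \<psi>1 \<psi>2 where
      "fm_over U (A \<union> b ` W) \<psi>1" "\<forall>v. true_in U \<psi>1 v \<longleftrightarrow> true_in U \<phi>1 (override_on v b W)"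
      "fm_over U (A \<union> b ` W) \<psi>2" "\<forall>v. true_in U \<psi>2 v \<longleftrightarrow> true_in U \<phi>2 (override_on v b W)"
    by (metis fm_over.simps(4))
  then show ?case by (intro exI[of _ "FConj \<psi>1 \<psi>2"]) simp
next
  case (FEx j \<phi>)
  have "fm_over U A \<phi>" using FEx.prems by simp
  from FEx.IH[OF this, of "W - {j}"] obtain \<psi> where \<psi>: "fm_over U (A \<union> b ` (W - {j})) \<psi>"
      "\<forall>v. true_in U \<psi> v \<longleftrightarrow> true_in U \<phi> (override_on v b (W - {j}))"
    by blast
  have "fm_over U (A \<union> b ` W) \<psi>" by (rule fm_over_mono[OF \<psi>(1)]) auto
  moreover have "override_on (v(j := c)) b (W - {j}) = (override_on v b W)(j := c)" for v c
    by (auto simp: override_on_def)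
  ultimately show ?case using \<psi>(2) by (intro exI[of _ "FEx j \<psi>"]) simp
qed

lemma Def_inst:
  assumes "D \<in> Def U A UNIV"
  shows "{a. override_on a b W \<in> D} \<in> Def U (A \<union> b ` W) UNIV"
proof -
  obtain \<phi> where \<phi>: "fm_over U A \<phi>" "\<And>a. true_in U \<phi> a \<longleftrightarrow> a \<in> D"
    using assms by (auto elim: Def_obtain)
  obtain \<psi> where "fm_over U (A \<union> b ` W) \<psi>" "\<forall>v. true_in U \<psi> v \<longleftrightarrow> true_in U \<phi> (override_on v b W)"
    using ex_inst[OF \<phi>(1)] by blast
  then show ?thesis unfolding Def_def using \<phi>(2) by auto
qed

fun tabs :: "('c \<Rightarrow> nat) \<Rightarrow> ('f, 'c) trm \<Rightarrow> ('f, 'c) trm" where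
  "tabs enc (Var i) = Var i"
| "tabs enc (Cst c) = Var (enc c)"
| "tabs enc (Fn f ts) = Fn f (map (tabs enc) ts)"

fun tconsts :: "('f, 'c) trm \<Rightarrow> 'c set" where
  "tconsts (Var i) = {}"
| "tconsts (Cst c) = {c}"
| "tconsts (Fn f ts) = (\<Union>t\<in>set ts. tconsts t)"

lemma finite_tconsts: "finite (tconsts t)"
  by (induction t) auto

lemma tconsts_over: "trm_over U A t \<Longrightarrow> tconsts t \<subseteq> A"
  by (induction t) auto

lemma trm_over_tabs: "trm_over U A t \<Longrightarrow> trm_over U {} (tabs enc t)"
  by (induction t) auto

lemma tvars_tabs: "tvars (tabs enc t) \<subseteq> tvars t \<union> enc ` tconsts t"
  by (induction t) fastforce+

lemma tval_tabs: "(\<And>c. c \<in> tconsts t \<Longrightarrow> v (enc c) = c) \<Longrightarrow> tval U v (tabs enc t) = tval U v t"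
proof (induction t)
  case (Fn f ts)
  have "map (tval U v \<circ> tabs enc) ts = map (tval U v) ts"
    using Fn by auto
  then show ?case by (simp only: tval.simps tabs.simps map_map)
qed auto

text \<open>
  The formula \<open>\<psi>\<close> need not be \<open>\<phi>\<close> with each constant \<open>c\<close> replaced by the variable \<open>enc c\<close>, but it
  behaves like it.
\<close>

definition abstracts :: "('f, 'r, 'u) model \<Rightarrow> ('u \<Rightarrow> nat) \<Rightarrow> 'u set \<Rightarrow> ('f, 'r, 'u) fm \<Rightarrow> ('f, 'r, 'u) fm \<Rightarrow> bool" where
  "abstracts U enc C \<phi> \<psi> \<longleftrightarrow> L_formula U \<psi> \<and> fv \<psi> \<subseteq> fv \<phi> \<union> enc ` C \<and>
    (\<forall>v. (\<forall>c\<in>C. v (enc c) = c) \<longrightarrow> (true_in U \<psi> v \<longleftrightarrow> true_in U \<phi> v))"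

text \<open>
  The bound \<open>K\<close> keeps these variables from being captured by quantifiers; different
  constants may share a variable, since \<open>v (enc c) = c\<close> is required anyway.
\<close>

lemma ex_abs_consts:
  fixes U :: "('f, 'r, 'u) model"
  assumes "fm_over U A \<phi>"
  shows "\<exists>C K. finite C \<and> C \<subseteq> A \<and>
    (\<forall>enc. (\<forall>c\<in>C. enc c \<ge> (K::nat)) \<longrightarrow> (\<exists>\<psi>. abstracts U enc C \<phi> \<psi>))"
  using assms
proof (induction \<phi>)
  case (FEq s t)
  show ?case
  proof (rule exI[of _ "tconsts s \<union> tconsts t"], rule exI[of _ 0], intro conjI allI impI)
    fix enc :: "'u \<Rightarrow> nat"
    show "\<exists>\<psi>. abstracts U enc (tconsts s \<union> tconsts t) (FEq s t) \<psi>"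
      unfolding abstracts_def using FEq tvars_tabs[of enc s] tvars_tabs[of enc t]
      by (intro exI[of _ "FEq (tabs enc s) (tabs enc t)"]) (auto simp: tval_tabs intro: trm_over_tabs)
  qed (use FEq tconsts_over[of U A s] tconsts_over[of U A t] in \<open>auto simp: finite_tconsts\<close>)
next
  case (FRel R ts)
  let ?C = "\<Union>t\<in>set ts. tconsts t"
  show ?case
  proof (rule exI[of _ ?C], rule exI[of _ 0], intro conjI allI impI)
    fix enc :: "'u \<Rightarrow> nat"
    have "true_in U (FRel R (map (tabs enc) ts)) v \<longleftrightarrow> true_in U (FRel R ts) v"
      if "\<forall>c\<in>?C. v (enc c) = c" for v
    proof -
      have "map (tval U v \<circ> tabs enc) ts = map (tval U v) ts"
        using that by (auto intro!: tval_tabs)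
      then show ?thesis by (simp only: sat.simps map_map)
    qed
    moreover have "fv (FRel R (map (tabs enc) ts)) \<subseteq> fv (FRel R ts) \<union> enc ` ?C"
      using tvars_tabs[of enc] by fastforce
    moreover have "L_formula U (FRel R (map (tabs enc) ts))"
      using FRel by (auto intro: trm_over_tabs)
    ultimately show "\<exists>\<psi>. abstracts U enc ?C (FRel R ts) \<psi>"
      unfolding abstracts_def by blast
  next
    show "?C \<subseteq> A" using FRel tconsts_over[of U A] by fastforce
  qed (auto simp: finite_tconsts)
next
  case (FNeg \<phi>)
  then obtain C and K :: nat where CK: "finite C" "C \<subseteq> A" and
    *: "\<And>enc. \<forall>c\<in>C. enc c \<ge> K \<Longrightarrow> \<exists>\<psi>. abstracts U enc C \<phi> \<psi>" by auto
  show ?case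
  proof (rule exI[of _ C], rule exI[of _ K], intro conjI allI impI CK)
    fix enc :: "'u \<Rightarrow> nat" assume "\<forall>c\<in>C. enc c \<ge> K"
    from *[OF this] obtain \<psi> where "abstracts U enc C \<phi> \<psi>" ..
    then show "\<exists>\<psi>. abstracts U enc C (FNeg \<phi>) \<psi>"
      unfolding abstracts_def by (intro exI[of _ "FNeg \<psi>"]) simp
  qed
next
  case (FConj \<phi>1 \<phi>2)
  from FConj obtain C1 and K1 :: nat where CK1: "finite C1" "C1 \<subseteq> A" and
    *: "\<And>enc. \<forall>c\<in>C1. enc c \<ge> K1 \<Longrightarrow> \<exists>\<psi>. abstracts U enc C1 \<phi>1 \<psi>" by auto
  from FConj obtain C2 and K2 :: nat where CK2: "finite C2" "C2 \<subseteq> A" and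
    **: "\<And>enc. \<forall>c\<in>C2. enc c \<ge> K2 \<Longrightarrow> \<exists>\<psi>. abstracts U enc C2 \<phi>2 \<psi>" by auto
  show ?case
  proof (rule exI[of _ "C1 \<union> C2"], rule exI[of _ "max K1 K2"], intro conjI allI impI)
    fix enc :: "'u \<Rightarrow> nat" assume enc: "\<forall>c\<in>C1 \<union> C2. enc c \<ge> max K1 K2"
    obtain \<psi>1 \<psi>2 where "abstracts U enc C1 \<phi>1 \<psi>1" "abstracts U enc C2 \<phi>2 \<psi>2"
      using *[of enc] **[of enc] enc by auto
    then show "\<exists>\<psi>. abstracts U enc (C1 \<union> C2) (FConj \<phi>1 \<phi>2) \<psi>"
      unfolding abstracts_def by (intro exI[of _ "FConj \<psi>1 \<psi>2"]) auto
  qed (use CK1 CK2 in auto)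
next
  case (FEx j \<phi>)
  then obtain C and K :: nat where CK: "finite C" "C \<subseteq> A" and
    *: "\<And>enc. \<forall>c\<in>C. enc c \<ge> K \<Longrightarrow> \<exists>\<psi>. abstracts U enc C \<phi> \<psi>" by auto
  show ?case
  proof (rule exI[of _ C], rule exI[of _ "max K (Suc j)"], intro conjI allI impI CK)
    fix enc :: "'u \<Rightarrow> nat" assume enc: "\<forall>c\<in>C. enc c \<ge> max K (Suc j)"
    then obtain \<psi> where \<psi>: "abstracts U enc C \<phi> \<psi>" using *[of enc] by auto
    have "true_in U \<psi> (v(j := d)) \<longleftrightarrow> true_in U \<phi> (v(j := d))" if "\<forall>c\<in>C. v (enc c) = c" for v d
    proof -
      have "\<forall>c\<in>C. (v(j := d)) (enc c) = c" using that enc by fastforce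
      then show ?thesis using \<psi> unfolding abstracts_def by blast
    qed
    then show "\<exists>\<psi>. abstracts U enc C (FEx j \<phi>) \<psi>"
      using \<psi> unfolding abstracts_def by (intro exI[of _ "FEx j \<psi>"]) auto
  qed
qed

text \<open>
  The parameters of a definable set are turned into values of fresh odd variables.  Even variables
  are reserved for the terms of the Morley sequence.
\<close>

lemma Def_parameters:
  fixes U :: "('f, 'r, 'u) model"
  assumes "D \<in> Def U M Y" "finite Y" "M \<noteq> {}"
  obtains \<psi> m where "L_formula U \<psi>" "range m \<subseteq> M" "fv \<psi> \<subseteq> Y \<union> {l. odd l}"
    "\<And>a. true_in U \<psi> (override_on m a Y) \<longleftrightarrow> a \<in> D"
proof -
  obtain \<phi> where \<phi>: "fm_over U M \<phi>" "fv \<phi> \<subseteq> Y" "\<And>a. true_in U \<phi> a \<longleftrightarrow> a \<in> D"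
    using assms(1) by (auto elim: Def_obtain)
  obtain C and K :: nat where CK: "finite C" "C \<subseteq> M" and
    *: "\<And>enc. \<forall>c\<in>C. enc c \<ge> K \<Longrightarrow> \<exists>\<psi>. abstracts U enc C \<phi> \<psi>"
    using ex_abs_consts[OF \<phi>(1)] by auto
  obtain f :: "'u \<Rightarrow> nat" where f: "inj_on f C"
    using finite_imp_inj_to_nat_seg[OF CK(1)] by auto
  obtain m0 where m0: "m0 \<in> M" using assms(3) by auto
  obtain k where k: "\<And>l. l \<in> Y \<Longrightarrow> l < k" using finite_nat_set_iff_bounded assms(2) by auto
  define enc where "enc c = 2 * (K + k + f c) + 1" for c
  have inj: "inj_on enc C" using f by (auto simp: inj_on_def enc_def)
  define m where "m l = (if l \<in> enc ` C then inv_into C enc l else m0)" for l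
  have mC: "m (enc c) = c" if "c \<in> C" for c using that inj by (simp add: m_def)
  have encY: "enc c \<notin> Y" for c using k[of "enc c"] by (auto simp: enc_def)
  have "\<forall>c\<in>C. enc c \<ge> K" by (simp add: enc_def)
  from *[OF this] obtain \<psi> where \<psi>: "L_formula U \<psi>" "fv \<psi> \<subseteq> fv \<phi> \<union> enc ` C"
    "\<And>v. (\<forall>c\<in>C. v (enc c) = c) \<Longrightarrow> (true_in U \<psi> v \<longleftrightarrow> true_in U \<phi> v)"
    unfolding abstracts_def by blast
  show ?thesis
  proof (rule that)
    show "range m \<subseteq> M" using inj CK m0 by (auto simp: m_def inv_into_into)
    show "fv \<psi> \<subseteq> Y \<union> {l. odd l}" using \<psi>(2) \<phi>(2) by (auto simp: enc_def)
    fix a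
    have "true_in U \<psi> (override_on m a Y) \<longleftrightarrow> true_in U \<phi> (override_on m a Y)"
      by (rule \<psi>(3)) (simp add: override_on_def encY mC)
    also have "\<dots> \<longleftrightarrow> true_in U \<phi> a" by (rule sat_cong) (use \<phi>(2) in \<open>auto simp: override_on_def\<close>)
    finally show "true_in U \<psi> (override_on m a Y) \<longleftrightarrow> a \<in> D" using \<phi>(3) by simp
  qed (rule \<psi>(1))
qed

section \<open>Saturation\<close>

lemma small_countable:
  assumes "uncountable_cardinal \<kappa>" "countable A"
  shows "small \<kappa> A"
proof -
  have "|A| \<le>o |UNIV :: nat set|"
    using assms(2) unfolding countable_def by (auto simp flip: card_of_ordLeq)
  then have "|A| \<le>o natLeq" using card_of_nat ordLeq_ordIso_trans by blast
  then show ?thesis using assms(1) unfolding small_def uncountable_cardinal_def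
    by (blast intro: ordLeq_ordLess_trans)
qed

lemma small_Un:
  assumes "uncountable_cardinal \<kappa>" "small \<kappa> A" "small \<kappa> B"
  shows "small \<kappa> (A \<union> B)"
proof -
  have "\<not> finite (Field \<kappa>)"
    using assms(1) unfolding uncountable_cardinal_def
    by (metis Card_order_iff_ordLeq_card_of card_of_Field_ordIso finite_iff_ordLess_natLeq
        not_ordLess_ordLeq ordIso_ordLess_trans ordIso_symmetric ordLess_imp_ordLeq)
  then show ?thesis
    using assms unfolding small_def uncountable_cardinal_def
    by (intro card_of_Un_ordLess_infinite_Field) auto
qed

text \<open>
  Saturation for one variable gives saturation for finite tuples: realize the projection of the
  partial type to all variables but one, then realize the last variable over this tuple.
\<close>

lemma saturated_finite_tuple:
  fixes U :: "('f, 'r, 'u) model"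
  assumes "finite V" "uncountable_cardinal \<kappa>" "saturated U \<kappa>" "small \<kappa> A" "q \<subseteq> Def U A V"
    and "\<And>F. finite F \<Longrightarrow> F \<subseteq> q \<Longrightarrow> \<Inter>F \<noteq> {}"
  shows "\<Inter>q \<noteq> {}"
  using assms(1,5,6)
proof (induction V arbitrary: q rule: finite_induct)
  case empty
  have "D = UNIV" if "D \<in> q" for D
  proof -
    have "D \<noteq> {}" using empty(2)[of "{D}"] that by auto
    then show ?thesis using Def_cong[of D U A "{}"] empty(1) that by blast
  qed
  then have "undefined \<in> \<Inter>q" by auto
  then show ?case by blast
next
  case (insert i V)
  define pr where "pr F = {a. \<exists>c. a(i := c) \<in> \<Inter>F}" for F :: "(nat \<Rightarrow> 'u) set set"
  let ?q' = "pr ` {F. finite F \<and> F \<subseteq> q}"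
  have "pr F \<in> Def U A V" if "finite F" "F \<subseteq> q" for F
  proof -
    have "(\<Inter>D\<in>F. D) \<in> Def U A (insert i V)" by (rule Def_INT) (use that insert.prems in auto)
    from Def_Ex[of "\<Inter>F" U A i V] this show ?thesis using insert.hyps by (simp add: pr_def)
  qed
  then have sub: "?q' \<subseteq> Def U A V" by blast
  have fip: "\<Inter>G \<noteq> {}" if G: "finite G" "G \<subseteq> ?q'" for G
  proof -
    obtain H where H: "finite H" "H \<subseteq> {F. finite F \<and> F \<subseteq> q}" "G = pr ` H"
      using finite_subset_image[OF G] by auto
    then have "\<Inter>(\<Union>H) \<noteq> {}" by (intro insert.prems(2)) auto
    then obtain a where "a \<in> \<Inter>(\<Union>H)" by auto
    then have "a \<in> pr F" if "F \<in> H" for F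
      using that unfolding pr_def by (intro CollectI exI[of _ "a i"]) auto
    then show ?thesis using H(3) by auto
  qed
  obtain b where b: "b \<in> \<Inter>?q'" using insert.IH[OF sub fip] by blast
  define sl where "sl D = {a::nat \<Rightarrow> 'u. b(i := a 0) \<in> D}" for D
  have slDef: "sl D \<in> Def U (A \<union> b ` V) {0}" if "D \<in> q" for D
  proof (rule Def_support)
    have D: "D \<in> Def U A (insert i V)" using that insert.prems by auto
    then have "D \<in> Def U A UNIV" using Def_mono[of A A "insert i V" UNIV U] by auto
    then have "{a. (\<lambda>l. a 0) \<in> {v. override_on v b V \<in> D}} \<in> Def U (A \<union> b ` V) UNIV"
      by (intro Def_subst[where r = "\<lambda>_. 0"] Def_inst)
    moreover have "override_on (\<lambda>l. a 0) b V \<in> D \<longleftrightarrow> b(i := a 0) \<in> D" for a :: "nat \<Rightarrow> 'u"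
      by (rule Def_cong[OF D]) (use insert.hyps in \<open>auto simp: override_on_def\<close>)
    then have "{a. (\<lambda>l. a 0) \<in> {v. override_on v b V \<in> D}} = sl D" by (auto simp: sl_def)
    ultimately show "sl D \<in> Def U (A \<union> b ` V) UNIV" by argo
  qed (auto simp: sl_def)
  have "small \<kappa> (A \<union> b ` V)"
    using insert.hyps(1) by (intro small_Un small_countable assms) (auto intro: countable_finite)
  moreover have "\<Inter>G \<noteq> {}" if G: "finite G" "G \<subseteq> sl ` q" for G
  proof -
    obtain H where H: "finite H" "H \<subseteq> q" "G = sl ` H" using finite_subset_image[OF G] by auto
    then have "b \<in> pr H" using b by auto
    then obtain c where "b(i := c) \<in> \<Inter>H" by (auto simp: pr_def)
    then have "(\<lambda>_. c) \<in> \<Inter>G" by (auto simp: H sl_def)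
    then show ?thesis by auto
  qed
  ultimately have "\<Inter>(sl ` q) \<noteq> {}"
    using assms(3) slDef unfolding saturated_def by (metis image_subsetI)
  then obtain a where "a \<in> \<Inter>(sl ` q)" by auto
  then have "b(i := a 0) \<in> \<Inter>q" by (auto simp: sl_def)
  then show ?case by auto
qed

section \<open>Types and their topology\<close>

lemma types_sub: "q \<in> types U A V \<Longrightarrow> D \<in> q \<Longrightarrow> D \<in> Def U A V"
  unfolding types_def by auto

lemma types_fip: "q \<in> types U A V \<Longrightarrow> finite F \<Longrightarrow> F \<subseteq> q \<Longrightarrow> \<Inter>F \<noteq> {}"
  unfolding types_def by auto

lemma types_Compl:
  assumes "q \<in> types U A V" "D \<in> Def U A V"
  shows "- D \<in> q \<longleftrightarrow> D \<notin> q"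
proof -
  have "D \<in> q \<or> - D \<in> q" using assms unfolding types_def by auto
  moreover have "\<not> (D \<in> q \<and> - D \<in> q)" using types_fip[OF assms(1), of "{D, - D}"] by auto
  ultimately show ?thesis by blast
qed

lemma types_up:
  assumes "q \<in> types U A V" "D \<in> q" "E \<in> Def U A V" "D \<subseteq> E"
  shows "E \<in> q"
proof (rule ccontr)
  assume "E \<notin> q"
  then have "- E \<in> q" using types_Compl[OF assms(1,3)] by simp
  then show False using types_fip[OF assms(1), of "{D, - E}"] assms by auto
qed

lemma types_Int:
  assumes "q \<in> types U A V" "D \<in> Def U A V" "E \<in> Def U A V"
  shows "D \<inter> E \<in> q \<longleftrightarrow> D \<in> q \<and> E \<in> q"
proof
  assume "D \<in> q \<and> E \<in> q"
  show "D \<inter> E \<in> q"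
  proof (rule ccontr)
    assume "D \<inter> E \<notin> q"
    then have "- (D \<inter> E) \<in> q" using types_Compl[OF assms(1) Def_Int[OF assms(2,3)]] by simp
    then show False using types_fip[OF assms(1), of "{D, E, - (D \<inter> E)}"] \<open>D \<in> q \<and> E \<in> q\<close> by auto
  qed
qed (use types_up[OF assms(1)] assms in blast)

lemma types_empty: "q \<in> types U A V \<Longrightarrow> {} \<notin> q"
  using types_fip[of q U A V "{{}}"] by auto

lemma types_UNIV: "q \<in> types U A V \<Longrightarrow> UNIV \<in> q"
  using types_Compl[OF _ Def_UNIV, of q U A V] types_empty by auto

lemma types_restrict:
  assumes "q \<in> types U B W" "A \<subseteq> B" "V \<subseteq> W"
  shows "q \<inter> Def U A V \<in> types U A V"
proof -
  have "D \<in> q \<or> - D \<in> q" if "D \<in> Def U A V" for D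
    using that assms(1) Def_mono[OF assms(2,3), of U] types_Compl[OF assms(1)] by blast
  moreover have "\<Inter>F \<noteq> {}" if "finite F" "F \<subseteq> q \<inter> Def U A V" for F
    using types_fip[OF assms(1)] that by blast
  ultimately show ?thesis using Def_Compl[of _ U A V] unfolding types_def by blast
qed

lemma types_realized:
  assumes "monster U \<kappa>" "small \<kappa> M" "finite V" "q \<in> types U M V"
  shows "(SOME b. b \<in> \<Inter>q) \<in> \<Inter>q"
proof -
  have "\<Inter>q \<noteq> {}"
    using assms by (intro saturated_finite_tuple[of V \<kappa> U M q])
      (auto simp: monster_def types_sub types_fip)
  then have "\<exists>b. b \<in> \<Inter>q" by blast
  then show ?thesis by (rule someI_ex)
qed

lemma types_member_iff:
  assumes "q \<in> types U A V" "b \<in> \<Inter>q" "D \<in> Def U A V"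
  shows "D \<in> q \<longleftrightarrow> b \<in> D"
  using types_Compl[OF assms(1,3)] assms(2) by blast

lemma tp_types: "tp U A V b \<in> types U A V"
  unfolding tp_def types_def using Def_Compl by auto

lemma topspace_type_space: "topspace (type_space U A V) = types U A V"
proof -
  have "(\<Union>D\<in>Def U A V. clopen U A V D) = types U A V"
    using types_UNIV Def_UNIV by (fastforce simp: clopen_def)
  then show ?thesis by (simp add: type_space_def)
qed

lemma openin_clopen: "D \<in> Def U A V \<Longrightarrow> openin (type_space U A V) (clopen U A V D)"
  unfolding type_space_def by (intro topology_generated_by_Basis) auto

text \<open>
  Clopen sets are closed under finite intersections, so they form a base and not only a subbase.
\<close>

lemma type_space_base:
  assumes "openin (type_space U A V) S" "q \<in> S"
  obtains D where "D \<in> Def U A V" "q \<in> clopen U A V D" "clopen U A V D \<subseteq> S"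
proof -
  have "generate_topology_on (clopen U A V ` Def U A V) S"
    using assms(1) by (simp add: type_space_def openin_topology_generated_by_iff)
  then have "\<forall>q\<in>S. \<exists>D\<in>Def U A V. q \<in> clopen U A V D \<and> clopen U A V D \<subseteq> S"
  proof induction
    case (Int S T)
    show ?case
    proof
      fix q assume q: "q \<in> S \<inter> T"
      obtain D E where "D \<in> Def U A V" "q \<in> clopen U A V D" "clopen U A V D \<subseteq> S"
        "E \<in> Def U A V" "q \<in> clopen U A V E" "clopen U A V E \<subseteq> T" using Int.IH q by blast
      then show "\<exists>D\<in>Def U A V. q \<in> clopen U A V D \<and> clopen U A V D \<subseteq> S \<inter> T"
        using Def_Int[of D U A V E] types_Int[of _ U A V D E]
        by (intro bexI[of _ "D \<inter> E"]) (auto simp: clopen_def)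
    qed
  next
    case (UN K)
    then show ?case by (metis Sup_upper2 Union_iff)
  next
    case (Basis S)
    then show ?case by blast
  qed simp
  then show ?thesis using assms(2) that by blast
qed

lemma sets_borel_of: "sets (borel_of X) = sigma_sets (topspace X) {S. openin X S}"
  unfolding borel_of_def by (rule sets_measure_of) (auto dest: openin_subset)

lemma space_borel_of: "space (borel_of X) = topspace X"
  unfolding borel_of_def by (rule space_measure_of) (auto dest: openin_subset)

lemma open_sets_borel_of: "openin X S \<Longrightarrow> S \<in> sets (borel_of X)"
  by (simp add: sets_borel_of sigma_sets.Basic)

lemma measurable_restrict_types:
  assumes "A \<subseteq> B" "V \<subseteq> W"
  shows "(\<lambda>p. p \<inter> Def U A V) \<in> measurable (borel_of (type_space U B W)) (borel_of (type_space U A V))"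
proof -
  let ?f = "\<lambda>p. p \<inter> Def U A V" and ?X = "type_space U B W"
  have cl: "?f -` clopen U A V D \<inter> topspace ?X = clopen U B W D" if "D \<in> Def U A V" for D
  proof (intro set_eqI iffI)
    fix q assume "q \<in> clopen U B W D"
    then show "q \<in> ?f -` clopen U A V D \<inter> topspace ?X"
      using types_restrict[OF _ assms, of q U] that
      unfolding clopen_def topspace_type_space by simp
  qed (simp add: clopen_def topspace_type_space)
  have "continuous_map ?X (type_space U A V) ?f"
    unfolding type_space_def[of U A V]
  proof (rule continuous_on_generated_topo)
    fix S assume "S \<in> clopen U A V ` Def U A V"
    then obtain D where D: "D \<in> Def U A V" "S = clopen U A V D" by blast
    then have "D \<in> Def U B W" using Def_mono[OF assms, of U] by blast
    from openin_clopen[OF this] show "openin ?X (?f -` S \<inter> topspace ?X)"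
      by (simp only: cl[OF D(1)] D(2))
  next
    show "?f ` topspace ?X \<subseteq> \<Union> (clopen U A V ` Def U A V)"
    proof
      fix q assume "q \<in> ?f ` topspace ?X"
      then have "q \<in> types U A V" using types_restrict[OF _ assms] by (auto simp: topspace_type_space)
      then show "q \<in> \<Union> (clopen U A V ` Def U A V)"
        using Def_UNIV types_UNIV by (intro UN_I[of UNIV]) (auto simp: clopen_def)
    qed
  qed
  then have cont: "continuous_map ?X (type_space U A V) ?f" .
  show ?thesis
  proof (rule measurable_sigma_sets[OF sets_borel_of])
    fix S assume "S \<in> {S. openin (type_space U A V) S}"
    then have "openin ?X {p \<in> topspace ?X. ?f p \<in> S}"
      using openin_continuous_map_preimage[OF cont] by auto
    moreover have "?f -` S \<inter> space (borel_of ?X) = {p \<in> topspace ?X. ?f p \<in> S}"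
      by (auto simp: space_borel_of)
    ultimately show "?f -` S \<inter> space (borel_of ?X) \<in> sets (borel_of ?X)"
      by (simp add: open_sets_borel_of)
  next
    show "{S. openin (type_space U A V) S} \<subseteq> Pow (topspace (type_space U A V))"
      by (auto dest: openin_subset)
    show "?f \<in> space (borel_of ?X) \<rightarrow> topspace (type_space U A V)"
      using types_restrict[OF _ assms] by (auto simp: space_borel_of topspace_type_space)
  qed
qed

section \<open>Step approximations of definable measures\<close>

definition step_approx :: "('f, 'r, 'u) model \<Rightarrow> 'u set \<Rightarrow> nat set \<Rightarrow> ((nat \<Rightarrow> 'u) \<Rightarrow> real) \<Rightarrow> real \<Rightarrow>
    nat \<Rightarrow> (nat \<Rightarrow> (nat \<Rightarrow> 'u) set) \<Rightarrow> (nat \<Rightarrow> real) \<Rightarrow> bool" where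
  "step_approx U A V f \<epsilon> k D r \<longleftrightarrow> (\<forall>j<k. D j \<in> Def U A V) \<and> disjoint_family_on D {..<k} \<and>
     (\<Union>j<k. D j) = UNIV \<and> (\<forall>j<k. \<forall>b\<in>D j. \<bar>f b - r j\<bar> \<le> \<epsilon>)"

text \<open>
  Around every realized type there is a definable set on which the continuous function
  \<open>b \<mapsto> \<mu>(\<theta>(x;b))\<close> varies by less than \<open>\<epsilon>\<close>.  If no finitely many such sets covered everything, their
  complements would be finitely satisfiable and hence, by saturation, realized by some \<open>b\<close>, which
  lies in such a set.
\<close>

lemma definable_over_step_approx:
  fixes U :: "('f, 'r, 'u) model"
  assumes U: "monster U \<kappa>" and \<mu>: "definable_over U \<kappa> M \<mu>" and \<theta>: "L_formula U \<theta>" and "\<epsilon> > 0"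
  obtains k D r where "step_approx U M (fv \<theta> - {x}) (\<lambda>b. \<mu> (fiber U \<theta> x b)) \<epsilon> k D r"
proof -
  let ?Y = "fv \<theta> - {x}" and ?f = "\<lambda>b. \<mu> (fiber U \<theta> x b)"
  define G where "G = {D \<in> Def U M ?Y. \<exists>r. \<forall>b\<in>D. \<bar>?f b - r\<bar> \<le> \<epsilon>}"
  obtain F where F: "continuous_map (type_space U M ?Y) euclideanreal F"
    "\<And>b. F (tp U M ?Y b) = ?f b"
    using \<mu> \<theta> unfolding definable_over_def by blast
  have good: "\<exists>D\<in>G. b \<in> D" for b
  proof -
    let ?S = "{q \<in> topspace (type_space U M ?Y). F q \<in> ball (?f b) \<epsilon>}"
    have "openin (type_space U M ?Y) ?S"
      by (rule openin_continuous_map_preimage[OF F(1)]) auto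
    moreover have "tp U M ?Y b \<in> ?S"
      using tp_types \<open>\<epsilon> > 0\<close> by (auto simp: topspace_type_space F(2))
    ultimately obtain D where D: "D \<in> Def U M ?Y" "tp U M ?Y b \<in> clopen U M ?Y D"
      "clopen U M ?Y D \<subseteq> ?S"
      by (rule type_space_base)
    have "\<bar>?f b' - ?f b\<bar> \<le> \<epsilon>" if "b' \<in> D" for b'
    proof -
      have "tp U M ?Y b' \<in> clopen U M ?Y D"
        using that D(1) tp_types[of U M ?Y b'] by (simp add: clopen_def tp_def)
      then have "tp U M ?Y b' \<in> ?S" using D(3) by blast
      then have "\<bar>?f b - ?f b'\<bar> < \<epsilon>" by (simp add: F(2) dist_real_def)
      then show ?thesis by linarith
    qed
    then have "D \<in> G" using D(1) unfolding G_def by blast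
    moreover have "b \<in> D" using D(2) by (simp add: clopen_def tp_def)
    ultimately show ?thesis by blast
  qed
  have "\<exists>H. finite H \<and> H \<subseteq> G \<and> \<Union>H = UNIV"
  proof (rule ccontr)
    assume *: "\<nexists>H. finite H \<and> H \<subseteq> G \<and> \<Union>H = UNIV"
    have "\<Inter>F \<noteq> {}" if F: "finite F" "F \<subseteq> uminus ` G" for F
    proof -
      obtain H where "finite H" "H \<subseteq> G" "F = uminus ` H" using finite_subset_image[OF F] by auto
      moreover from this have "\<Union>H \<noteq> UNIV" using * by blast
      then obtain b where "b \<notin> \<Union>H" by blast
      ultimately have "b \<in> \<Inter>F" by simp
      then show ?thesis by blast
    qed
    moreover have "uminus ` G \<subseteq> Def U M ?Y" using Def_Compl by (auto simp: G_def)
    ultimately have "\<Inter>(uminus ` G) \<noteq> {}"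
      using U \<mu> finite_fv[of \<theta>] saturated_finite_tuple[of ?Y \<kappa> U M "uminus ` G"]
      by (auto simp: monster_def definable_over_def)
    then show False using good by blast
  qed
  then obtain H where H: "finite H" "H \<subseteq> G" "\<Union>H = UNIV" by blast
  obtain k and E :: "nat \<Rightarrow> (nat \<Rightarrow> 'u) set" where E: "H = E ` {i. i < k}"
    using finite_imp_nat_seg_image_inj_on[OF H(1)] by blast
  have EG: "E j \<in> G" if "j < k" for j using that E H(2) by auto
  define r where "r j = (SOME r. \<forall>b\<in>E j. \<bar>?f b - r\<bar> \<le> \<epsilon>)" for j
  have r: "\<forall>b\<in>E j. \<bar>?f b - r j\<bar> \<le> \<epsilon>" if "j < k" for j
    unfolding r_def by (rule someI_ex) (use EG[OF that] in \<open>auto simp: G_def\<close>)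
  \<comment> \<open>Make the covering disjoint; the oscillation only decreases.\<close>
  let ?D = "disjointed E"
  have "?D j \<in> Def U M ?Y" if "j < k" for j
  proof -
    have "(\<Union>i\<in>{0..<j}. E i) \<in> Def U M ?Y" using EG that by (intro Def_UN) (auto simp: G_def)
    then show ?thesis using EG[OF that] Def_Int[OF _ Def_Compl]
      unfolding disjointed_def Diff_eq G_def by blast
  qed
  moreover have "disjoint_family_on ?D {..<k}"
    using disjoint_family_disjointed[of E] by (auto simp: disjoint_family_on_def)
  moreover have "(\<Union>j<k. ?D j) = UNIV"
    using UN_disjointed_eq[of E] H(3) E finite_UN_disjointed_eq[of E k]
    by (simp add: atLeast0LessThan lessThan_def)
  moreover have "\<forall>b\<in>?D j. \<bar>?f b - r j\<bar> \<le> \<epsilon>" if "j < k" for j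
    using r[OF that] disjointed_subset[of E j] by blast
  ultimately show ?thesis by (intro that[of k ?D r]) (simp add: step_approx_def)
qed

text \<open>
  Places \<open>a\<^sub>1,\<dots>,a\<^sub>n\<close> at the variables \<open>2, 4, \<dots>, 2n\<close> and \<open>m\<close> at all others.  The variables \<open>x\<^sub>1, x\<^sub>2, \<dots>\<close>
  use up all positive indices, so they are spread out to leave room for parameters.
\<close>

definition interleave :: "nat \<Rightarrow> (nat \<Rightarrow> 'a) \<Rightarrow> (nat \<Rightarrow> 'a) \<Rightarrow> nat \<Rightarrow> 'a" where
  "interleave n m a l = (if even l \<and> l \<in> {2..2 * n} then a (l div 2) else m l)"

lemma interleave_Def:
  assumes "D \<in> Def U M UNIV" "range m \<subseteq> M"
  shows "{a. interleave n m a \<in> D} \<in> Def U M {1..n}"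
proof (rule Def_support)
  let ?W = "{l. \<not> (even l \<and> l \<in> {2..2 * n})}"
  have "{v. override_on v m ?W \<in> D} \<in> Def U (M \<union> m ` ?W) UNIV"
    by (rule Def_inst[OF assms(1)])
  moreover have "M \<union> m ` ?W = M" using assms(2) by auto
  ultimately have "{a. (\<lambda>l. a (l div 2)) \<in> {v. override_on v m ?W \<in> D}} \<in> Def U M UNIV"
    by (intro Def_subst) simp
  moreover have "override_on (\<lambda>l. a (l div 2)) m ?W = interleave n m a" for a :: "nat \<Rightarrow> 'a"
    by (auto simp: override_on_def interleave_def fun_eq_iff)
  ultimately show "{a. interleave n m a \<in> D} \<in> Def U M UNIV" by simp
next
  fix a b :: "nat \<Rightarrow> 'a" assume *: "\<And>i. i \<in> {1..n} \<Longrightarrow> a i = b i" "a \<in> {a. interleave n m a \<in> D}"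
  have "a (l div 2) = b (l div 2)" if "l \<in> {2..2 * n}" for l using that by (intro *(1)) auto
  then have "interleave n m a = interleave n m b" by (auto simp: interleave_def fun_eq_iff)
  then show "b \<in> {a. interleave n m a \<in> D}" using *(2) by simp
qed

lemma step_approx_interleave:
  assumes "step_approx U M Y f \<epsilon> k D r" "range m \<subseteq> M"
  shows "step_approx U M {1..n} (\<lambda>b. f (interleave n m b)) \<epsilon> k (\<lambda>j. {b. interleave n m b \<in> D j}) r"
proof -
  have "{b. interleave n m b \<in> D j} \<in> Def U M {1..n}" if "j < k" for j
    using assms that Def_mono[of M M Y UNIV U]
    by (intro interleave_Def) (auto simp: step_approx_def)
  moreover have "(\<Union>j<k. {b. interleave n m b \<in> D j}) = UNIV"
    using assms(1) unfolding step_approx_def by blast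
  moreover have "disjoint_family_on (\<lambda>j. {b. interleave n m b \<in> D j}) {..<k}"
    using assms(1) unfolding step_approx_def disjoint_family_on_def by blast
  ultimately show ?thesis using assms(1) by (simp add: step_approx_def)
qed

section \<open>Marginals\<close>

lemma sets_marginal: "sets (marginal U A V P) = sets (borel_of (type_space U A V))"
  by (simp add: marginal_def)

lemma measurable_restrict:
  assumes "sets P = sets (borel_of (type_space U B W))" "A \<subseteq> B" "V \<subseteq> W"
  shows "(\<lambda>p. p \<inter> Def U A V) \<in> measurable P (borel_of (type_space U A V))"
  using measurable_restrict_types[OF assms(2,3), of U] measurable_cong_sets[OF assms(1) refl] by blast

lemma prob_space_marginal:
  assumes "sets P = sets (borel_of (type_space U B W))" "A \<subseteq> B" "V \<subseteq> W" "prob_space P"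
  shows "prob_space (marginal U A V P)"
  unfolding marginal_def using assms(4) measurable_restrict[OF assms(1-3)]
  by (rule prob_space.prob_space_distr)

lemma measure_marginal_clopen:
  assumes "sets P = sets (borel_of (type_space U B W))" "A \<subseteq> B" "V \<subseteq> W" "D \<in> Def U A V"
  shows "measure (marginal U A V P) (clopen U A V D) = measure P (clopen U B W D)"
proof -
  have sp: "space P = types U B W"
    using sets_eq_imp_space_eq[OF assms(1)] by (simp add: space_borel_of topspace_type_space)
  have "measure (marginal U A V P) (clopen U A V D) =
      measure P ((\<lambda>p. p \<inter> Def U A V) -` clopen U A V D \<inter> space P)"
    unfolding marginal_def using measurable_restrict[OF assms(1-3)]
    by (rule measure_distr) (simp add: open_sets_borel_of openin_clopen assms(4))
  also have "(\<lambda>p. p \<inter> Def U A V) -` clopen U A V D \<inter> space P = clopen U B W D"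
  proof (intro set_eqI iffI)
    fix q assume "q \<in> clopen U B W D"
    then show "q \<in> (\<lambda>p. p \<inter> Def U A V) -` clopen U A V D \<inter> space P"
      using types_restrict[OF _ assms(2,3), of q U] assms(4)
      unfolding clopen_def sp by simp
  qed (simp add: clopen_def sp)
  finally show ?thesis .
qed

lemma step_approx_type:
  assumes "step_approx U A V f \<epsilon> k D r" "q \<in> types U A V" "b \<in> \<Inter>q"
  shows "\<bar>f b - (\<Sum>j<k. r j * indicator (clopen U A V (D j)) q)\<bar> \<le> \<epsilon>"
proof -
  obtain i where i: "i < k" "b \<in> D i" using assms(1) unfolding step_approx_def by blast
  have "indicator (clopen U A V (D j)) q = (if j = i then 1 else 0 :: real)" if "j < k" for j
  proof -
    have "D j \<in> q \<longleftrightarrow> b \<in> D j"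
      using assms that by (intro types_member_iff) (auto simp: step_approx_def)
    also have "\<dots> \<longleftrightarrow> j = i"
      using i that assms(1) unfolding step_approx_def disjoint_family_on_def by blast
    finally show ?thesis using assms(2) by (simp add: clopen_def indicator_def)
  qed
  then have "(\<Sum>j<k. r j * indicator (clopen U A V (D j)) q) = (\<Sum>j<k. if j = i then r j else 0)"
    by (intro sum.cong) auto
  also have "\<dots> = r i" using i by simp
  finally show ?thesis using i assms(1) by (simp add: step_approx_def)
qed

text \<open>
  The integrand is within \<open>\<epsilon>\<close> of the step function at every type \<open>q\<close>, because by saturation the chosen
  realization of \<open>q\<close> exists.  That step functions exist for all \<open>\<epsilon>\<close> makes the integrand measurable;
  without measurability the integral would be \<open>0\<close> by convention.
\<close>

lemma integral_step_approx:
  assumes U: "monster U \<kappa>" and M: "small \<kappa> M" and V: "finite V"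
    and N: "prob_space N" "sets N = sets (borel_of (type_space U M V))"
    and steps: "\<And>\<epsilon>. \<epsilon> > 0 \<Longrightarrow> \<exists>k D r. step_approx U M V f \<epsilon> k D r"
    and approx: "step_approx U M V f \<epsilon> k D r"
  shows "\<bar>(\<integral>q. f (SOME b. b \<in> \<Inter>q) \<partial>N) - (\<Sum>j<k. r j * measure N (clopen U M V (D j)))\<bar> \<le> \<epsilon>"
proof -
  interpret prob_space N by fact
  have sp: "space N = types U M V"
    using sets_eq_imp_space_eq[OF N(2)] by (simp add: space_borel_of topspace_type_space)
  let ?f = "\<lambda>q. f (SOME b. b \<in> \<Inter>q)"
  define s where "s k D r q = (\<Sum>j<k. r j * indicator (clopen U M V (D j)) q)"
    for k :: nat and D and r :: "nat \<Rightarrow> real" and q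
  have near: "\<bar>?f q - s k D r q\<bar> \<le> \<epsilon>" if "step_approx U M V f \<epsilon> k D r" "q \<in> space N" for \<epsilon> k D r q
    unfolding s_def by (rule step_approx_type) (use that sp types_realized[OF U M V] in auto)
  have cl: "clopen U M V (D j) \<in> sets N" if "step_approx U M V f \<epsilon> k D r" "j < k" for \<epsilon> k D r j
    using that by (simp add: N(2) open_sets_borel_of openin_clopen step_approx_def)
  have meas: "s k D r \<in> borel_measurable N" if "step_approx U M V f \<epsilon> k D r" for \<epsilon> k D r
    unfolding s_def using cl[OF that] by (intro borel_measurable_sum borel_measurable_times) auto
  have "\<forall>n. \<exists>k D r. step_approx U M V f (1 / Suc n) k D r" using steps by simp
  then obtain kk DD rr where app: "\<And>n. step_approx U M V f (1 / Suc n) (kk n) (DD n) (rr n)" by metis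
  have fm: "?f \<in> borel_measurable N"
  proof (rule borel_measurable_LIMSEQ_real)
    fix q assume q: "q \<in> space N"
    have "\<bar>s (kk n) (DD n) (rr n) q - ?f q\<bar> \<le> 1 / Suc n" for n
      using near[OF app q, of n] by (simp add: abs_minus_commute)
    then have "(\<lambda>n. s (kk n) (DD n) (rr n) q - ?f q) \<longlonglongrightarrow> 0"
      by (intro Lim_null_comparison[OF always_eventually LIMSEQ_inverse_real_of_nat] allI)
        (simp only: real_norm_def inverse_eq_divide)
    then show "(\<lambda>n. s (kk n) (DD n) (rr n) q) \<longlonglongrightarrow> ?f q" by (rule LIM_zero_cancel)
  qed (rule meas[OF app])
  have int_s: "integrable N (s k D r)"
    unfolding s_def using cl[OF approx]
    by (intro Bochner_Integration.integrable_sum integrable_mult_right integrable_real_indicator) (auto simp: emeasure_eq_measure)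
  have int_d: "integrable N (\<lambda>q. ?f q - s k D r q)"
    using near[OF approx] fm meas[OF approx]
    by (intro integrable_const_bound[of _ \<epsilon>]) auto
  have int_f: "integrable N ?f"
    using Bochner_Integration.integrable_add[OF int_d int_s] by simp
  have "(\<integral>q. s k D r q \<partial>N) =
      (\<Sum>j<k. \<integral>q. r j * indicator (clopen U M V (D j)) q \<partial>N)"
    unfolding s_def using cl[OF approx]
    by (intro Bochner_Integration.integral_sum integrable_mult_right integrable_real_indicator)
      (auto simp: emeasure_eq_measure)
  also have "\<dots> = (\<Sum>j<k. r j * measure N (clopen U M V (D j)))"
    using cl[OF approx] by (intro sum.cong refl) simp
  finally have int_s_eq: "(\<integral>q. s k D r q \<partial>N) = (\<Sum>j<k. r j * measure N (clopen U M V (D j)))" .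
  have "(\<integral>q. ?f q \<partial>N) - (\<Sum>j<k. r j * measure N (clopen U M V (D j))) = (\<integral>q. ?f q - s k D r q \<partial>N)"
    unfolding int_s_eq[symmetric] using int_f int_s by simp
  also have "\<bar>\<dots>\<bar> \<le> (\<integral>q. \<bar>?f q - s k D r q\<bar> \<partial>N)" by (rule integral_abs_bound)
  also have "\<dots> \<le> (\<integral>q. \<epsilon> \<partial>N)"
    by (rule integral_mono[OF integrable_abs[OF int_d] _ near[OF approx]]) simp_all
  also have "\<dots> = \<epsilon>" by (simp add: prob_space)
  finally show ?thesis .
qed

section \<open>Values of formulas of the randomization language\<close>

lemma compact_unit_cube: "compact {t :: nat \<Rightarrow> real. \<forall>i. t i \<in> {0..1}}"
proof -
  have "compactin (product_topology (\<lambda>_. euclideanreal) UNIV) (\<Pi>\<^sub>E i\<in>(UNIV :: nat set). {0..1})"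
    by (subst compactin_PiE) auto
  moreover have "(\<Pi>\<^sub>E i\<in>(UNIV :: nat set). {0..1::real}) = {t. \<forall>i. t i \<in> {0..1}}"
    by (auto simp: PiE_def)
  ultimately show ?thesis
    by (simp add: euclidean_product_topology)
qed

text \<open>
  The cube \<open>[0,1]\<^sup>\<omega>\<close> is compact, and points with uniformly close coordinates are close in its metric.
\<close>

lemma connective_uniformly_continuous:
  fixes u :: "(nat \<Rightarrow> real) \<Rightarrow> real"
  assumes "continuous_on {t. \<forall>i. t i \<in> {0..1}} u" "\<epsilon> > 0"
  obtains \<eta> where "\<eta> > 0" "\<And>s t. (\<And>i. s i \<in> {0..1}) \<Longrightarrow> (\<And>i. t i \<in> {0..1}) \<Longrightarrow>
    (\<And>i. \<bar>s i - t i\<bar> \<le> \<eta>) \<Longrightarrow> \<bar>u s - u t\<bar> \<le> \<epsilon>"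
proof -
  have "uniformly_continuous_on {t. \<forall>i. t i \<in> {0..1}} u"
    by (intro compact_uniformly_continuous assms compact_unit_cube)
  then obtain d where d: "d > 0" and
    d': "\<forall>s\<in>{t. \<forall>i. t i \<in> {0..1}}. \<forall>t\<in>{t. \<forall>i. t i \<in> {0..1}}. dist t s < d \<longrightarrow> dist (u t) (u s) < \<epsilon>"
    using \<open>\<epsilon> > 0\<close> unfolding uniformly_continuous_on_def by blast
  obtain N where N: "(1/2::real) ^ N < d / 2" using real_arch_pow_inv[of "d / 2" "1/2"] d(1) by auto
  show ?thesis
  proof (rule that[of "d / 4"])
    fix s t :: "nat \<Rightarrow> real"
    assume st: "\<And>i. s i \<in> {0..1}" "\<And>i. t i \<in> {0..1}" "\<And>i. \<bar>s i - t i\<bar> \<le> d / 4"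
    have "Max {dist (s (from_nat n)) (t (from_nat n)) | n. n \<le> N} \<le> d / 4"
      using st(3) by (subst Max_le_iff) (auto simp: dist_real_def)
    then have "dist s t < d"
      using dist_fun_le_dist_first_terms[of s t N] N by linarith
    then have "dist (u s) (u t) < \<epsilon>" using d' st(1,2) by blast
    then show "\<bar>u s - u t\<bar> \<le> \<epsilon>" by (simp add: dist_real_def)
  qed (use d in simp)
qed

lemma cval_CConn_arg: "(if i < length \<psi>s then map f \<psi>s ! i else 0) = (if i < length \<psi>s then f (\<psi>s ! i) else 0)"
  by simp

lemma abs_SUP_diff_le:
  fixes f g :: "'a \<Rightarrow> real"
  assumes "N \<noteq> {}" "\<And>c. c \<in> N \<Longrightarrow> \<bar>f c - g c\<bar> \<le> \<epsilon>" "bdd_above (f ` N)" "bdd_above (g ` N)"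
  shows "\<bar>(SUP c\<in>N. f c) - (SUP c\<in>N. g c)\<bar> \<le> \<epsilon>"
proof -
  have "(SUP c\<in>N. f c) \<le> (SUP c\<in>N. g c) + \<epsilon>"
  proof (rule cSUP_least[OF assms(1)])
    fix c assume "c \<in> N"
    then show "f c \<le> (SUP c\<in>N. g c) + \<epsilon>" using cSUP_upper[OF _ assms(4), of c] assms(2)[of c] by linarith
  qed
  moreover have "(SUP c\<in>N. g c) \<le> (SUP c\<in>N. f c) + \<epsilon>"
  proof (rule cSUP_least[OF assms(1)])
    fix c assume "c \<in> N"
    then show "g c \<le> (SUP c\<in>N. f c) + \<epsilon>" using cSUP_upper[OF _ assms(3), of c] assms(2)[of c] by linarith
  qed
  ultimately show ?thesis by linarith
qed

lemma abs_INF_diff_le: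
  fixes f g :: "'a \<Rightarrow> real"
  assumes "N \<noteq> {}" "\<And>c. c \<in> N \<Longrightarrow> \<bar>f c - g c\<bar> \<le> \<epsilon>" "bdd_below (f ` N)" "bdd_below (g ` N)"
  shows "\<bar>(INF c\<in>N. f c) - (INF c\<in>N. g c)\<bar> \<le> \<epsilon>"
proof -
  have "(INF c\<in>N. f c) - \<epsilon> \<le> (INF c\<in>N. g c)"
  proof (rule cINF_greatest[OF assms(1)])
    fix c assume "c \<in> N"
    then show "(INF c\<in>N. f c) - \<epsilon> \<le> g c" using cINF_lower[OF assms(3), of c] assms(2)[of c] by linarith
  qed
  moreover have "(INF c\<in>N. g c) - \<epsilon> \<le> (INF c\<in>N. f c)"
  proof (rule cINF_greatest[OF assms(1)])
    fix c assume "c \<in> N"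
    then show "(INF c\<in>N. g c) - \<epsilon> \<le> f c" using cINF_lower[OF assms(4), of c] assms(2)[of c] by linarith
  qed
  ultimately show ?thesis by linarith
qed

lemma finite_cfv: "finite (cfv \<psi>)"
  by (induction \<psi>) (auto simp: finite_fv)

locale random_structure =
  fixes U :: "('f, 'r, 'u) model" and Pr :: "('f, 'r, 'u, 'c) rstruct"
  assumes rstructure: "rstructure U Pr"
begin

sublocale Metric_space UNIV "rdist Pr"
  using rstructure by (simp add: rstructure_def)

lemma Pr_bounds: "L_formula U \<phi> \<Longrightarrow> 0 \<le> Pr \<phi> v \<and> Pr \<phi> v \<le> 1"
  using rstructure by (auto simp: rstructure_def)

lemma Pr_lipschitz: "L_formula U \<phi> \<Longrightarrow> \<bar>Pr \<phi> v - Pr \<phi> w\<bar> \<le> (\<Sum>i\<in>fv \<phi>. rdist Pr (v i) (w i))"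
  using rstructure by (auto simp: rstructure_def)

lemma Pr_cong:
  assumes "L_formula U \<phi>" "\<And>i. i \<in> fv \<phi> \<Longrightarrow> v i = w i"
  shows "Pr \<phi> v = Pr \<phi> w"
proof -
  have "(\<Sum>i\<in>fv \<phi>. rdist Pr (v i) (w i)) = 0" using assms(2) by (intro sum.neutral) simp
  then show ?thesis using Pr_lipschitz[OF assms(1), of v w] by simp
qed

lemma cval_bounds: "cfm_wf U \<psi> \<Longrightarrow> N \<noteq> {} \<Longrightarrow> cval Pr N \<psi> v \<in> {0..1}"
proof (induction \<psi> arbitrary: v)
  case (CProb \<phi>)
  then show ?case using Pr_bounds by simp
next
  case (CConn u \<psi>s)
  have "(if i < length \<psi>s then map (\<lambda>\<psi>. cval Pr N \<psi> v) \<psi>s ! i else 0) \<in> {0..1}" for i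
    using CConn by (simp add: cval_CConn_arg)
  then show ?case using CConn.prems by simp
next
  case (CSup i \<psi>)
  then have *: "cval Pr N \<psi> (v(i := c)) \<in> {0..1}" for c by simp
  have bdd: "bdd_above ((\<lambda>c. cval Pr N \<psi> (v(i := c))) ` N)" using * by (intro bdd_aboveI[of _ 1]) auto
  obtain c0 where c0: "c0 \<in> N" using CSup.prems by auto
  have "(SUP c\<in>N. cval Pr N \<psi> (v(i := c))) \<le> 1" using * CSup.prems by (intro cSUP_least) auto
  moreover have "0 \<le> (SUP c\<in>N. cval Pr N \<psi> (v(i := c)))"
    using cSUP_upper2[OF bdd c0, of 0] * by auto
  ultimately show ?case by simp
next
  case (CInf i \<psi>)
  then have *: "cval Pr N \<psi> (v(i := c)) \<in> {0..1}" for c by simp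
  have bdd: "bdd_below ((\<lambda>c. cval Pr N \<psi> (v(i := c))) ` N)" using * by (intro bdd_belowI[of _ 0]) auto
  obtain c0 where c0: "c0 \<in> N" using CInf.prems by auto
  have "0 \<le> (INF c\<in>N. cval Pr N \<psi> (v(i := c)))" using * CInf.prems by (intro cINF_greatest) auto
  moreover have "(INF c\<in>N. cval Pr N \<psi> (v(i := c))) \<le> 1"
    using cINF_lower2[OF bdd c0, of 1] * by auto
  ultimately show ?case by simp
qed

lemma cval_bdd:
  assumes "cfm_wf U \<psi>" "N \<noteq> {}"
  shows "bdd_above ((\<lambda>c. cval Pr N \<psi> (v c)) ` N)" "bdd_below ((\<lambda>c. cval Pr N \<psi> (v c)) ` N)"
proof -
  have *: "cval Pr N \<psi> w \<le> 1" "0 \<le> cval Pr N \<psi> w" for w using cval_bounds[OF assms, of w] by auto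
  show "bdd_above ((\<lambda>c. cval Pr N \<psi> (v c)) ` N)" by (rule bdd_aboveI2) (rule *)
  show "bdd_below ((\<lambda>c. cval Pr N \<psi> (v c)) ` N)" by (rule bdd_belowI2) (rule *)
qed

lemma cval_cong: "cfm_wf U \<psi> \<Longrightarrow> (\<And>i. i \<in> cfv \<psi> \<Longrightarrow> v i = w i) \<Longrightarrow> cval Pr N \<psi> v = cval Pr N \<psi> w"
proof (induction \<psi> arbitrary: v w)
  case (CProb \<phi>)
  have "L_formula U \<phi>" "\<And>i. i \<in> fv \<phi> \<Longrightarrow> v i = w i" using CProb by simp_all
  then show ?case unfolding cval.simps by (rule Pr_cong)
next
  case (CConn u \<psi>s)
  have "cval Pr N \<psi> v = cval Pr N \<psi> w" if "\<psi> \<in> set \<psi>s" for \<psi>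
    by (rule CConn.IH[OF that]) (use CConn.prems that in \<open>simp, force\<close>)
  then have "map (\<lambda>\<psi>. cval Pr N \<psi> v) \<psi>s = map (\<lambda>\<psi>. cval Pr N \<psi> w) \<psi>s"
    by (intro map_cong refl)
  then show ?case by (simp only: cval.simps)
next
  case (CSup i \<psi>)
  have wf: "cfm_wf U \<psi>" using CSup.prems(1) by simp
  have "cval Pr N \<psi> (v(i := c)) = cval Pr N \<psi> (w(i := c))" for c
    by (rule CSup.IH[OF wf]) (use CSup.prems(2) in simp)
  then show ?case by (simp only: cval.simps)
next
  case (CInf i \<psi>)
  have wf: "cfm_wf U \<psi>" using CInf.prems(1) by simp
  have "cval Pr N \<psi> (v(i := c)) = cval Pr N \<psi> (w(i := c))" for c
    by (rule CInf.IH[OF wf]) (use CInf.prems(2) in simp)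
  then show ?case by (simp only: cval.simps)
qed

text \<open>
  Uniformity in the assignment is what makes the induction pass through suprema and infima.
\<close>

lemma cvalue_uniformly_continuous:
  assumes "cfm_wf U \<psi>" "\<epsilon> > 0"
  shows "\<exists>\<delta>>0. \<forall>v w. (\<forall>i\<in>cfv \<psi>. rdist Pr (v i) (w i) < \<delta>) \<longrightarrow> \<bar>cvalue Pr \<psi> v - cvalue Pr \<psi> w\<bar> \<le> \<epsilon>"
  using assms
proof (induction \<psi> arbitrary: \<epsilon>)
  case (CProb \<phi>)
  define \<delta> where "\<delta> = \<epsilon> / (1 + real (card (fv \<phi>)))"
  show ?case
  proof (intro exI[of _ \<delta>] conjI allI impI)
    show "\<delta> > 0" using CProb by (simp add: \<delta>_def)
    fix v w :: "nat \<Rightarrow> 'c" assume "\<forall>i\<in>cfv (CProb \<phi>). rdist Pr (v i) (w i) < \<delta>"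
    then have "(\<Sum>i\<in>fv \<phi>. rdist Pr (v i) (w i)) \<le> (\<Sum>i\<in>fv \<phi>. \<delta>)" by (intro sum_mono) auto
    also have "\<dots> = card (fv \<phi>) * \<delta>" by simp
    also have "\<dots> \<le> \<epsilon>" using CProb.prems(2) by (simp add: \<delta>_def field_simps)
    finally show "\<bar>cvalue Pr (CProb \<phi>) v - cvalue Pr (CProb \<phi>) w\<bar> \<le> \<epsilon>"
      using Pr_lipschitz[of \<phi> v w] CProb.prems by simp
  qed
next
  case (CConn u \<psi>s)
  have u: "continuous_on {t. \<forall>i. t i \<in> {0..1}} u" using CConn.prems by simp
  obtain \<eta> where \<eta>: "\<eta> > 0" "\<And>s t. (\<And>i. s i \<in> {0..1}) \<Longrightarrow> (\<And>i. t i \<in> {0..1}) \<Longrightarrow>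
      (\<And>i. \<bar>s i - t i\<bar> \<le> \<eta>) \<Longrightarrow> \<bar>u s - u t\<bar> \<le> \<epsilon>"
    by (rule connective_uniformly_continuous[OF u CConn.prems(2)]) blast
  have "\<forall>\<psi>\<in>set \<psi>s. \<exists>\<delta>>0. \<forall>v w. (\<forall>i\<in>cfv \<psi>. rdist Pr (v i) (w i) < \<delta>) \<longrightarrow>
      \<bar>cvalue Pr \<psi> v - cvalue Pr \<psi> w\<bar> \<le> \<eta>"
    using CConn \<eta>(1) by auto
  then obtain D where D: "\<And>\<psi>. \<psi> \<in> set \<psi>s \<Longrightarrow> D \<psi> > 0"
    "\<And>\<psi> v w. \<psi> \<in> set \<psi>s \<Longrightarrow> (\<forall>i\<in>cfv \<psi>. rdist Pr (v i) (w i) < D \<psi>) \<Longrightarrow>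
      \<bar>cvalue Pr \<psi> v - cvalue Pr \<psi> w\<bar> \<le> \<eta>"
    by metis
  let ?\<delta> = "Min (insert 1 (D ` set \<psi>s))"
  show ?case
  proof (intro exI[of _ ?\<delta>] conjI allI impI)
    show "?\<delta> > 0" using D(1) by simp
    fix v w :: "nat \<Rightarrow> 'c" assume *: "\<forall>i\<in>cfv (CConn u \<psi>s). rdist Pr (v i) (w i) < ?\<delta>"
    have near: "\<bar>cvalue Pr \<psi> v - cvalue Pr \<psi> w\<bar> \<le> \<eta>" if "\<psi> \<in> set \<psi>s" for \<psi>
    proof (rule D(2)[OF that], rule ballI)
      fix i assume "i \<in> cfv \<psi>"
      then have "rdist Pr (v i) (w i) < ?\<delta>" using * that by auto
      also have "?\<delta> \<le> D \<psi>" using that by (intro Min_le) auto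
      finally show "rdist Pr (v i) (w i) < D \<psi>" .
    qed
    have wf: "\<forall>\<psi>\<in>set \<psi>s. cfm_wf U \<psi>" using CConn.prems by simp
    show "\<bar>cvalue Pr (CConn u \<psi>s) v - cvalue Pr (CConn u \<psi>s) w\<bar> \<le> \<epsilon>"
      unfolding cval.simps cval_CConn_arg
    proof (rule \<eta>(2))
      fix i
      show "(if i < length \<psi>s then cvalue Pr (\<psi>s ! i) v else 0) \<in> {0..1}"
        "(if i < length \<psi>s then cvalue Pr (\<psi>s ! i) w else 0) \<in> {0..1}"
        using cval_bounds[of "\<psi>s ! i" UNIV] wf by auto
      show "\<bar>(if i < length \<psi>s then cvalue Pr (\<psi>s ! i) v else 0) -
          (if i < length \<psi>s then cvalue Pr (\<psi>s ! i) w else 0)\<bar> \<le> \<eta>"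
        using near \<eta>(1) by auto
    qed
  qed
next
  case (CSup i \<psi>)
  then obtain \<delta> where \<delta>: "\<delta> > 0" "\<And>v w. (\<forall>i\<in>cfv \<psi>. rdist Pr (v i) (w i) < \<delta>) \<Longrightarrow>
      \<bar>cvalue Pr \<psi> v - cvalue Pr \<psi> w\<bar> \<le> \<epsilon>" by (metis cfm_wf.simps(3))
  show ?case
  proof (intro exI[of _ \<delta>] conjI allI impI \<delta>(1))
    fix v w :: "nat \<Rightarrow> 'c" assume *: "\<forall>j\<in>cfv (CSup i \<psi>). rdist Pr (v j) (w j) < \<delta>"
    have "\<bar>cvalue Pr \<psi> (v(i := c)) - cvalue Pr \<psi> (w(i := c))\<bar> \<le> \<epsilon>" for c
      by (rule \<delta>(2)) (use * \<delta>(1) in auto)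
    then show "\<bar>cvalue Pr (CSup i \<psi>) v - cvalue Pr (CSup i \<psi>) w\<bar> \<le> \<epsilon>"
      unfolding cval.simps using CSup.prems
      by (intro abs_SUP_diff_le cval_bdd) auto
  qed
next
  case (CInf i \<psi>)
  then obtain \<delta> where \<delta>: "\<delta> > 0" "\<And>v w. (\<forall>i\<in>cfv \<psi>. rdist Pr (v i) (w i) < \<delta>) \<Longrightarrow>
      \<bar>cvalue Pr \<psi> v - cvalue Pr \<psi> w\<bar> \<le> \<epsilon>" by (metis cfm_wf.simps(4))
  show ?case
  proof (intro exI[of _ \<delta>] conjI allI impI \<delta>(1))
    fix v w :: "nat \<Rightarrow> 'c" assume *: "\<forall>j\<in>cfv (CInf i \<psi>). rdist Pr (v j) (w j) < \<delta>"
    have "\<bar>cvalue Pr \<psi> (v(i := c)) - cvalue Pr \<psi> (w(i := c))\<bar> \<le> \<epsilon>" for c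
      by (rule \<delta>(2)) (use * \<delta>(1) in auto)
    then show "\<bar>cvalue Pr (CInf i \<psi>) v - cvalue Pr (CInf i \<psi>) w\<bar> \<le> \<epsilon>"
      unfolding cval.simps using CInf.prems
      by (intro abs_INF_diff_le cval_bdd) auto
  qed
qed

lemma cvalue_le_CSups:
  assumes "cfm_wf U \<psi>"
  shows "cvalue Pr \<psi> (override_on v w (set xs)) \<le> cvalue Pr (foldr CSup xs \<psi>) v"
proof (induction xs arbitrary: v)
  case (Cons i xs)
  have wf: "cfm_wf U (foldr CSup xs \<psi>)" using assms by (induction xs) auto
  have "override_on v w (set (i # xs)) = override_on (v(i := w i)) w (set xs)"
    by (auto simp: override_on_def)
  then have "cvalue Pr \<psi> (override_on v w (set (i # xs))) \<le> cvalue Pr (foldr CSup xs \<psi>) (v(i := w i))"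
    using Cons.IH[of "v(i := w i)"] by (simp only:)
  also have "\<dots> \<le> cvalue Pr (foldr CSup (i # xs) \<psi>) v"
    using cSUP_upper[OF UNIV_I cval_bdd(1)[OF wf], of "\<lambda>c. v(i := c)" "w i"] by simp
  finally show ?case .
qed simp

lemma CInfs_le_cvalue:
  assumes "cfm_wf U \<psi>"
  shows "cvalue Pr (foldr CInf xs \<psi>) v \<le> cvalue Pr \<psi> (override_on v w (set xs))"
proof (induction xs arbitrary: v)
  case (Cons i xs)
  have wf: "cfm_wf U (foldr CInf xs \<psi>)" using assms by (induction xs) auto
  have "override_on v w (set (i # xs)) = override_on (v(i := w i)) w (set xs)"
    by (auto simp: override_on_def)
  then have "cvalue Pr \<psi> (override_on v w (set (i # xs))) \<ge> cvalue Pr (foldr CInf xs \<psi>) (v(i := w i))"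
    using Cons.IH[of "v(i := w i)"] by (simp only:)
  moreover have "cvalue Pr (foldr CInf xs \<psi>) (v(i := w i)) \<ge> cvalue Pr (foldr CInf (i # xs) \<psi>) v"
    using cINF_lower[OF cval_bdd(2)[OF wf], of UNIV "w i" "\<lambda>c. v(i := c)"] by simp
  ultimately show ?case by simp
qed simp

lemma CInfs_less_witness:
  assumes "cfm_wf U \<psi>" "N \<noteq> {}" "cval Pr N (foldr CInf xs \<psi>) v < \<delta>"
  obtains w where "\<And>i. i \<in> set xs \<Longrightarrow> w i \<in> N" "cval Pr N \<psi> (override_on v w (set xs)) < \<delta>"
  using assms(3)
proof (induction xs arbitrary: v thesis)
  case Nil
  then show ?case by simp
next
  case (Cons i xs)
  have wf: "cfm_wf U (foldr CInf xs \<psi>)" using assms(1) by (induction xs) auto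
  have "(INF c\<in>N. cval Pr N (foldr CInf xs \<psi>) (v(i := c))) < \<delta>" using Cons.prems(2) by simp
  then obtain c where c: "c \<in> N" "cval Pr N (foldr CInf xs \<psi>) (v(i := c)) < \<delta>"
    using cINF_less_iff[OF assms(2) cval_bdd(2)[OF wf assms(2)], of "\<lambda>c. v(i := c)" \<delta>] by auto
  obtain w where w: "\<And>j. j \<in> set xs \<Longrightarrow> w j \<in> N" "cval Pr N \<psi> (override_on (v(i := c)) w (set xs)) < \<delta>"
    using Cons.IH[OF _ c(2)] by blast
  show ?case
  proof (rule Cons.prems(1)[of "if i \<in> set xs then w else w(i := c)"])
    have "override_on v (if i \<in> set xs then w else w(i := c)) (set (i # xs)) = override_on (v(i := c)) w (set xs)"
      by (auto simp: override_on_def fun_eq_iff)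
    then show "cval Pr N \<psi> (override_on v (if i \<in> set xs then w else w(i := c)) (set (i # xs))) < \<delta>"
      using w(2) by simp
  qed (use w(1) c(1) in auto)
qed

lemma CInfs_mono:
  assumes "cfm_wf U \<psi>" "cfm_wf U \<psi>'" "\<And>v. cvalue Pr \<psi> v \<le> cvalue Pr \<psi>' v"
  shows "cvalue Pr (foldr CInf xs \<psi>) v \<le> cvalue Pr (foldr CInf xs \<psi>') v"
proof (induction xs arbitrary: v)
  case (Cons i xs)
  have wf: "cfm_wf U (foldr CInf xs \<psi>)" using assms(1) by (induction xs) auto
  have "(INF c. cvalue Pr (foldr CInf xs \<psi>) (v(i := c))) \<le> (INF c. cvalue Pr (foldr CInf xs \<psi>') (v(i := c)))"
    by (rule cINF_mono[OF UNIV_not_empty cval_bdd(2)[OF wf UNIV_not_empty]]) (use Cons.IH in blast)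
  then show ?case by simp
qed (simp add: assms)

lemma cfm_wf_CInfs: "cfm_wf U (foldr CInf xs \<psi>) \<longleftrightarrow> cfm_wf U \<psi>"
  by (induction xs) auto

end

section \<open>Simple random variables\<close>

lemma simple_rvs_comp:
  assumes "T \<in> simple_rvs \<Omega> A" "G ` A \<subseteq> B"
  shows "(\<lambda>\<omega>. G (T \<omega>)) \<in> simple_rvs \<Omega> B"
proof -
  have fin: "finite (T ` space \<Omega>)" using assms(1) by (simp add: simple_rvs_def)
  have "{\<omega>\<in>space \<Omega>. G (T \<omega>) = a} \<in> sets \<Omega>" for a
  proof -
    have "{\<omega>\<in>space \<Omega>. G (T \<omega>) = a} = (\<Union>t\<in>{t \<in> T ` space \<Omega>. G t = a}. {\<omega>\<in>space \<Omega>. T \<omega> = t})" by auto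
    also have "\<dots> \<in> sets \<Omega>" using assms(1) fin by (intro sets.finite_UN) (auto simp: simple_rvs_def)
    finally show ?thesis .
  qed
  moreover have "finite ((\<lambda>\<omega>. G (T \<omega>)) ` space \<Omega>)"
    using finite_imageI[OF fin, of G] by (simp add: image_image)
  moreover have "(\<lambda>\<omega>. G (T \<omega>)) ` space \<Omega> \<subseteq> B"
    using assms unfolding simple_rvs_def by blast
  ultimately show ?thesis unfolding simple_rvs_def by blast
qed

lemma simple_rvs_event:
  assumes "T \<in> simple_rvs \<Omega> A"
  shows "{\<omega>\<in>space \<Omega>. Q (T \<omega>)} \<in> sets \<Omega>"
proof -
  have "(\<lambda>\<omega>. Q (T \<omega>)) \<in> simple_rvs \<Omega> UNIV" by (rule simple_rvs_comp[OF assms]) simp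
  then have "{\<omega>\<in>space \<Omega>. Q (T \<omega>) = True} \<in> sets \<Omega>" unfolding simple_rvs_def by blast
  then show ?thesis by simp
qed

text \<open>
  A finite tuple of simple random variables is one simple random variable with values in tuples.
  Anything that depends on finitely many simple random variables is thus handled by
  \<open>simple_rvs_comp\<close> and \<open>simple_rvs_event\<close>.
\<close>

lemma simple_rvs_tuple:
  assumes "finite S" "S \<noteq> {}" "\<And>l. l \<in> S \<Longrightarrow> h l \<in> simple_rvs \<Omega> M"
  shows "(\<lambda>\<omega>. restrict (\<lambda>l. h l \<omega>) S) \<in> simple_rvs \<Omega> (S \<rightarrow>\<^sub>E M)"
proof -
  have "{\<omega>\<in>space \<Omega>. restrict (\<lambda>l. h l \<omega>) S = t} \<in> sets \<Omega>" for t
  proof (cases "t \<in> extensional S")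
    case True
    then have "{\<omega>\<in>space \<Omega>. restrict (\<lambda>l. h l \<omega>) S = t} = (\<Inter>l\<in>S. {\<omega>\<in>space \<Omega>. h l \<omega> = t l})"
      using assms(2) by (force simp: fun_eq_iff restrict_def extensional_def)
    also have "\<dots> \<in> sets \<Omega>" using assms by (intro sets.finite_INT) (auto simp: simple_rvs_def)
    finally show ?thesis .
  next
    case False
    then have "{\<omega>\<in>space \<Omega>. restrict (\<lambda>l. h l \<omega>) S = t} = {}" using restrict_extensional by blast
    then show ?thesis by (simp only: sets.empty_sets)
  qed
  moreover have "finite ((\<lambda>\<omega>. restrict (\<lambda>l. h l \<omega>) S) ` space \<Omega>)"
  proof (rule finite_subset)
    show "finite (\<Pi>\<^sub>E l\<in>S. h l ` space \<Omega>)" using assms by (intro finite_PiE) (auto simp: simple_rvs_def)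
  qed auto
  ultimately show ?thesis using assms(3) by (fastforce simp: simple_rvs_def)
qed

lemma simple_rvs_const: "a \<in> M \<Longrightarrow> (\<lambda>_. a) \<in> simple_rvs \<Omega> M"
  by (cases "space \<Omega> = {}") (auto simp: simple_rvs_def image_constant_conv)

lemma simple_rvs_mono: "f \<in> simple_rvs \<Omega> M \<Longrightarrow> M \<subseteq> N \<Longrightarrow> f \<in> simple_rvs \<Omega> N"
  by (auto simp: simple_rvs_def)

lemma true_in_event:
  assumes "\<And>l. h l \<in> simple_rvs \<Omega> M"
  shows "{\<omega>\<in>space \<Omega>. true_in U \<phi> (\<lambda>l. h l \<omega>)} \<in> sets \<Omega>"
proof -
  let ?S = "insert 0 (fv \<phi>)"
  have "{\<omega>\<in>space \<Omega>. true_in U \<phi> (restrict (\<lambda>l. h l \<omega>) ?S)} \<in> sets \<Omega>"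
    by (rule simple_rvs_event[OF simple_rvs_tuple]) (use assms finite_fv in auto)
  moreover have "true_in U \<phi> (restrict (\<lambda>l. h l \<omega>) ?S) \<longleftrightarrow> true_in U \<phi> (\<lambda>l. h l \<omega>)" for \<omega>
    by (rule sat_cong) auto
  ultimately show ?thesis by simp
qed

section \<open>Transfer from the randomization to the monster model\<close>

locale random_monster = random_structure U Pr
  for U :: "('f, 'r, 'u) model" and Pr :: "('f, 'r, 'u, 'c) rstruct" +
  fixes \<Omega> :: "'w measure" and e :: "('w \<Rightarrow> 'u) \<Rightarrow> 'c" and \<kappa>' :: "'l rel"
  assumes cmonster: "cmonster U Pr \<kappa>'" and prob_space: "prob_space \<Omega>"
    and embedding: "randomization_embedding U Pr \<Omega> e"
begin

interpretation \<Omega>: prob_space \<Omega> by (rule prob_space)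

lemma Pr_simple:
  "L_formula U \<phi> \<Longrightarrow> (\<And>l. h l \<in> simple_rvs \<Omega> UNIV) \<Longrightarrow>
    Pr \<phi> (\<lambda>l. e (h l)) = measure \<Omega> {\<omega>\<in>space \<Omega>. true_in U \<phi> (\<lambda>l. h l \<omega>)}"
  using embedding unfolding randomization_embedding_def by blast

lemma simple_in_randomization: "f \<in> simple_rvs \<Omega> M \<Longrightarrow> e f \<in> randomization Pr \<Omega> e M"
  unfolding randomization_def by (rule subsetD[OF closure_of_subset]) auto

lemma randomization_approx:
  assumes "range v \<subseteq> randomization Pr \<Omega> e M" "\<delta> > 0"
  obtains h where "\<And>l. h l \<in> simple_rvs \<Omega> M" "\<And>l. rdist Pr (v l) (e (h l)) < \<delta>"
proof -
  have "\<exists>f. f \<in> simple_rvs \<Omega> M \<and> rdist Pr (v l) (e f) < \<delta>" for l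
  proof -
    have "v l \<in> mtopology closure_of (e ` simple_rvs \<Omega> M)"
      using assms(1) by (auto simp: randomization_def)
    then show ?thesis using assms(2) by (auto simp: metric_closure_of)
  qed
  then show ?thesis using that by metis
qed

text \<open>
  A formula that vanishes at all tuples of simple random variables vanishes on all of \<open>U\<^sup>\<Omega>\<close> by
  continuity.  So the sentence that takes the supremum over all its variables has the value \<open>0\<close> in
  \<open>U\<^sup>\<Omega>\<close>, hence also in the monster model.
\<close>

lemma transfer_zero:
  assumes wf: "cfm_wf U \<psi>"
    and zero: "\<And>h. (\<And>l. h l \<in> simple_rvs \<Omega> UNIV) \<Longrightarrow> cvalue Pr \<psi> (\<lambda>l. e (h l)) \<le> 0"
  shows "cvalue Pr \<psi> v = 0"
proof -
  let ?R = "randomization Pr \<Omega> e UNIV"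
  have R: "?R \<noteq> {}" "\<And>\<psi> v. cfm_wf U \<psi> \<Longrightarrow> range v \<subseteq> ?R \<Longrightarrow> cval Pr ?R \<psi> v = cvalue Pr \<psi> v"
    using embedding unfolding randomization_embedding_def celem_sub_def by blast+
  have pos: "0 \<le> cvalue Pr \<psi> w" for w using cval_bounds[OF wf, of UNIV w] by simp
  have zeroR: "cval Pr ?R \<psi> v = 0" if v: "range v \<subseteq> ?R" for v
  proof -
    have "cvalue Pr \<psi> v \<le> \<epsilon>" if \<epsilon>: "\<epsilon> > 0" for \<epsilon>
    proof -
      obtain \<delta> where \<delta>: "\<delta> > 0" "\<And>v w. (\<forall>i\<in>cfv \<psi>. rdist Pr (v i) (w i) < \<delta>) \<Longrightarrow>
          \<bar>cvalue Pr \<psi> v - cvalue Pr \<psi> w\<bar> \<le> \<epsilon>"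
        using cvalue_uniformly_continuous[OF wf \<epsilon>] by blast
      obtain h where h: "\<And>l. h l \<in> simple_rvs \<Omega> UNIV" "\<And>l. rdist Pr (v l) (e (h l)) < \<delta>"
        using randomization_approx[OF v \<delta>(1)] by blast
      have "\<bar>cvalue Pr \<psi> v - cvalue Pr \<psi> (\<lambda>l. e (h l))\<bar> \<le> \<epsilon>" using h(2) by (intro \<delta>(2)) simp
      moreover have "cvalue Pr \<psi> (\<lambda>l. e (h l)) \<le> 0" by (rule zero) (rule h(1))
      ultimately show ?thesis by linarith
    qed
    then have "cvalue Pr \<psi> v \<le> 0" by (rule field_le_epsilon[of _ 0, simplified])
    then show ?thesis using pos[of v] R(2)[OF wf v] by simp
  qed
  obtain c where c: "c \<in> ?R" using R(1) by auto
  have sups: "cval Pr ?R (foldr CSup xs \<psi>) v = 0" if "range v \<subseteq> ?R" for xs v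
    using that
  proof (induction xs arbitrary: v)
    case (Cons i xs)
    have "cval Pr ?R (foldr CSup xs \<psi>) (v(i := d)) = 0" if "d \<in> ?R" for d
      by (rule Cons.IH) (use Cons.prems that in auto)
    then have "(SUP d\<in>?R. cval Pr ?R (foldr CSup xs \<psi>) (v(i := d))) = (SUP d\<in>?R. 0)"
      by (intro SUP_cong) auto
    then show ?case using R(1) by simp
  qed (simp add: zeroR)
  let ?xs = "sorted_list_of_set (cfv \<psi>)"
  have set: "set ?xs = cfv \<psi>" by (simp add: finite_cfv)
  have wfs: "cfm_wf U (foldr CSup xs \<psi>)" for xs using wf by (induction xs) auto
  have "cvalue Pr \<psi> v = cvalue Pr \<psi> (override_on (\<lambda>_. c) v (set ?xs))"
    by (rule cval_cong[OF wf]) (simp add: set)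
  also have "\<dots> \<le> cvalue Pr (foldr CSup ?xs \<psi>) (\<lambda>_. c)" by (rule cvalue_le_CSups[OF wf])
  also have "\<dots> = cval Pr ?R (foldr CSup ?xs \<psi>) (\<lambda>_. c)" by (rule R(2)[OF wfs, symmetric]) (use c in auto)
  also have "\<dots> = 0" by (rule sups) (use c in auto)
  finally show ?thesis using pos[of v] by simp
qed

text \<open>
  All the probability theory that is needed in the monster model: a linear inequality between the
  truth values of \<open>L\<close>-formulas which is valid in \<open>U\<close> holds for the probabilities.  For simple random
  variables one integrates it over \<open>\<Omega>\<close>; the rest is transfer.
\<close>

lemma Pr_linear:
  fixes xs :: "(real \<times> ('f, 'r, 'u) fm) list"
  assumes L: "\<And>c \<theta>. (c, \<theta>) \<in> set xs \<Longrightarrow> L_formula U \<theta>"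
    and le: "\<And>a. (\<Sum>(c, \<theta>)\<leftarrow>xs. c * of_bool (true_in U \<theta> a)) \<le> d"
  shows "(\<Sum>(c, \<theta>)\<leftarrow>xs. c * Pr \<theta> v) \<le> d"
proof -
  let ?u = "\<lambda>t :: nat \<Rightarrow> real. min 1 (max 0 ((\<Sum>i<length xs. fst (xs ! i) * t i) - d))"
  let ?\<psi> = "CConn ?u (map (\<lambda>x. CProb (snd x)) xs)"
  have "continuous_on UNIV ?u" by (intro continuous_intros continuous_on_product_coordinates)
  then have wf: "cfm_wf U ?\<psi>" using L by (auto intro: continuous_on_subset)
  have sum_eq: "(\<Sum>i<length xs. fst (xs ! i) * g (snd (xs ! i))) = (\<Sum>(c, \<theta>)\<leftarrow>xs. c * g \<theta>)" for g
    by (simp add: sum_list_sum_nth case_prod_beta atLeast0LessThan)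
  have val: "cvalue Pr ?\<psi> w = min 1 (max 0 ((\<Sum>(c, \<theta>)\<leftarrow>xs. c * Pr \<theta> w) - d))" for w
  proof -
    have "(\<Sum>i<length xs. fst (xs ! i) * (if i < length xs then Pr (snd (xs ! i)) w else 0)) =
      (\<Sum>(c, \<theta>)\<leftarrow>xs. c * Pr \<theta> w)" by (simp add: sum_eq[of "\<lambda>\<theta>. Pr \<theta> w", symmetric])
    then show ?thesis by (simp add: cong: if_cong)
  qed
  have "cvalue Pr ?\<psi> v = 0"
  proof (rule transfer_zero[OF wf])
    fix h :: "nat \<Rightarrow> 'w \<Rightarrow> 'u" assume h: "\<And>l. h l \<in> simple_rvs \<Omega> UNIV"
    let ?E = "\<lambda>\<theta>. {\<omega>\<in>space \<Omega>. true_in U \<theta> (\<lambda>l. h l \<omega>)}"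
    have E: "?E \<theta> \<in> sets \<Omega>" for \<theta> by (rule true_in_event[OF h])
    have "(\<Sum>(c, \<theta>)\<leftarrow>xs. c * Pr \<theta> (\<lambda>l. e (h l))) = (\<Sum>i<length xs. fst (xs ! i) * measure \<Omega> (?E (snd (xs ! i))))"
      unfolding sum_eq[symmetric] using L
      by (intro sum.cong refl arg_cong2[where f = times] Pr_simple h) (metis lessThan_iff nth_mem prod.collapse)
    also have "\<dots> = (\<integral>\<omega>. (\<Sum>i<length xs. fst (xs ! i) * indicator (?E (snd (xs ! i))) \<omega>) \<partial>\<Omega>)"
      using E by (subst Bochner_Integration.integral_sum)
        (auto intro!: integrable_mult_right integrable_real_indicator simp: \<Omega>.emeasure_eq_measure Int_absorb2 sets.sets_into_space)
    also have "\<dots> \<le> (\<integral>\<omega>. d \<partial>\<Omega>)"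
    proof (rule integral_mono)
      show "integrable \<Omega> (\<lambda>\<omega>. \<Sum>i<length xs. fst (xs ! i) * indicator (?E (snd (xs ! i))) \<omega>)"
        using E by (intro Bochner_Integration.integrable_sum integrable_mult_right integrable_real_indicator)
          (auto simp: \<Omega>.emeasure_eq_measure)
      fix \<omega> assume "\<omega> \<in> space \<Omega>"
      then have "(\<Sum>i<length xs. fst (xs ! i) * indicator (?E (snd (xs ! i))) \<omega>) =
          (\<Sum>i<length xs. fst (xs ! i) * of_bool (true_in U (snd (xs ! i)) (\<lambda>l. h l \<omega>)))"
        by (intro sum.cong refl) (simp add: indicator_def)
      also have "\<dots> \<le> d" using le[of "\<lambda>l. h l \<omega>"] by (simp add: sum_eq[of "\<lambda>\<theta>. of_bool (true_in U \<theta> (\<lambda>l. h l \<omega>))"])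
      finally show "(\<Sum>i<length xs. fst (xs ! i) * indicator (?E (snd (xs ! i))) \<omega>) \<le> d" .
    qed simp
    also have "\<dots> = d" by (simp add: \<Omega>.prob_space)
    finally show "cvalue Pr ?\<psi> (\<lambda>l. e (h l)) \<le> 0" unfolding val by simp
  qed
  then show ?thesis unfolding val by (auto simp: min_def max_def split: if_splits)
qed

lemma Pr_union_bound:
  assumes "L_formula U \<phi>" "\<And>\<theta>. \<theta> \<in> set \<theta>s \<Longrightarrow> L_formula U \<theta>"
    and "\<And>a. true_in U \<phi> a \<Longrightarrow> \<exists>\<theta>\<in>set \<theta>s. true_in U \<theta> a"
  shows "Pr \<phi> v \<le> (\<Sum>\<theta>\<leftarrow>\<theta>s. Pr \<theta> v)"
proof -
  have neg: "(\<Sum>(c, \<theta>)\<leftarrow>map (\<lambda>\<theta>. (-1, \<theta>)) \<theta>s. c * g \<theta>) = - (\<Sum>\<theta>\<leftarrow>\<theta>s. g \<theta>)" for g :: "_ \<Rightarrow> real"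
    by (induction \<theta>s) auto
  have "(\<Sum>(c, \<theta>)\<leftarrow>(1, \<phi>) # map (\<lambda>\<theta>. (-1, \<theta>)) \<theta>s. c * Pr \<theta> v) \<le> 0"
  proof (rule Pr_linear)
    fix a
    have "of_bool (true_in U \<theta> a) \<le> (\<Sum>\<theta>\<leftarrow>\<theta>s. of_bool (true_in U \<theta> a) :: real)" if "\<theta> \<in> set \<theta>s" for \<theta>
      using that by (intro member_le_sum_list) auto
    then have "of_bool (true_in U \<phi> a) \<le> (\<Sum>\<theta>\<leftarrow>\<theta>s. of_bool (true_in U \<theta> a) :: real)"
      using assms(3)[of a] sum_list_nonneg[of "map (\<lambda>\<theta>. of_bool (true_in U \<theta> a) :: real) \<theta>s"]
      by (cases "true_in U \<phi> a") force+
    then show "(\<Sum>(c, \<theta>)\<leftarrow>(1, \<phi>) # map (\<lambda>\<theta>. (-1, \<theta>)) \<theta>s. c * of_bool (true_in U \<theta> a)) \<le> (0::real)"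
      using neg[of "\<lambda>\<theta>. of_bool (true_in U \<theta> a)"] by simp
  qed (use assms in auto)
  then show ?thesis using neg[of "\<lambda>\<theta>. Pr \<theta> v"] by simp
qed

section \<open>Witnesses and saturation in the monster model\<close>

definition one_minus :: "('f, 'r, 'u) fm \<Rightarrow> ('f, 'r, 'u) cfm" where
  "one_minus \<theta> = CConn (\<lambda>t. 1 - t 0) [CProb \<theta>]"

lemma one_minus_wf: "L_formula U \<theta> \<Longrightarrow> cfm_wf U (one_minus \<theta>)"
  unfolding one_minus_def
  by (auto intro!: continuous_intros continuous_on_subset[OF continuous_on_product_coordinates])

lemma one_minus_value: "cvalue Pr (one_minus \<theta>) v = 1 - Pr \<theta> v"
  by (simp add: one_minus_def)

text \<open>
  Random witnesses are glued from classical ones: for simple random variables, choose a witness for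
  each of the finitely many values of the parameters.  The rest is transfer.
\<close>

lemma fullness:
  assumes L: "L_formula U \<Psi>" and ex: "\<And>a. \<exists>b. true_in U \<Psi> (override_on a b (set ws))"
  shows "cvalue Pr (foldr CInf ws (one_minus \<Psi>)) v = 0"
proof (rule transfer_zero)
  show "cfm_wf U (foldr CInf ws (one_minus \<Psi>))" by (simp add: cfm_wf_CInfs one_minus_wf L)
  fix h :: "nat \<Rightarrow> 'w \<Rightarrow> 'u" assume h: "\<And>l. h l \<in> simple_rvs \<Omega> UNIV"
  let ?S = "insert 0 (fv \<Psi>)"
  define B where "B a = (SOME b. true_in U \<Psi> (override_on a b (set ws)))" for a
  have B: "true_in U \<Psi> (override_on a (B a) (set ws))" for a
    unfolding B_def by (rule someI_ex[OF ex])
  define T where "T \<omega> = restrict (\<lambda>l. h l \<omega>) ?S" for \<omega>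
  have T: "T \<in> simple_rvs \<Omega> (?S \<rightarrow>\<^sub>E UNIV)"
    unfolding T_def by (rule simple_rvs_tuple) (use h finite_fv in auto)
  define w where "w l \<omega> = B (T \<omega>) l" for l \<omega>
  have w: "w l \<in> simple_rvs \<Omega> UNIV" for l
    unfolding w_def by (rule simple_rvs_comp[OF T, of "\<lambda>t. B t l"]) simp
  let ?k = "override_on h w (set ws)"
  have k: "?k l \<in> simple_rvs \<Omega> UNIV" for l using h w by (simp add: override_on_def)
  have "true_in U \<Psi> (\<lambda>l. ?k l \<omega>)" for \<omega>
  proof -
    have "true_in U \<Psi> (\<lambda>l. ?k l \<omega>) \<longleftrightarrow> true_in U \<Psi> (override_on (T \<omega>) (B (T \<omega>)) (set ws))"
      by (rule sat_cong) (simp add: override_on_def w_def T_def)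
    then show ?thesis using B by blast
  qed
  then have "Pr \<Psi> (\<lambda>l. e (?k l)) = 1" by (simp add: Pr_simple[OF L k] \<Omega>.prob_space)
  moreover have "(\<lambda>l. e (?k l)) = override_on (\<lambda>l. e (h l)) (\<lambda>l. e (w l)) (set ws)"
    by (auto simp: override_on_def)
  ultimately have "cvalue Pr (one_minus \<Psi>) (override_on (\<lambda>l. e (h l)) (\<lambda>l. e (w l)) (set ws)) = 0"
    by (simp add: one_minus_value)
  then show "cvalue Pr (foldr CInf ws (one_minus \<Psi>)) (\<lambda>l. e (h l)) \<le> 0"
    using CInfs_le_cvalue[OF one_minus_wf[OF L], of ws "\<lambda>l. e (h l)" "\<lambda>l. e (w l)"] by simp
qed

text \<open>
  Saturation of the monster model for an increasing sequence of conditions on a finite tuple.  Each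
  variable is found by one-variable saturation, for the conditions in which the remaining variables
  are bound by infima.
\<close>

lemma saturated_sequence:
  fixes \<psi> :: "nat \<Rightarrow> ('f, 'r, 'u) cfm"
  assumes wf: "\<And>n. cfm_wf U (\<psi> n)"
    and mono: "\<And>m n v. m \<le> n \<Longrightarrow> cvalue Pr (\<psi> m) v \<le> cvalue Pr (\<psi> n) v"
    and zero: "\<And>n. cvalue Pr (foldr CInf ws (\<psi> n)) v = 0"
  shows "\<exists>w. \<forall>n. cvalue Pr (\<psi> n) (override_on v w (set ws)) = 0"
  using zero
proof (induction ws arbitrary: v)
  case (Cons i ws)
  let ?D = "\<lambda>n c. cvalue Pr (foldr CInf ws (\<psi> n)) (v(i := c))"
  have wfs: "cfm_wf U (foldr CInf ws (\<psi> n))" for n by (simp add: cfm_wf_CInfs wf)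
  have "range ?D \<subseteq> cdef U Pr (range v)" unfolding cdef_def using wfs by blast
  moreover have "small \<kappa>' (range v)"
    using cmonster by (intro small_countable) (auto simp: cmonster_def)
  moreover have "\<forall>\<epsilon>>0. \<exists>c. \<forall>D\<in>F. D c \<le> \<epsilon>" if F: "finite F" "F \<subseteq> range ?D" for F
  proof (intro allI impI)
    fix \<epsilon> :: real assume "\<epsilon> > 0"
    obtain I where I: "finite I" "F = ?D ` I" using finite_subset_image[OF F] by auto
    define m where "m = Max (insert 0 I)"
    have "(INF c. ?D m c) < \<epsilon>" using Cons.prems[of m] \<open>\<epsilon> > 0\<close> by simp
    then obtain c where c: "?D m c < \<epsilon>"
      using cINF_less_iff[OF UNIV_not_empty cval_bdd(2)[OF wfs[of m] UNIV_not_empty], of "\<lambda>c. v(i := c)" \<epsilon>] by auto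
    have "?D n c \<le> \<epsilon>" if "n \<in> I" for n
    proof -
      have "n \<le> m" unfolding m_def using that I(1) by (intro Max_ge) auto
      then have "?D n c \<le> ?D m c" by (intro CInfs_mono wf mono)
      then show ?thesis using c by linarith
    qed
    then show "\<exists>c. \<forall>D\<in>F. D c \<le> \<epsilon>" unfolding I(2) by blast
  qed
  moreover have "csaturated U Pr \<kappa>'" using cmonster by (simp add: cmonster_def)
  ultimately have "\<exists>c. \<forall>D\<in>range ?D. D c = 0" unfolding csaturated_def by blast
  then obtain c where c': "\<forall>D\<in>range ?D. D c = 0" by blast
  have c: "?D n c = 0" for n using bspec[OF c', of "?D n"] by simp
  obtain w where w: "\<And>n. cvalue Pr (\<psi> n) (override_on (v(i := c)) w (set ws)) = 0"
    using Cons.IH[OF c] by blast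
  have "override_on v (if i \<in> set ws then w else w(i := c)) (set (i # ws)) = override_on (v(i := c)) w (set ws)"
    by (auto simp: override_on_def fun_eq_iff)
  then show ?case using w by (intro exI[of _ "if i \<in> set ws then w else w(i := c)"] allI) (simp only:)
qed simp

section \<open>Twins and renaming of variables\<close>

text \<open>
  The element \<open>d\<close>, seen through the variable \<open>x\<^sub>j\<close>, almost surely equals \<open>c\<close>, seen through \<open>x\<^sub>i\<close>.
\<close>

definition twin :: "nat \<Rightarrow> nat \<Rightarrow> 'c \<Rightarrow> 'c \<Rightarrow> bool" where
  "twin i j c d \<longleftrightarrow> Pr (FNeg (FEq (Var i) (Var j))) (\<lambda>l. if l = i then c else d) = 0"

lemma L_neq: "L_formula U (FNeg (FEq (Var i) (Var j)))"
  by simp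

lemma twin_exists:
  assumes "i \<noteq> j"
  shows "\<exists>d. twin i j c d"
proof -
  let ?\<Psi> = "FEq (Var i) (Var j)" and ?v = "\<lambda>_::nat. c"
  have L: "L_formula U ?\<Psi>" by simp
  have "cvalue Pr (foldr CInf [j] (one_minus ?\<Psi>)) ?v = 0"
  proof (rule fullness[OF L])
    fix a :: "nat \<Rightarrow> 'u"
    show "\<exists>b. true_in U ?\<Psi> (override_on a b (set [j]))"
      using assms by (intro exI[of _ "\<lambda>_. a i"]) (simp add: override_on_def)
  qed
  then have "\<exists>w. \<forall>n::nat. cvalue Pr (one_minus ?\<Psi>) (override_on ?v w (set [j])) = 0"
    by (intro saturated_sequence one_minus_wf L) simp_all
  then obtain w where w: "Pr ?\<Psi> (override_on ?v w {j}) = 1" by (auto simp: one_minus_value)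
  let ?w = "override_on ?v w {j}"
  have "(\<Sum>(c, \<theta>)\<leftarrow>[(1, ?\<Psi>), (1, FNeg ?\<Psi>)]. c * Pr \<theta> ?w) \<le> 1"
    by (rule Pr_linear) auto
  then have "Pr (FNeg ?\<Psi>) ?w \<le> 0" using w by simp
  then have "Pr (FNeg ?\<Psi>) ?w = 0" using Pr_bounds[OF L_neq, of i j ?w] by linarith
  moreover have "Pr (FNeg ?\<Psi>) ?w = Pr (FNeg ?\<Psi>) (\<lambda>l. if l = i then c else w j)"
    by (rule Pr_cong) (use assms in \<open>auto simp: override_on_def\<close>)
  ultimately show ?thesis unfolding twin_def by auto
qed

lemma twin_simple:
  assumes "f \<in> simple_rvs \<Omega> UNIV"
  shows "twin i j (e f) (e f)"
  using Pr_simple[OF L_neq, of "\<lambda>_. f" i j] assms unfolding twin_def by simp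

text \<open>
  Both sides can be evaluated at one common assignment.  There \<open>\<phi>\<close> and \<open>\<phi>'\<close> are equivalent outside of
  the events \<open>x\<^sub>j \<noteq> x\<^sub>r\<^sub>(\<^sub>j\<^sub>)\<close>, which have probability \<open>0\<close> by the choice of twins.
\<close>

lemma Pr_rename:
  assumes L: "L_formula U \<phi>" "L_formula U \<phi>'"
    and r: "\<And>a. true_in U \<phi>' a \<longleftrightarrow> true_in U \<phi> (\<lambda>l. a (r l))"
    and agree: "\<And>k. k \<in> fv \<phi> \<Longrightarrow> k \<in> fv \<phi>' \<Longrightarrow> v k = w k"
    and twins: "\<And>j. j \<in> fv \<phi> \<Longrightarrow> r j \<noteq> j \<Longrightarrow> r j \<notin> fv \<phi> \<and> twin j (r j) (v j) (w (r j))"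
  shows "Pr \<phi> v = Pr \<phi>' w"
proof -
  \<comment> \<open>The common assignment; \<open>v\<close> and \<open>w\<close> agree where both matter.\<close>
  define u where "u k = (if k \<in> fv \<phi> then v k else w k)" for k
  have u: "Pr \<phi> v = Pr \<phi> u" "Pr \<phi>' w = Pr \<phi>' u"
    using L agree by (auto simp: u_def intro!: Pr_cong)
  obtain js where js: "set js = {j \<in> fv \<phi>. r j \<noteq> j}"
    using finite_list[of "{j \<in> fv \<phi>. r j \<noteq> j}"] finite_fv[of \<phi>] by auto
  let ?d = "\<lambda>j. FNeg (FEq (Var j) (Var (r j))) :: ('f, 'r, 'u) fm"
  have "Pr (?d j) u = 0" if "j \<in> set js" for j
  proof -
    have j: "j \<in> fv \<phi>" "r j \<noteq> j" using that js by auto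
    have "Pr (?d j) u = Pr (?d j) (\<lambda>l. if l = j then v j else w (r j))"
      by (rule Pr_cong) (use j twins[OF j] in \<open>auto simp: u_def\<close>)
    then show ?thesis using twins[OF j] by (simp add: twin_def)
  qed
  then have sum0: "(\<Sum>\<theta>\<leftarrow>map ?d js. Pr \<theta> u) = 0" by (simp add: sum_list_0 cong: map_cong)
  have eq: "true_in U \<phi> a \<longleftrightarrow> true_in U \<phi>' a" if "\<forall>j\<in>set js. a j = a (r j)" for a
    unfolding r by (rule sat_cong) (use that js in \<open>metis (mono_tags, lifting) mem_Collect_eq\<close>)
  have "Pr \<phi> u \<le> (\<Sum>\<theta>\<leftarrow>\<phi>' # map ?d js. Pr \<theta> u)"
  proof (rule Pr_union_bound)
    fix a assume "true_in U \<phi> a"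
    then show "\<exists>\<theta>\<in>set (\<phi>' # map ?d js). true_in U \<theta> a" using eq[of a] by auto
  qed (use L in auto)
  moreover have "Pr \<phi>' u \<le> (\<Sum>\<theta>\<leftarrow>\<phi> # map ?d js. Pr \<theta> u)"
  proof (rule Pr_union_bound)
    fix a assume "true_in U \<phi>' a"
    then show "\<exists>\<theta>\<in>set (\<phi> # map ?d js). true_in U \<theta> a" using eq[of a] by auto
  qed (use L in auto)
  ultimately show ?thesis using u sum0 by simp
qed

definition renaming :: "(nat \<Rightarrow> nat) \<Rightarrow> ('f, 'r, 'u) cfm \<Rightarrow> ('f, 'r, 'u) cfm \<Rightarrow> bool" where
  "renaming r \<psi> \<psi>' \<longleftrightarrow> cfm_wf U \<psi>' \<and> cfv \<psi>' \<subseteq> r ` cfv \<psi> \<and>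
    (\<forall>v w. (\<forall>j\<in>cfv \<psi>. if r j = j then v j = w j else twin j (r j) (v j) (w (r j))) \<longrightarrow>
      cvalue Pr \<psi> v = cvalue Pr \<psi>' w)"

lemma renaming_value:
  assumes "renaming r \<psi> \<psi>'"
    "\<And>j. j \<in> cfv \<psi> \<Longrightarrow> if r j = j then v j = w j else twin j (r j) (v j) (w (r j))"
  shows "cvalue Pr \<psi> v = cvalue Pr \<psi>' w"
  using assms unfolding renaming_def by blast

lemma renaming_quantifier:
  assumes ren: "renaming (r(i := i)) \<psi> \<psi>'" and r: "\<And>j. r j = j \<or> r j > i"
    and vw: "\<And>j. j \<in> cfv \<psi> - {i} \<Longrightarrow> if r j = j then v j = w j else twin j (r j) (v j) (w (r j))"
  shows "cvalue Pr \<psi> (v(i := c)) = cvalue Pr \<psi>' (w(i := c))"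
proof (rule renaming_value[OF ren])
  fix j assume j: "j \<in> cfv \<psi>"
  show "if (r(i := i)) j = j then (v(i := c)) j = (w(i := c)) j
    else twin j ((r(i := i)) j) ((v(i := c)) j) ((w(i := c)) ((r(i := i)) j))"
  proof (cases "j = i")
    case False
    then have "j \<in> cfv \<psi> - {i}" using j by simp
    from vw[OF this] show ?thesis using False r[of j] by (cases "r j = j") auto
  qed simp
qed

text \<open>
  Free variables of a formula of the randomization language may be renamed to variables beyond some
  bound \<open>K\<close> (which depends on the bound variables too, so that no capture occurs), at the price of
  passing to twins.  Bound variables keep their names: a quantifier over \<open>x\<^sub>i\<close> could not be matched
  with one over \<open>x\<^sub>j\<close> without knowing that every element has twins in both directions.
\<close>

lemma renaming_exists:
  assumes "cfm_wf U \<psi>"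
  shows "\<exists>K::nat. \<forall>r. (\<forall>j. r j = j \<or> r j \<ge> K) \<longrightarrow> (\<exists>\<psi>'. renaming r \<psi> \<psi>')"
  using assms
proof (induction \<psi>)
  case (CProb \<phi>)
  obtain K where K: "\<And>k. k \<in> fv \<phi> \<Longrightarrow> k < K" using finite_fv[of \<phi>] finite_nat_set_iff_bounded by auto
  show ?case
  proof (rule exI[of _ K], intro allI impI)
    fix r :: "nat \<Rightarrow> nat" assume r: "\<forall>j. r j = j \<or> r j \<ge> K"
    obtain \<phi>' where \<phi>': "L_formula U \<phi>'" "fv \<phi>' \<subseteq> r ` fv \<phi>"
      "\<And>a. true_in U \<phi>' a \<longleftrightarrow> true_in U \<phi> (\<lambda>l. a (r l))"
      using ex_subst_fv[of U "{}" \<phi> r] CProb by auto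
    have "Pr \<phi> v = Pr \<phi>' w"
      if vw: "\<forall>j\<in>fv \<phi>. if r j = j then v j = w j else twin j (r j) (v j) (w (r j))" for v w
    proof (rule Pr_rename[of \<phi> \<phi>' r])
      fix k assume k: "k \<in> fv \<phi>" "k \<in> fv \<phi>'"
      then obtain j where "j \<in> fv \<phi>" "k = r j" using \<phi>'(2) by auto
      moreover have "k < K" using K k(1) by auto
      ultimately have "r k = k" using r by (metis not_le)
      then show "v k = w k" using bspec[OF vw k(1)] by simp
    next
      fix j assume j: "j \<in> fv \<phi>" "r j \<noteq> j"
      then have "r j \<ge> K" using r by blast
      then have "r j \<notin> fv \<phi>" using K by fastforce
      then show "r j \<notin> fv \<phi> \<and> twin j (r j) (v j) (w (r j))" using bspec[OF vw j(1)] j(2) by simp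
    qed (use CProb \<phi>' in auto)
    then show "\<exists>\<psi>'. renaming r (CProb \<phi>) \<psi>'"
      unfolding renaming_def using \<phi>' by (intro exI[of _ "CProb \<phi>'"]) simp
  qed
next
  case (CConn u \<psi>s)
  have "\<forall>\<psi>\<in>set \<psi>s. \<exists>K. \<forall>r. (\<forall>j. r j = j \<or> r j \<ge> K) \<longrightarrow> (\<exists>\<psi>'. renaming r \<psi> \<psi>')"
    using CConn.IH CConn.prems by simp
  from bchoice[OF this] obtain Kf where
    Kf: "\<forall>\<psi>\<in>set \<psi>s. \<forall>r. (\<forall>j. r j = j \<or> r j \<ge> Kf \<psi>) \<longrightarrow> (\<exists>\<psi>'. renaming r \<psi> \<psi>')" ..
  define K where "K = Max (insert 0 (Kf ` set \<psi>s))"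
  show ?case
  proof (rule exI[of _ K], intro allI impI)
    fix r :: "nat \<Rightarrow> nat" assume r: "\<forall>j. r j = j \<or> r j \<ge> K"
    have "\<forall>\<psi>\<in>set \<psi>s. \<exists>\<psi>'. renaming r \<psi> \<psi>'"
    proof
      fix \<psi> assume \<psi>: "\<psi> \<in> set \<psi>s"
      have "Kf \<psi> \<le> K" unfolding K_def using \<psi> by (intro Max_ge) auto
      then have "\<forall>j. r j = j \<or> r j \<ge> Kf \<psi>" using r le_trans by blast
      then show "\<exists>\<psi>'. renaming r \<psi> \<psi>'" using Kf \<psi> by blast
    qed
    from bchoice[OF this] obtain f where f: "\<forall>\<psi>\<in>set \<psi>s. renaming r \<psi> (f \<psi>)" ..
    have "cfm_wf U (CConn u (map f \<psi>s))" using f CConn.prems by (simp add: renaming_def)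
    moreover have "cfv (CConn u (map f \<psi>s)) \<subseteq> r ` cfv (CConn u \<psi>s)"
      using f by (fastforce simp: renaming_def)
    moreover have "cvalue Pr (CConn u \<psi>s) v = cvalue Pr (CConn u (map f \<psi>s)) w"
      if vw: "\<forall>j\<in>cfv (CConn u \<psi>s). if r j = j then v j = w j else twin j (r j) (v j) (w (r j))" for v w
    proof -
      have "cvalue Pr \<psi> v = cvalue Pr (f \<psi>) w" if "\<psi> \<in> set \<psi>s" for \<psi>
      proof (rule renaming_value[OF bspec[OF f that]])
        fix j assume "j \<in> cfv \<psi>"
        then have "j \<in> cfv (CConn u \<psi>s)" using that by auto
        then show "if r j = j then v j = w j else twin j (r j) (v j) (w (r j))" by (rule bspec[OF vw])
      qed
      then have "(if i < length \<psi>s then cvalue Pr (\<psi>s ! i) v else 0) =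
          (if i < length \<psi>s then cvalue Pr (f (\<psi>s ! i)) w else 0)" for i by simp
      then show ?thesis
        unfolding cval.simps cval_CConn_arg length_map by (simp cong: if_cong)
    qed
    ultimately show "\<exists>\<psi>'. renaming r (CConn u \<psi>s) \<psi>'" unfolding renaming_def by blast
  qed
next
  case (CSup i \<psi>)
  then obtain K where K: "\<And>r. \<forall>j. r j = j \<or> r j \<ge> K \<Longrightarrow> \<exists>\<psi>'. renaming r \<psi> \<psi>'" by auto
  show ?case
  proof (rule exI[of _ "max K (Suc i)"], intro allI impI)
    fix r :: "nat \<Rightarrow> nat" assume r: "\<forall>j. r j = j \<or> r j \<ge> max K (Suc i)"
    then have "\<forall>j. (r(i := i)) j = j \<or> (r(i := i)) j \<ge> K" by auto
    from K[OF this] obtain \<psi>' where \<psi>': "renaming (r(i := i)) \<psi> \<psi>'" ..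
    have r': "r j = j \<or> r j > i" for j using r by (metis Suc_le_lessD max.boundedE)
    have "cvalue Pr (CSup i \<psi>) v = cvalue Pr (CSup i \<psi>') w"
      if "\<forall>j\<in>cfv (CSup i \<psi>). if r j = j then v j = w j else twin j (r j) (v j) (w (r j))" for v w
      using renaming_quantifier[OF \<psi>' r', of v w] that by simp
    moreover have "cfv (CSup i \<psi>') \<subseteq> r ` cfv (CSup i \<psi>)"
      using \<psi>' by (auto simp: renaming_def split: if_splits)
    moreover have "cfm_wf U (CSup i \<psi>')" using \<psi>' by (simp add: renaming_def)
    ultimately show "\<exists>\<psi>'. renaming r (CSup i \<psi>) \<psi>'" unfolding renaming_def by blast
  qed
next
  case (CInf i \<psi>)
  then obtain K where K: "\<And>r. \<forall>j. r j = j \<or> r j \<ge> K \<Longrightarrow> \<exists>\<psi>'. renaming r \<psi> \<psi>'" by auto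
  show ?case
  proof (rule exI[of _ "max K (Suc i)"], intro allI impI)
    fix r :: "nat \<Rightarrow> nat" assume r: "\<forall>j. r j = j \<or> r j \<ge> max K (Suc i)"
    then have "\<forall>j. (r(i := i)) j = j \<or> (r(i := i)) j \<ge> K" by auto
    from K[OF this] obtain \<psi>' where \<psi>': "renaming (r(i := i)) \<psi> \<psi>'" ..
    have r': "r j = j \<or> r j > i" for j using r by (metis Suc_le_lessD max.boundedE)
    have "cvalue Pr (CInf i \<psi>) v = cvalue Pr (CInf i \<psi>') w"
      if "\<forall>j\<in>cfv (CInf i \<psi>). if r j = j then v j = w j else twin j (r j) (v j) (w (r j))" for v w
      using renaming_quantifier[OF \<psi>' r', of v w] that by simp
    moreover have "cfv (CInf i \<psi>') \<subseteq> r ` cfv (CInf i \<psi>)"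
      using \<psi>' by (auto simp: renaming_def split: if_splits)
    moreover have "cfm_wf U (CInf i \<psi>')" using \<psi>' by (simp add: renaming_def)
    ultimately show "\<exists>\<psi>'. renaming r (CInf i \<psi>) \<psi>'" unfolding renaming_def by blast
  qed
qed

end

section \<open>Values of the canonical extension\<close>

lemma step_approx_value:
  assumes "step_approx U A V f \<epsilon> k D r"
  shows "\<bar>f b - (\<Sum>j<k. r j * of_bool (b \<in> D j))\<bar> \<le> \<epsilon>"
proof -
  obtain i where i: "i < k" "b \<in> D i" using assms unfolding step_approx_def by blast
  have "b \<in> D j \<longleftrightarrow> j = i" if "j < k" for j
    using i that assms unfolding step_approx_def disjoint_family_on_def by blast
  then have "(\<Sum>j<k. r j * of_bool (b \<in> D j)) = (\<Sum>j<k. if j = i then r j else 0)"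
    by (intro sum.cong) auto
  also have "\<dots> = r i" using i by simp
  finally show ?thesis using i assms by (simp add: step_approx_def)
qed

text \<open>
  The type \<open>p\<close> is \<open>r\<^sub>\<mu>\<close>.  The assumption \<open>elem\<close> is the part \<open>M\<^sup>\<Omega> \<preceq> \<C>\<close> of its generic stability; the part
  about sequences enters as a hypothesis of the final contradiction only.
\<close>

locale canonical_extension = random_monster U Pr \<Omega> e \<kappa>'
  for U :: "('f, 'r, 'u) model" and Pr :: "('f, 'r, 'u, 'c) rstruct"
    and \<Omega> :: "'w measure" and e :: "('w \<Rightarrow> 'u) \<Rightarrow> 'c" and \<kappa>' :: "'l rel" +
  fixes \<kappa> :: "'k rel" and M :: "'u set" and \<mu> :: "'u set \<Rightarrow> real" and p :: "('c \<Rightarrow> real) \<Rightarrow> real"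
  assumes U_monster: "monster U \<kappa>" and definable: "definable_over U \<kappa> M \<mu>"
    and canonical: "is_canonical_extension U Pr \<Omega> e M \<mu> p"
    and elem: "celem_sub U Pr (randomization Pr \<Omega> e M)"
    and small_N: "small \<kappa>' (randomization Pr \<Omega> e M)"
begin

interpretation \<Omega>: prob_space \<Omega> by (rule prob_space)

abbreviation N :: "'c set" where "N \<equiv> randomization Pr \<Omega> e M"

definition const_rv :: "(nat \<Rightarrow> 'u) \<Rightarrow> nat \<Rightarrow> 'c" where "const_rv m l = e (\<lambda>_. m l)"

lemma M_nonempty: "M \<noteq> {}"
  using definable by (auto simp: definable_over_def elem_sub_def)

lemma const_rv_simple: "range m \<subseteq> M \<Longrightarrow> const_rv m l \<in> e ` simple_rvs \<Omega> M"
  unfolding const_rv_def by (intro imageI simple_rvs_const) auto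

lemma const_rv_N: "range m \<subseteq> M \<Longrightarrow> const_rv m l \<in> N"
  unfolding const_rv_def by (intro simple_in_randomization simple_rvs_const) auto

text \<open>
  Types over \<open>M\<^sub>0\<^sup>\<Omega>\<close> are approximated by tuples from \<open>M\<^sub>0\<^sup>\<Omega>\<close>.  The conditions are combined to a single
  formula \<open>T\<close>, which is \<open>0\<close> at \<open>g\<close>; by \<open>M\<^sup>\<Omega> \<preceq> \<C>\<close> it is almost \<open>0\<close> at a tuple from \<open>M\<^sup>\<Omega>\<close>, and by
  continuity at one from \<open>M\<^sub>0\<^sup>\<Omega>\<close>.  Different conditions may put different parameters at the same
  variable, so their parameters are first renamed apart; elements of \<open>M\<^sub>0\<^sup>\<Omega>\<close> are their own twins.
\<close>

lemma simple_tuples_dense: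
  fixes xs :: "(('f, 'r, 'u) cfm \<times> (nat \<Rightarrow> 'c)) list"
  assumes Y: "finite Y" and wf: "\<And>\<theta> u. (\<theta>, u) \<in> set xs \<Longrightarrow> cfm_wf U \<theta>"
    and u: "\<And>\<theta> u. (\<theta>, u) \<in> set xs \<Longrightarrow> range u \<subseteq> e ` simple_rvs \<Omega> M" and \<epsilon>: "\<epsilon> > 0"
  shows "\<exists>h. (\<forall>l. h l \<in> simple_rvs \<Omega> M) \<and> (\<forall>(\<theta>, u)\<in>set xs.
    \<bar>cvalue Pr \<theta> (override_on u (\<lambda>l. e (h l)) Y) - cvalue Pr \<theta> (override_on u g Y)\<bar> < \<epsilon>)"
proof -
  let ?n = "length xs"
  define \<theta> where "\<theta> i = fst (xs ! i)" for i
  define u where "u i = snd (xs ! i)" for i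
  have mem: "(\<theta> i, u i) \<in> set xs" if "i < ?n" for i using that by (simp add: \<theta>_def u_def)
  have ren: "\<exists>K::nat. \<forall>r. (\<forall>j. r j = j \<or> r j \<ge> K) \<longrightarrow> (\<exists>\<psi>'. renaming r (\<theta> i) \<psi>')" if "i < ?n" for i
    using renaming_exists[OF wf[OF mem[OF that]]] .
  then obtain Kf where Kf: "\<And>i r. i < ?n \<Longrightarrow> (\<forall>j. r j = j \<or> r j \<ge> Kf i) \<Longrightarrow> \<exists>\<psi>'. renaming r (\<theta> i) \<psi>'"
    by metis
  obtain K0 where K0: "\<And>l. l \<in> Y \<Longrightarrow> l < K0" using Y finite_nat_set_iff_bounded by auto
  define K where "K = Suc K0 + (\<Sum>i<?n. Kf i)"
  \<comment> \<open>Since \<open>K > 0\<close>, no variable outside of \<open>Y\<close> keeps its name.\<close>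
  define rn where "rn i l = (if l \<in> Y then l else K + prod_encode (i, l))" for i l
  have "\<exists>\<psi>'. renaming (rn i) (\<theta> i) \<psi>'" if "i < ?n" for i
  proof (rule Kf[OF that])
    have "Kf i \<le> (\<Sum>i<?n. Kf i)" by (rule member_le_sum) (use that in auto)
    then show "\<forall>j. rn i j = j \<or> rn i j \<ge> Kf i" by (simp add: rn_def K_def)
  qed
  then obtain \<psi> where \<psi>: "\<And>i. i < ?n \<Longrightarrow> renaming (rn i) (\<theta> i) (\<psi> i)" by metis
  obtain m0 where "m0 \<in> M" using M_nonempty by auto
  define c0 where "c0 = const_rv (\<lambda>_. m0) 0"
  have c0: "c0 \<in> N" unfolding c0_def using \<open>m0 \<in> M\<close> by (intro const_rv_N) auto
  \<comment> \<open>Parameters of the combined formula: those of the \<open>i\<close>-th condition, under their new names.\<close>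
  define s where "s k = (let (i, l) = prod_decode (k - K) in if k \<ge> K \<and> i < ?n then u i l else c0)" for k
  have simpleN: "c \<in> N" if "c \<in> e ` simple_rvs \<Omega> M" for c using that simple_in_randomization by auto
  have "u i l \<in> N" if "i < ?n" for i l using u[OF mem[OF that]] simpleN by blast
  then have s: "s k \<in> N" for k using c0 by (auto simp: s_def split: prod.split)
  have val: "cvalue Pr (\<theta> i) (override_on (u i) g' Y) = cvalue Pr (\<psi> i) (override_on s g' Y)"
    if i: "i < ?n" for i g'
  proof (rule renaming_value[OF \<psi>[OF i]])
    fix j assume "j \<in> cfv (\<theta> i)"
    show "if rn i j = j then override_on (u i) g' Y j = override_on s g' Y j
      else twin j (rn i j) (override_on (u i) g' Y j) (override_on s g' Y (rn i j))"
    proof (cases "j \<in> Y")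
      case True
      then show ?thesis by (simp add: rn_def)
    next
      case False
      have "j \<le> prod_encode (i, j)" by (rule le_prod_encode_2)
      then have ne: "rn i j \<noteq> j" using False by (simp add: rn_def K_def)
      have "rn i j \<notin> Y" using K0[of "rn i j"] False by (auto simp: rn_def K_def)
      moreover have "s (rn i j) = u i j" using False i by (simp add: s_def rn_def)
      moreover obtain f where "f \<in> simple_rvs \<Omega> M" "u i j = e f" using u[OF mem[OF i]] by auto
      ultimately show ?thesis
        using ne False twin_simple[OF simple_rvs_mono[OF _ subset_UNIV], of f] by (simp add: override_on_def)
    qed
  qed
  define d where "d i = cvalue Pr (\<theta> i) (override_on (u i) g Y)" for i
  define T where "T = CConn (\<lambda>t. min 1 (\<Sum>i<?n. \<bar>t i - d i\<bar>)) (map \<psi> [0..<?n])"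
  have wfT: "cfm_wf U T"
    unfolding T_def using \<psi>
    by (auto simp: renaming_def sum_nonneg intro!: continuous_intros continuous_on_subset[OF continuous_on_product_coordinates])
  have valT: "cvalue Pr T (override_on s g' Y) =
      min 1 (\<Sum>i<?n. \<bar>cvalue Pr (\<theta> i) (override_on (u i) g' Y) - d i\<bar>)" for g'
  proof -
    have "cvalue Pr T (override_on s g' Y) = min 1 (\<Sum>i<?n. \<bar>(if i < ?n then cvalue Pr (\<psi> i) (override_on s g' Y) else 0) - d i\<bar>)"
      unfolding T_def cval.simps cval_CConn_arg by (simp cong: if_cong)
    also have "(\<Sum>i<?n. \<bar>(if i < ?n then cvalue Pr (\<psi> i) (override_on s g' Y) else 0) - d i\<bar>) =
        (\<Sum>i<?n. \<bar>cvalue Pr (\<theta> i) (override_on (u i) g' Y) - d i\<bar>)"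
      by (intro sum.cong) (simp_all add: val)
    finally show ?thesis .
  qed
  \<comment> \<open>A value of \<open>T\<close> below \<open>min \<epsilon> 1\<close> is not truncated and bounds each of the summands by \<open>\<epsilon>\<close>.\<close>
  define \<delta> where "\<delta> = min \<epsilon> 1 / 3"
  have \<delta>: "\<delta> > 0" using \<epsilon> by (simp add: \<delta>_def)
  obtain ys where ys: "set ys = Y" using Y finite_list by auto
  have "cvalue Pr (foldr CInf ys T) s \<le> cvalue Pr T (override_on s g Y)"
    using CInfs_le_cvalue[OF wfT, of ys s g] by (simp add: ys)
  also have "\<dots> = 0" by (simp add: valT d_def)
  finally have "cvalue Pr (foldr CInf ys T) s < \<delta>" using \<delta> by linarith
  moreover have NE: "\<And>\<psi> v. cfm_wf U \<psi> \<Longrightarrow> range v \<subseteq> N \<Longrightarrow> cval Pr N \<psi> v = cvalue Pr \<psi> v"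
    using elem unfolding celem_sub_def by blast
  ultimately have "cval Pr N (foldr CInf ys T) s < \<delta>"
    using s by (subst NE) (auto simp: cfm_wf_CInfs wfT)
  moreover have "N \<noteq> {}" using c0 by blast
  ultimately obtain w where w: "\<And>l. l \<in> set ys \<Longrightarrow> w l \<in> N" "cval Pr N T (override_on s w (set ys)) < \<delta>"
    using CInfs_less_witness[OF wfT, of N ys s \<delta>] by metis
  let ?w = "override_on s w Y"
  have rangeW: "range ?w \<subseteq> N" using w(1) s by (auto simp: override_on_def ys)
  have w\<delta>: "cvalue Pr T ?w < \<delta>" using w(2) NE[OF wfT rangeW] by (simp add: ys)
  obtain \<eta> where \<eta>: "\<eta> > 0" "\<And>v w. (\<forall>i\<in>cfv T. rdist Pr (v i) (w i) < \<eta>) \<Longrightarrow>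
      \<bar>cvalue Pr T v - cvalue Pr T w\<bar> \<le> \<delta>"
    using cvalue_uniformly_continuous[OF wfT \<delta>] by blast
  obtain h where h: "\<And>l. h l \<in> simple_rvs \<Omega> M" "\<And>l. rdist Pr (?w l) (e (h l)) < \<eta>"
    using randomization_approx[OF rangeW \<eta>(1)] by blast
  have "\<bar>cvalue Pr T ?w - cvalue Pr T (override_on s (\<lambda>l. e (h l)) Y)\<bar> \<le> \<delta>"
  proof (rule \<eta>(2), rule ballI)
    fix i
    show "rdist Pr (?w i) (override_on s (\<lambda>l. e (h l)) Y i) < \<eta>"
      using h(2)[of i] \<eta>(1) by (cases "i \<in> Y") (simp_all add: override_on_def)
  qed
  then have "cvalue Pr T (override_on s (\<lambda>l. e (h l)) Y) < min \<epsilon> 1" using w\<delta> \<delta> unfolding \<delta>_def by linarith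
  then have small: "(\<Sum>i<?n. \<bar>cvalue Pr (\<theta> i) (override_on (u i) (\<lambda>l. e (h l)) Y) - d i\<bar>) < \<epsilon>"
    unfolding valT by linarith
  show ?thesis
  proof (intro exI[of _ h] conjI allI h(1) ballI, clarify)
    fix \<theta>' u' assume "(\<theta>', u') \<in> set xs"
    then obtain i where i: "i < ?n" "\<theta>' = \<theta> i" "u' = u i" by (metis \<theta>_def fst_conv in_set_conv_nth snd_conv u_def)
    have "\<bar>cvalue Pr (\<theta> i) (override_on (u i) (\<lambda>l. e (h l)) Y) - d i\<bar> \<le>
      (\<Sum>i<?n. \<bar>cvalue Pr (\<theta> i) (override_on (u i) (\<lambda>l. e (h l)) Y) - d i\<bar>)"
      using i(1) member_le_sum[of i "{..<?n}" "\<lambda>i. \<bar>cvalue Pr (\<theta> i) (override_on (u i) (\<lambda>l. e (h l)) Y) - d i\<bar>"] by simp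
    then show "\<bar>cvalue Pr \<theta>' (override_on u' (\<lambda>l. e (h l)) Y) - cvalue Pr \<theta>' (override_on u' g Y)\<bar> < \<epsilon>"
      using small i by (simp add: d_def)
  qed
qed

text \<open>
  The filter generated by the approximating sets of the preceding lemma: a net of tuples from
  \<open>M\<^sub>0\<^sup>\<Omega>\<close> whose types over \<open>M\<^sub>0\<^sup>\<Omega>\<close> converge to that of \<open>g\<close>.
\<close>

lemma simple_net:
  assumes Y: "finite Y"
  obtains F :: "(nat \<Rightarrow> 'w \<Rightarrow> 'u) filter" where "F \<noteq> bot" "\<forall>\<^sub>F h in F. \<forall>l. h l \<in> simple_rvs \<Omega> M"
    "\<And>\<theta> u. cfm_wf U \<theta> \<Longrightarrow> range u \<subseteq> e ` simple_rvs \<Omega> M \<Longrightarrow>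
      ((\<lambda>h. cvalue Pr \<theta> (override_on u (\<lambda>l. e (h l)) Y)) \<longlongrightarrow> cvalue Pr \<theta> (override_on u g Y)) F"
proof -
  define B where "B = (\<lambda>(\<theta>, u, \<epsilon>). {h. (\<forall>l. h l \<in> simple_rvs \<Omega> M) \<and>
    \<bar>cvalue Pr \<theta> (override_on u (\<lambda>l. e (h l)) Y) - cvalue Pr \<theta> (override_on u g Y)\<bar> < \<epsilon>})"
  define I where "I = {(\<theta>, u :: nat \<Rightarrow> 'c, \<epsilon> :: real). cfm_wf U \<theta> \<and> range u \<subseteq> e ` simple_rvs \<Omega> M \<and> \<epsilon> > 0}"
  define F where "F = (INF i\<in>I. principal (B i))"
  have ne: "(\<Inter>i\<in>X. B i) \<noteq> {}" if X: "finite X" "X \<subseteq> I" for X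
  proof -
    obtain xs where xs: "set xs = X" using X(1) finite_list by auto
    define \<epsilon> where "\<epsilon> = Min (insert 1 ((\<lambda>(\<theta>, u, \<epsilon>). \<epsilon>) ` X))"
    have "\<forall>i\<in>X. 0 < (case i of (\<theta>, u, \<epsilon>) \<Rightarrow> \<epsilon>)"
    proof
      fix i assume "i \<in> X"
      then have "i \<in> I" using X(2) by (rule rev_subsetD)
      then show "0 < (case i of (\<theta>, u, \<epsilon>) \<Rightarrow> \<epsilon>)" by (cases i) (simp add: I_def)
    qed
    then have "\<epsilon> > 0" unfolding \<epsilon>_def using X(1) by simp
    have le: "\<epsilon> \<le> \<epsilon>'" if "(\<theta>, u, \<epsilon>') \<in> X" for \<theta> u \<epsilon>'
      unfolding \<epsilon>_def using X(1) that by (intro Min_le) (auto intro: rev_image_eqI)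
    have "\<exists>h. (\<forall>l. h l \<in> simple_rvs \<Omega> M) \<and> (\<forall>(\<theta>, u)\<in>set (map (\<lambda>(\<theta>, u, \<epsilon>). (\<theta>, u)) xs).
      \<bar>cvalue Pr \<theta> (override_on u (\<lambda>l. e (h l)) Y) - cvalue Pr \<theta> (override_on u g Y)\<bar> < \<epsilon>)"
    proof (rule simple_tuples_dense[OF Y _ _ \<open>\<epsilon> > 0\<close>])
      fix \<theta> u assume "(\<theta>, u) \<in> set (map (\<lambda>(\<theta>, u, \<epsilon>). (\<theta>, u)) xs)"
      then obtain \<epsilon>' where "(\<theta>, u, \<epsilon>') \<in> I" using X(2) xs by auto
      then show "cfm_wf U \<theta>" "range u \<subseteq> e ` simple_rvs \<Omega> M" unfolding I_def by simp_all
    qed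
    then obtain h where h: "\<forall>l. h l \<in> simple_rvs \<Omega> M"
      "\<forall>(\<theta>, u)\<in>set (map (\<lambda>(\<theta>, u, \<epsilon>). (\<theta>, u)) xs).
        \<bar>cvalue Pr \<theta> (override_on u (\<lambda>l. e (h l)) Y) - cvalue Pr \<theta> (override_on u g Y)\<bar> < \<epsilon>" by blast
    have "h \<in> B i" if i: "i \<in> X" for i
    proof -
      obtain \<theta> u \<epsilon>' where i': "i = (\<theta>, u, \<epsilon>')" by (cases i)
      have "(\<theta>, u) \<in> set (map (\<lambda>(\<theta>, u, \<epsilon>). (\<theta>, u)) xs)" using i unfolding i' set_map xs by force
      from bspec[OF h(2) this] le[OF i[unfolded i']] show ?thesis
        using h(1) by (simp add: B_def i')
    qed
    then have "h \<in> (\<Inter>i\<in>X. B i)" by blast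
    then show ?thesis by blast
  qed
  have "F \<noteq> bot"
  proof
    assume "F = bot"
    then have "eventually (\<lambda>_. False) F" by (simp only: eventually_bot)
    then have "\<exists>X\<subseteq>I. finite X \<and> eventually (\<lambda>_. False) (INF i\<in>X. principal (B i))"
      unfolding F_def by (rule iffD1[OF eventually_INF])
    then obtain X where X: "X \<subseteq> I" "finite X" "eventually (\<lambda>_. False) (INF i\<in>X. principal (B i))"
      by (elim exE conjE) (rule that)
    have "eventually (\<lambda>_. False) (principal (\<Inter>i\<in>X. B i))"
      using X(3) unfolding INF_principal_finite[OF X(2)] .
    then have none: "\<forall>h\<in>(\<Inter>i\<in>X. B i). False" unfolding eventually_principal .
    obtain h where "h \<in> (\<Inter>i\<in>X. B i)" using ne[OF X(2,1)] by (metis ex_in_conv)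
    then show False by (rule bspec[OF none])
  qed
  moreover have evB: "eventually (\<lambda>h. h \<in> B i) F" if "i \<in> I" for i
    unfolding F_def by (rule eventually_INF1[OF that]) (simp only: eventually_principal, blast)
  have "\<forall>\<^sub>F h in F. \<forall>l. h l \<in> simple_rvs \<Omega> M"
  proof -
    obtain m0 where "m0 \<in> M" using M_nonempty by auto
    then have "(CProb (FEq (Var 0) (Var 0)), const_rv (\<lambda>_. m0), 1) \<in> I"
      using const_rv_simple[of "\<lambda>_. m0"] unfolding I_def by (simp add: image_subset_iff)
    from evB[OF this] show ?thesis by eventually_elim (simp add: B_def)
  qed
  moreover have "((\<lambda>h. cvalue Pr \<theta> (override_on u (\<lambda>l. e (h l)) Y)) \<longlongrightarrow> cvalue Pr \<theta> (override_on u g Y)) F"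
    if "cfm_wf U \<theta>" "range u \<subseteq> e ` simple_rvs \<Omega> M" for \<theta> u
  proof (rule tendstoI)
    fix \<epsilon> :: real assume "\<epsilon> > 0"
    then have "(\<theta>, u, \<epsilon>) \<in> I" using that by (simp add: I_def)
    from evB[OF this] show "\<forall>\<^sub>F h in F. dist (cvalue Pr \<theta> (override_on u (\<lambda>l. e (h l)) Y)) (cvalue Pr \<theta> (override_on u g Y)) < \<epsilon>"
      by eventually_elim (simp add: B_def dist_real_def)
  qed
  ultimately show ?thesis by (rule that)
qed

lemma p_simple:
  assumes "L_formula U \<theta>" "\<And>l. h l \<in> simple_rvs \<Omega> M" "\<And>i. i < k \<Longrightarrow> A i \<in> sets \<Omega>"
    "disjoint_family_on A {..<k}" "(\<Union>i<k. A i) = space \<Omega>"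
    "\<And>i \<omega> l. i < (k::nat) \<Longrightarrow> \<omega> \<in> A i \<Longrightarrow> l \<in> fv \<theta> - {x} \<Longrightarrow> h l \<omega> = a i l"
    "\<And>i l. i < k \<Longrightarrow> l \<in> fv \<theta> - {x} \<Longrightarrow> a i l \<in> M"
  shows "p (\<lambda>c. Pr \<theta> ((\<lambda>l. e (h l))(x := c))) = (\<Sum>i<k. measure \<Omega> (A i) * \<mu> (fiber U \<theta> x (a i)))"
proof -
  note * = canonical[unfolded is_canonical_extension_def, THEN conjunct2, THEN conjunct1]
  show ?thesis by (rule *[rule_format]) (use assms in blast)+
qed

lemma p_limit:
  assumes "L_formula U \<theta>" "F \<noteq> bot" "\<forall>\<^sub>F h in F. \<forall>l. h l \<in> simple_rvs \<Omega> M"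
    "\<And>\<theta>' u. cfm_wf U \<theta>' \<Longrightarrow> range u \<subseteq> e ` simple_rvs \<Omega> M \<Longrightarrow>
      ((\<lambda>h. cvalue Pr \<theta>' (override_on u (\<lambda>l. e (h l)) (fv \<theta> - {x}))) \<longlongrightarrow>
        cvalue Pr \<theta>' (override_on u g (fv \<theta> - {x}))) F"
  shows "((\<lambda>h. p (\<lambda>c. Pr \<theta> ((\<lambda>l. e (h l))(x := c)))) \<longlongrightarrow> p (\<lambda>c. Pr \<theta> (g(x := c)))) F"
proof -
  note * = canonical[unfolded is_canonical_extension_def, THEN conjunct2, THEN conjunct2]
  show ?thesis by (rule *[rule_format]) (use assms in blast)+
qed

lemma p_const:
  assumes "L_formula U \<theta>" "range m \<subseteq> M"
  shows "p (\<lambda>c. Pr \<theta> ((const_rv m)(x := c))) = \<mu> (fiber U \<theta> x m)"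
proof -
  have "p (\<lambda>c. Pr \<theta> ((\<lambda>l. e (\<lambda>_. m l))(x := c))) = (\<Sum>i<Suc 0. measure \<Omega> (space \<Omega>) * \<mu> (fiber U \<theta> x m))"
    by (rule p_simple[OF assms(1), of "\<lambda>l _. m l" "Suc 0" "\<lambda>_. space \<Omega>" x "\<lambda>_. m"])
      (use assms in \<open>auto simp: disjoint_family_on_def lessThan_Suc intro!: simple_rvs_const\<close>)
  then show ?thesis by (simp add: \<Omega>.prob_space const_rv_def[abs_def])
qed

text \<open>
  If \<open>\<mu>(\<theta>(x;b))\<close> is within \<open>\<epsilon>\<close> of a step function of \<open>b\<close>, then \<open>r\<^sub>\<mu>\<close> assigns to \<open>\<theta>(x;g)\<close> the
  expectation of this step function at \<open>g\<close>, up to \<open>\<epsilon>\<close>.  For simple \<open>g\<close> this is the defining sum of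
  \<open>r\<^sub>\<mu>\<close>, taken over the values of \<open>g\<close>; both sides are continuous along the net of \<open>simple_net\<close>.
\<close>

lemma p_step_approx:
  assumes L: "L_formula U \<theta>" and Y: "Y = fv \<theta> - {x}"
    and app: "step_approx U M Y (\<lambda>b. \<mu> (fiber U \<theta> x b)) \<epsilon> k D r"
    and \<psi>: "\<And>j. j < k \<Longrightarrow> L_formula U (\<psi> j)" "\<And>j. j < k \<Longrightarrow> range (m j) \<subseteq> M"
      "\<And>j a. j < k \<Longrightarrow> true_in U (\<psi> j) (override_on (m j) a Y) \<longleftrightarrow> a \<in> D j"
  shows "\<bar>p (\<lambda>c. Pr \<theta> (g(x := c))) - (\<Sum>j<k. r j * Pr (\<psi> j) (override_on (const_rv (m j)) g Y))\<bar> \<le> \<epsilon>"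
proof -
  have finY: "finite Y" using finite_fv by (simp add: Y)
  have simple: "\<bar>p (\<lambda>c. Pr \<theta> ((\<lambda>l. e (h l))(x := c))) -
      (\<Sum>j<k. r j * Pr (\<psi> j) (override_on (const_rv (m j)) (\<lambda>l. e (h l)) Y))\<bar> \<le> \<epsilon>"
    if h: "\<And>l. h l \<in> simple_rvs \<Omega> M" for h
  proof -
    let ?S = "insert 0 Y"
    define T where "T \<omega> = restrict (\<lambda>l. h l \<omega>) ?S" for \<omega>
    have T: "T \<in> simple_rvs \<Omega> (?S \<rightarrow>\<^sub>E M)"
      unfolding T_def by (rule simple_rvs_tuple) (use h finY in auto)
    then have finT: "finite (T ` space \<Omega>)" by (simp add: simple_rvs_def)
    obtain t where t: "bij_betw t {0..<card (T ` space \<Omega>)} (T ` space \<Omega>)"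
      using ex_bij_betw_nat_finite[OF finT] by blast
    define q where "q = card (T ` space \<Omega>)"
    define A where "A i = {\<omega>\<in>space \<Omega>. T \<omega> = t i}" for i
    have A: "A i \<in> sets \<Omega>" for i unfolding A_def by (rule simple_rvs_event[OF T])
    have timg: "t ` {..<q} = T ` space \<Omega>" and tinj: "inj_on t {..<q}"
      using t by (auto simp: bij_betw_def q_def atLeast0LessThan)
    have disj: "disjoint_family_on A {..<q}"
      using tinj by (auto simp: disjoint_family_on_def A_def inj_on_def)
    have UN: "(\<Union>i<q. A i) = space \<Omega>"
    proof -
      have "\<exists>i<q. T \<omega> = t i" if "\<omega> \<in> space \<Omega>" for \<omega>
      proof -
        have "T \<omega> \<in> t ` {..<q}" using that timg by blast
        then show ?thesis by auto
      qed
      then show ?thesis by (auto simp: A_def)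
    qed
    \<comment> \<open>The tuple \<open>h\<close> is constant on each \<open>A i\<close>, with value \<open>t i\<close>.\<close>
    have pt: "p (\<lambda>c. Pr \<theta> ((\<lambda>l. e (h l))(x := c))) = (\<Sum>i<q. measure \<Omega> (A i) * \<mu> (fiber U \<theta> x (t i)))"
    proof (rule p_simple[OF L h A disj UN])
      fix i \<omega> l assume "i < q" "\<omega> \<in> A i" "l \<in> fv \<theta> - {x}"
      then have "T \<omega> = t i" "l \<in> ?S" by (auto simp: A_def Y)
      then show "h l \<omega> = t i l" unfolding T_def by (metis restrict_apply')
    next
      fix i l assume "i < q" "l \<in> fv \<theta> - {x}"
      then have "t i \<in> T ` space \<Omega>" "l \<in> ?S" using timg by (auto simp: Y)
      moreover have "T ` space \<Omega> \<subseteq> ?S \<rightarrow>\<^sub>E M" using T by (simp add: simple_rvs_def)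
      ultimately show "t i l \<in> M" by (meson PiE_mem subsetD)
    qed
    have measT: "measure \<Omega> {\<omega>\<in>space \<Omega>. T \<omega> \<in> E} = (\<Sum>i<q. measure \<Omega> (A i) * of_bool (t i \<in> E))" for E
    proof -
      let ?I = "{i \<in> {..<q}. t i \<in> E}"
      have "{\<omega>\<in>space \<Omega>. T \<omega> \<in> E} = (\<Union>i\<in>?I. A i)"
        unfolding UN[symmetric] by (auto simp: A_def)
      also have "measure \<Omega> \<dots> = (\<Sum>i\<in>?I. measure \<Omega> (A i))"
        using A disj by (intro \<Omega>.finite_measure_finite_Union) (auto simp: disjoint_family_on_def)
      also have "\<dots> = (\<Sum>i<q. measure \<Omega> (A i) * of_bool (t i \<in> E))"
        unfolding sum.inter_filter[OF finite_lessThan] by (intro sum.cong) auto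
      finally show ?thesis .
    qed
    have prs: "Pr (\<psi> j) (override_on (const_rv (m j)) (\<lambda>l. e (h l)) Y) = (\<Sum>i<q. measure \<Omega> (A i) * of_bool (t i \<in> D j))"
      if j: "j < k" for j
    proof -
      let ?k = "override_on (\<lambda>l _. m j l) h Y"
      have k: "?k l \<in> simple_rvs \<Omega> UNIV" for l
        using h[THEN simple_rvs_mono[OF _ subset_UNIV]] by (auto simp: override_on_def intro!: simple_rvs_const)
      have "override_on (const_rv (m j)) (\<lambda>l. e (h l)) Y = (\<lambda>l. e (?k l))"
        by (auto simp: override_on_def const_rv_def)
      then have "Pr (\<psi> j) (override_on (const_rv (m j)) (\<lambda>l. e (h l)) Y) =
          measure \<Omega> {\<omega>\<in>space \<Omega>. true_in U (\<psi> j) (\<lambda>l. ?k l \<omega>)}"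
        using Pr_simple[OF \<psi>(1)[OF j] k] by simp
      moreover have "true_in U (\<psi> j) (\<lambda>l. ?k l \<omega>) \<longleftrightarrow> T \<omega> \<in> D j" for \<omega>
      proof -
        have "(\<lambda>l. ?k l \<omega>) = override_on (m j) (T \<omega>) Y"
          by (auto simp: override_on_def T_def fun_eq_iff)
        then show ?thesis using \<psi>(3)[OF j] by simp
      qed
      ultimately show ?thesis by (simp only: measT)
    qed
    have "p (\<lambda>c. Pr \<theta> ((\<lambda>l. e (h l))(x := c))) -
        (\<Sum>j<k. r j * Pr (\<psi> j) (override_on (const_rv (m j)) (\<lambda>l. e (h l)) Y)) =
      (\<Sum>i<q. measure \<Omega> (A i) * (\<mu> (fiber U \<theta> x (t i)) - (\<Sum>j<k. r j * of_bool (t i \<in> D j))))"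
    proof -
      have "(\<Sum>j<k. r j * Pr (\<psi> j) (override_on (const_rv (m j)) (\<lambda>l. e (h l)) Y)) =
          (\<Sum>j<k. \<Sum>i<q. measure \<Omega> (A i) * (r j * of_bool (t i \<in> D j)))"
      proof (rule sum.cong[OF refl])
        fix j assume "j \<in> {..<k}"
        then have j: "j < k" by simp
        show "r j * Pr (\<psi> j) (override_on (const_rv (m j)) (\<lambda>l. e (h l)) Y) =
            (\<Sum>i<q. measure \<Omega> (A i) * (r j * of_bool (t i \<in> D j)))"
          unfolding prs[OF j] sum_distrib_left by (intro sum.cong refl) (simp only: mult_ac)
      qed
      also have "\<dots> = (\<Sum>i<q. measure \<Omega> (A i) * (\<Sum>j<k. r j * of_bool (t i \<in> D j)))"
        by (subst sum.swap) (simp only: sum_distrib_left)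
      finally show ?thesis unfolding pt by (simp only: sum_subtractf right_diff_distrib)
    qed
    also have "\<bar>\<dots>\<bar> \<le> (\<Sum>i<q. \<bar>measure \<Omega> (A i) * (\<mu> (fiber U \<theta> x (t i)) - (\<Sum>j<k. r j * of_bool (t i \<in> D j)))\<bar>)"
      by (rule sum_abs)
    also have "\<dots> \<le> (\<Sum>i<q. measure \<Omega> (A i) * \<epsilon>)"
      by (intro sum_mono) (simp only: abs_mult abs_of_nonneg[OF measure_nonneg],
          intro mult_left_mono step_approx_value[OF app] measure_nonneg)
    also have "\<dots> = (\<Sum>i<q. measure \<Omega> (A i)) * \<epsilon>" by (simp add: sum_distrib_right)
    also have "(\<Sum>i<q. measure \<Omega> (A i)) = measure \<Omega> (\<Union>i<q. A i)"
      using A disj by (intro \<Omega>.finite_measure_finite_Union[symmetric]) auto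
    also have "\<dots> = 1" by (simp only: UN \<Omega>.prob_space)
    finally show ?thesis unfolding mult_1 .
  qed
  obtain F :: "(nat \<Rightarrow> 'w \<Rightarrow> 'u) filter" where F: "F \<noteq> bot" "\<forall>\<^sub>F h in F. \<forall>l. h l \<in> simple_rvs \<Omega> M"
    "\<And>\<theta> u. cfm_wf U \<theta> \<Longrightarrow> range u \<subseteq> e ` simple_rvs \<Omega> M \<Longrightarrow>
      ((\<lambda>h. cvalue Pr \<theta> (override_on u (\<lambda>l. e (h l)) Y)) \<longlongrightarrow> cvalue Pr \<theta> (override_on u g Y)) F"
    using simple_net[OF finY, of g] by metis
  have "((\<lambda>h. p (\<lambda>c. Pr \<theta> ((\<lambda>l. e (h l))(x := c)))) \<longlongrightarrow> p (\<lambda>c. Pr \<theta> (g(x := c)))) F"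
    by (rule p_limit[OF L F(1,2)]) (use F(3) Y in blast)
  moreover have "((\<lambda>h. Pr (\<psi> j) (override_on (const_rv (m j)) (\<lambda>l. e (h l)) Y)) \<longlongrightarrow>
      Pr (\<psi> j) (override_on (const_rv (m j)) g Y)) F" if "j < k" for j
    using F(3)[of "CProb (\<psi> j)" "const_rv (m j)"] \<psi>(1,2)[OF that] const_rv_simple[of "m j"] by auto
  ultimately have "((\<lambda>h. \<bar>p (\<lambda>c. Pr \<theta> ((\<lambda>l. e (h l))(x := c))) -
      (\<Sum>j<k. r j * Pr (\<psi> j) (override_on (const_rv (m j)) (\<lambda>l. e (h l)) Y))\<bar>) \<longlongrightarrow>
    \<bar>p (\<lambda>c. Pr \<theta> (g(x := c))) - (\<Sum>j<k. r j * Pr (\<psi> j) (override_on (const_rv (m j)) g Y))\<bar>) F"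
    by (intro tendsto_intros) auto
  then show ?thesis
  proof (rule tendsto_upperbound)
    show "\<forall>\<^sub>F h in F. \<bar>p (\<lambda>c. Pr \<theta> ((\<lambda>l. e (h l))(x := c))) -
      (\<Sum>j<k. r j * Pr (\<psi> j) (override_on (const_rv (m j)) (\<lambda>l. e (h l)) Y))\<bar> \<le> \<epsilon>"
      using F(2) by eventually_elim (rule simple, blast)
  qed (rule F(1))
qed

section \<open>Morley sequences of the canonical extension\<close>

lemma global_p: "global_ctype U Pr p"
  using canonical by (simp add: is_canonical_extension_def)

lemma cdef_mono: "A \<subseteq> B \<Longrightarrow> cdef U Pr A \<subseteq> cdef U Pr B"
  unfolding cdef_def by blast

lemma p_bounds:
  assumes "D \<in> cdef U Pr A"
  shows "0 \<le> p D \<and> p D \<le> 1"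
proof -
  have D: "D \<in> cdef U Pr UNIV" using cdef_mono[of A UNIV] assms by blast
  obtain \<psi> x g where \<psi>: "D = (\<lambda>c. cvalue Pr \<psi> (g(x := c)))" "cfm_wf U \<psi>"
    using D unfolding cdef_def by blast
  have bounds: "0 \<le> D c \<and> D c \<le> 1" for c
    using cval_bounds[OF \<psi>(2), of UNIV "g(x := c)"] unfolding \<psi>(1) by simp
  have near: "\<exists>c. \<bar>D c - p D\<bar> < \<epsilon>" if "\<epsilon> > 0" for \<epsilon>
    using global_p[unfolded global_ctype_def, rule_format, of "{D}" \<epsilon>] D that by blast
  have "p D \<le> 1 + \<epsilon>" if "\<epsilon> > 0" for \<epsilon>
  proof -
    obtain c where "\<bar>D c - p D\<bar> < \<epsilon>" using near[OF \<open>\<epsilon> > 0\<close>] ..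
    then show ?thesis using bounds[of c] by linarith
  qed
  moreover have "0 \<le> p D + \<epsilon>" if "\<epsilon> > 0" for \<epsilon>
  proof -
    obtain c where "\<bar>D c - p D\<bar> < \<epsilon>" using near[OF \<open>\<epsilon> > 0\<close>] ..
    then show ?thesis using bounds[of c] by linarith
  qed
  ultimately show ?thesis by (meson field_le_epsilon)
qed

lemma p_realized:
  assumes "small \<kappa>' A"
  shows "\<exists>c. crealizes U Pr c p A"
proof -
  define dev where "dev D = (\<lambda>c. \<bar>D c - p D\<bar>)" for D :: "'c \<Rightarrow> real"
  have "dev D \<in> cdef U Pr A" if D: "D \<in> cdef U Pr A" for D
  proof -
    obtain \<psi> x g where \<psi>: "D = (\<lambda>c. cvalue Pr \<psi> (g(x := c)))" "cfm_wf U \<psi>" "g ` (cfv \<psi> - {x}) \<subseteq> A"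
      using D unfolding cdef_def by blast
    let ?\<psi> = "CConn (\<lambda>t. \<bar>t 0 - p D\<bar>) [\<psi>]"
    have "\<bar>s - p D\<bar> \<le> 1" if "0 \<le> s" "s \<le> 1" for s using p_bounds[OF D] that by linarith
    then have "cfm_wf U ?\<psi>" using \<psi>(2)
      by (auto intro!: continuous_intros continuous_on_subset[OF continuous_on_product_coordinates])
    moreover have "g ` (cfv ?\<psi> - {x}) \<subseteq> A" using \<psi>(3) by simp
    moreover have "dev D = (\<lambda>c. cvalue Pr ?\<psi> (g(x := c)))"
      unfolding dev_def using \<psi>(1) by (simp add: fun_eq_iff)
    ultimately show ?thesis unfolding cdef_def by blast
  qed
  then have "dev ` cdef U Pr A \<subseteq> cdef U Pr A" by blast
  moreover have "\<forall>\<epsilon>>0. \<exists>c. \<forall>D\<in>F. D c \<le> \<epsilon>" if F: "finite F" "F \<subseteq> dev ` cdef U Pr A" for F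
  proof (intro allI impI)
    fix \<epsilon> :: real assume "\<epsilon> > 0"
    obtain G where G: "finite G" "G \<subseteq> cdef U Pr A" "F = dev ` G" using finite_subset_image[OF F] by auto
    have "G \<subseteq> cdef U Pr UNIV" using G(2) cdef_mono[of A UNIV] by blast
    then obtain c where "\<forall>D\<in>G. \<bar>D c - p D\<bar> < \<epsilon>"
      using global_p[unfolded global_ctype_def, rule_format, OF G(1) _ \<open>\<epsilon> > 0\<close>] by blast
    then have "\<forall>D\<in>F. D c \<le> \<epsilon>" unfolding G(3) dev_def by fastforce
    then show "\<exists>c. \<forall>D\<in>F. D c \<le> \<epsilon>" ..
  qed
  moreover have "csaturated U Pr \<kappa>'" using cmonster by (simp add: cmonster_def)
  ultimately have "\<exists>c. \<forall>D\<in>dev ` cdef U Pr A. D c = 0"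
    using assms unfolding csaturated_def by blast
  then obtain c where c: "\<forall>D\<in>dev ` cdef U Pr A. D c = 0" ..
  have "D c = p D" if "D \<in> cdef U Pr A" for D
    using bspec[OF c imageI[OF that]] unfolding dev_def by simp
  then show ?thesis unfolding crealizes_def by blast
qed

lemma crealizes_mono: "crealizes U Pr c p B \<Longrightarrow> A \<subseteq> B \<Longrightarrow> crealizes U Pr c p A"
  unfolding crealizes_def using cdef_mono by blast

text \<open>
  The term \<open>\<alpha>\<^sub>i\<close> realizes the type at the variable \<open>0\<close>, and its twin \<open>c\<^sub>i\<^sub>+\<^sub>1\<close> stands for it at the
  variable \<open>2(i+1)\<close>.  It is not automatic that \<open>\<alpha>\<^sub>i\<close> realizes the type over the twins of the earlier
  terms, so the construction adds them to the parameters.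
\<close>

lemma morley_sequence_with_twins:
  obtains \<alpha> c :: "nat \<Rightarrow> 'c" where "morley_sequence U Pr N p \<alpha>"
    "\<And>i. twin 0 (2 * Suc i) (\<alpha> i) (c (Suc i))"
    "\<And>i. crealizes U Pr (\<alpha> i) p (N \<union> c ` {1..i})"
proof -
  have "\<exists>c. crealizes U Pr c p (N \<union> B)" if "finite B" for B
    using that cmonster
    by (intro p_realized small_Un[OF _ small_N] small_countable) (auto simp: cmonster_def countable_finite)
  then obtain \<rho> where \<rho>: "\<And>B. finite B \<Longrightarrow> crealizes U Pr (\<rho> B) p (N \<union> B)" by metis
  have "\<exists>d. twin 0 (2 * Suc i) a d" for i a by (rule twin_exists) simp
  then obtain t where t: "\<And>i a. twin 0 (2 * Suc i) a (t i a)" by metis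
  define S where "S = rec_nat {} (\<lambda>i S. insert (\<rho> S) (insert (t i (\<rho> S)) S))"
  have S0: "S 0 = {}" and SS: "\<And>i. S (Suc i) = insert (\<rho> (S i)) (insert (t i (\<rho> (S i))) (S i))"
    by (simp_all add: S_def)
  have fin: "finite (S i)" for i by (induction i) (simp_all add: S0 SS)
  have sub1: "(\<lambda>i. \<rho> (S i)) ` {..<i} \<subseteq> S i" for i
    by (induction i) (auto simp: S0 SS lessThan_Suc)
  have sub2: "(\<lambda>i. t (i - 1) (\<rho> (S (i - 1)))) ` {1..i} \<subseteq> S i" for i
    by (induction i) (auto simp: S0 SS atLeastAtMostSuc_conv)
  show ?thesis
  proof (rule that[of "\<lambda>i. \<rho> (S i)" "\<lambda>i. t (i - 1) (\<rho> (S (i - 1)))"])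
    show "morley_sequence U Pr N p (\<lambda>i. \<rho> (S i))"
      unfolding morley_sequence_def
    proof
      fix i
      show "crealizes U Pr (\<rho> (S i)) p (N \<union> (\<lambda>i. \<rho> (S i)) ` {..<i})"
        using sub1[of i] by (intro crealizes_mono[OF \<rho>[OF fin]]) blast
    qed
    fix i
    show "twin 0 (2 * Suc i) (\<rho> (S i)) (t (Suc i - 1) (\<rho> (S (Suc i - 1))))" using t by simp
    show "crealizes U Pr (\<rho> (S i)) p (N \<union> (\<lambda>i. t (i - 1) (\<rho> (S (i - 1)))) ` {1..i})"
      using sub2[of i] by (intro crealizes_mono[OF \<rho>[OF fin]]) blast
  qed
qed

lemma interleave_override:
  assumes "fv \<psi> \<subseteq> Y \<union> {l. odd l}" "l \<in> fv \<psi>"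
  shows "interleave n (override_on m' m Y) a l = override_on m' (interleave n m a) Y l"
  using assms by (auto simp: interleave_def override_on_def)

lemma const_rv_override: "const_rv (override_on m' m Y) = override_on (const_rv m') (const_rv m) Y"
  by (auto simp: const_rv_def override_on_def fun_eq_iff)

lemma interleave_0: "interleave 0 m a = m"
  by (auto simp: interleave_def fun_eq_iff)

text \<open>
  Induction on \<open>n\<close>, for formulas with parameters from \<open>M\<close> since the steps of the approximation of
  \<open>\<mu>(\<theta>(x;b))\<close> have such parameters.  The last variable \<open>2(n+1)\<close> is renamed to \<open>0\<close>, which replaces the
  twin \<open>c\<^sub>n\<^sub>+\<^sub>1\<close> by \<open>\<alpha>\<^sub>n\<close> and makes the defining property of \<open>\<alpha>\<^sub>n\<close> applicable.
\<close>

lemma morley_power_distribution: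
  assumes P: "is_morley_power_omega U \<kappa> \<mu> P"
    and twins: "\<And>i. twin 0 (2 * Suc i) (\<alpha> i) (c (Suc i))"
    and real: "\<And>i. crealizes U Pr (\<alpha> i) p (N \<union> c ` {1..i})"
    and \<theta>: "L_formula U \<theta>" "0 \<notin> fv \<theta>" and m: "range m \<subseteq> M"
  shows "Pr \<theta> (interleave n (const_rv m) c) = measure P (event U {a. true_in U \<theta> (interleave n m a)})"
  using \<theta> m
proof (induction n arbitrary: \<theta> m)
  case 0
  have Pp: "prob_space P" "sets P = sets (borel_of (type_space U UNIV {1..}))"
    using P by (auto simp: is_morley_power_omega_def regular_borel_prob_def)
  interpret P: prob_space P by fact
  have sp: "space P = types U UNIV {1..}"
    using sets_eq_imp_space_eq[OF Pp(2)] by (simp add: space_borel_of topspace_type_space)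
  have "Pr \<theta> (const_rv m) = measure \<Omega> {\<omega>\<in>space \<Omega>. true_in U \<theta> m}"
    unfolding const_rv_def[abs_def] by (rule Pr_simple[OF 0(1)]) (rule simple_rvs_const, rule UNIV_I)
  also have "\<dots> = of_bool (true_in U \<theta> m)" by (simp add: \<Omega>.prob_space)
  also have "\<dots> = measure P (event U {a. true_in U \<theta> m})"
  proof (cases "true_in U \<theta> m")
    case True
    have "clopen U UNIV {1..} UNIV = space P" unfolding sp clopen_def using types_UNIV by blast
    then show ?thesis using True by (simp add: P.prob_space)
  next
    case False
    have "clopen U UNIV {1..} {} = {}" unfolding clopen_def using types_empty by blast
    then show ?thesis using False by simp
  qed
  finally show ?case by (simp add: interleave_0)
next
  case (Suc n)
  note \<theta> = Suc.prems(1,2) and m = Suc.prems(3)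
  have Pp: "prob_space P" "sets P = sets (borel_of (type_space U UNIV {1..}))"
    using P unfolding is_morley_power_omega_def regular_borel_prob_def by blast+
  let ?r = "\<lambda>i::nat. if i = 2 * Suc n then 0 else i" and ?r' = "\<lambda>i::nat. if i = 0 then 2 * Suc n else i"
  \<comment> \<open>The formula \<open>\<theta>x\<close> is \<open>\<theta>\<close> with its last variable renamed to \<open>0\<close>.\<close>
  obtain \<theta>x where \<theta>x: "L_formula U \<theta>x" "fv \<theta>x \<subseteq> ?r ` fv \<theta>"
    "\<And>v. true_in U \<theta>x v \<longleftrightarrow> true_in U \<theta> (\<lambda>i. v (?r i))"
    by (rule ex_subst_fv[OF \<theta>(1), of ?r]) (rule that)
  let ?g = "interleave n (const_rv m) c" and ?w = "interleave (Suc n) (const_rv m) c"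
  have \<theta>eq: "true_in U \<theta> a \<longleftrightarrow> true_in U \<theta>x (\<lambda>l. a (?r' l))" for a
    unfolding \<theta>x(3)
  proof (rule sat_cong)
    fix i assume "i \<in> fv \<theta>"
    then have "i \<noteq> 0" using \<theta>(2) by metis
    then show "a i = a (?r' (?r i))" by simp
  qed
  have fvx: "2 * Suc n \<notin> fv \<theta>x" using \<theta>x(2) by auto
  have "Pr \<theta>x (?g(0 := \<alpha> n)) = Pr \<theta> ?w"
  proof (rule Pr_rename[OF \<theta>x(1) \<theta>(1) \<theta>eq])
    fix k assume k: "k \<in> fv \<theta>x" "k \<in> fv \<theta>"
    then have "k \<noteq> 0" "k \<noteq> 2 * Suc n" using fvx \<theta>(2) by metis+
    then show "(?g(0 := \<alpha> n)) k = ?w k" by (auto simp: interleave_def)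
  next
    fix j assume "j \<in> fv \<theta>x" "?r' j \<noteq> j"
    then have "j = 0" by (auto split: if_splits)
    moreover have "?w (2 * Suc n) = c (Suc n)" by (simp add: interleave_def)
    ultimately show "?r' j \<notin> fv \<theta>x \<and> twin j (?r' j) ((?g(0 := \<alpha> n)) j) (?w (?r' j))"
      using fvx twins[of n] by simp
  qed
  moreover have "Pr \<theta>x (?g(0 := \<alpha> n)) = p (\<lambda>d. Pr \<theta>x (?g(0 := d)))"
  proof -
    have "?g l \<in> N \<union> c ` {1..n}" for l
      using const_rv_N[OF m, of l] by (auto simp: interleave_def)
    then have "?g ` (cfv (CProb \<theta>x) - {0}) \<subseteq> N \<union> c ` {1..n}" by blast
    then have "(\<lambda>d. cvalue Pr (CProb \<theta>x) (?g(0 := d))) \<in> cdef U Pr (N \<union> c ` {1..n})"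
      unfolding cdef_def using \<theta>x(1)
      by (intro CollectI exI[of _ "CProb \<theta>x"] exI[of _ "0::nat"] exI[of _ ?g]) simp
    from bspec[OF real[of n, unfolded crealizes_def] this] show ?thesis by simp
  qed
  ultimately have lhs: "Pr \<theta> ?w = p (\<lambda>d. Pr \<theta>x (?g(0 := d)))" by simp
  let ?E = "{a. true_in U \<theta> (interleave (Suc n) m a)}"
  have "{a. true_in U \<theta> a} \<in> Def U M UNIV"
    by (rule Def_formula[OF fm_over_mono[OF \<theta>(1)]]) simp
  from interleave_Def[OF this m, of "Suc n"] have ED: "?E \<in> Def U M {1..Suc n}" by simp
  then obtain \<phi> where \<phi>: "fm_over U M \<phi>" "fv \<phi> \<subseteq> {1..Suc n}" "\<And>a. true_in U \<phi> a \<longleftrightarrow> a \<in> ?E"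
    by (rule Def_obtain) (rule that)
  have \<phi>E: "{a. true_in U \<phi> a} = ?E" using \<phi>(3) by blast
  have ED': "?E \<in> Def U UNIV {1..Suc n}" using ED Def_mono[of M UNIV "{1..Suc n}" "{1..Suc n}" U] by blast
  have fiber_eq: "fiber U \<phi> (Suc n) b = fiber U \<theta>x 0 (interleave n m b)" for b
  proof -
    have "true_in U \<theta> (interleave (Suc n) m (b(Suc n := a))) \<longleftrightarrow>
        true_in U \<theta> (\<lambda>i. ((interleave n m b)(0 := a)) (?r i))" for a
      by (rule sat_cong) (use \<theta>(2) in \<open>auto simp: interleave_def\<close>)
    then show ?thesis unfolding fiber_def using \<phi>(3) \<theta>x(3) by simp
  qed
  show ?case
  proof (cases "n = 0")
    case True
    have "measure P (event U ?E) = measure (marginal U UNIV {1} P) (clopen U UNIV {1} ?E)"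
      using ED' True by (intro measure_marginal_clopen[symmetric] Pp) auto
    also have "\<dots> = \<mu> {a. true_in U \<phi> (\<lambda>_. a)}"
    proof -
      have "fm_over U UNIV \<phi>" by (rule fm_over_mono[OF \<phi>(1)]) simp
      then show ?thesis using P \<phi>(2) True unfolding is_morley_power_omega_def \<phi>E[symmetric] by simp
    qed
    also have "{a. true_in U \<phi> (\<lambda>_. a)} = fiber U \<phi> (Suc n) m"
    proof -
      have "true_in U \<phi> (\<lambda>_. a) \<longleftrightarrow> true_in U \<phi> (m(Suc n := a))" for a
        by (rule sat_cong) (use \<phi>(2) True in auto)
      then show ?thesis by (simp add: fiber_def)
    qed
    also have "\<mu> \<dots> = p (\<lambda>d. Pr \<theta>x (?g(0 := d)))"
      using p_const[OF \<theta>x(1) m, of 0] fiber_eq[of m] True by (simp only: interleave_0)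
    finally show ?thesis using lhs by simp
  next
    case False
    let ?Y = "fv \<theta>x - {0}"
    \<comment> \<open>The restriction of \<open>\<mu>\<^sup>(\<^sup>n\<^sup>)\<close> to \<open>M\<close>, over which the Morley product integrates.\<close>
    let ?N = "marginal U M {1..n} (marginal U UNIV {1..n} P)"
    have Npp: "prob_space (marginal U UNIV {1..n} P)"
      by (rule prob_space_marginal[OF Pp(2) _ _ Pp(1)]) auto
    have Np: "prob_space ?N"
      by (rule prob_space_marginal[OF sets_marginal _ _ Npp]) auto
    have clN: "measure ?N (clopen U M {1..n} D) = measure P (event U D)" if "D \<in> Def U M {1..n}" for D
    proof -
      have "D \<in> Def U UNIV {1..n}" using that Def_mono[of M UNIV "{1..n}" "{1..n}" U] by blast
      then have "measure (marginal U UNIV {1..n} P) (clopen U UNIV {1..n} D) = measure P (event U D)"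
        by (intro measure_marginal_clopen Pp) auto
      moreover have "measure ?N (clopen U M {1..n} D) = measure (marginal U UNIV {1..n} P) (clopen U UNIV {1..n} D)"
        by (rule measure_marginal_clopen[OF sets_marginal _ _ that]) auto
      ultimately show ?thesis by simp
    qed
    let ?f = "\<lambda>b. \<mu> (fiber U \<phi> (Suc n) b)"
    have f_eq: "?f = (\<lambda>b. \<mu> (fiber U \<theta>x 0 (interleave n m b)))" by (simp add: fiber_eq)
    have "measure P (event U ?E) =
        measure (marginal U UNIV (insert (Suc n) {1..n}) P) (clopen U UNIV (insert (Suc n) {1..n}) ?E)"
      using ED' by (intro measure_marginal_clopen[symmetric] Pp) (auto simp: atLeastAtMostSuc_conv)
    also have "\<dots> = (\<integral>q. fiber_measure U \<mu> \<phi> (Suc n) q \<partial>?N)"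
    proof -
      have "is_morley_product U \<kappa> \<mu> (Suc n) {1..n}
        (marginal U UNIV {1..n} P) (marginal U UNIV (insert (Suc n) {1..n}) P)"
        using P False unfolding is_morley_power_omega_def by simp
      moreover have "fv \<phi> \<subseteq> insert (Suc n) {1..n}" using \<phi>(2) by auto
      ultimately show ?thesis
        using definable \<phi>(1) unfolding is_morley_product_def \<phi>E[symmetric] by blast
    qed
    also have "\<dots> = (\<integral>q. ?f (SOME b. b \<in> \<Inter>q) \<partial>?N)" by (simp only: fiber_measure_def)
    finally have rhs: "measure P (event U ?E) = (\<integral>q. ?f (SOME b. b \<in> \<Inter>q) \<partial>?N)" .
    have smallM: "small \<kappa> M" using definable by (simp add: definable_over_def)
    have finY: "finite ?Y" using finite_fv by blast
    have "\<bar>p (\<lambda>d. Pr \<theta>x (?g(0 := d))) - measure P (event U ?E)\<bar> \<le> \<epsilon>" if "\<epsilon> > 0" for \<epsilon>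
    proof -
      define \<epsilon>' where "\<epsilon>' = \<epsilon> / 2"
      have "\<epsilon>' > 0" using that by (simp add: \<epsilon>'_def)
      obtain k D r where app: "step_approx U M ?Y (\<lambda>b. \<mu> (fiber U \<theta>x 0 b)) \<epsilon>' k D r"
        by (rule definable_over_step_approx[OF U_monster definable \<theta>x(1) \<open>\<epsilon>' > 0\<close>]) (rule that)
      have "\<forall>j. \<exists>\<psi> m'. j < k \<longrightarrow> L_formula U \<psi> \<and> range m' \<subseteq> M \<and> fv \<psi> \<subseteq> ?Y \<union> {l. odd l} \<and>
          (\<forall>a. true_in U \<psi> (override_on m' a ?Y) \<longleftrightarrow> a \<in> D j)"
      proof
        fix j
        show "\<exists>\<psi> m'. j < k \<longrightarrow> L_formula U \<psi> \<and> range m' \<subseteq> M \<and> fv \<psi> \<subseteq> ?Y \<union> {l. odd l} \<and>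
          (\<forall>a. true_in U \<psi> (override_on m' a ?Y) \<longleftrightarrow> a \<in> D j)"
        proof (cases "j < k")
          case True
          then have "D j \<in> Def U M ?Y" using app by (simp add: step_approx_def)
          from Def_parameters[OF this finY M_nonempty] show ?thesis by metis
        qed simp
      qed
      then obtain \<psi> m' where
        "\<forall>j. j < k \<longrightarrow> L_formula U (\<psi> j) \<and> range (m' j) \<subseteq> M \<and> fv (\<psi> j) \<subseteq> ?Y \<union> {l. odd l} \<and>
          (\<forall>a. true_in U (\<psi> j) (override_on (m' j) a ?Y) \<longleftrightarrow> a \<in> D j)" by metis
      then have \<psi>: "\<And>j. j < k \<Longrightarrow> L_formula U (\<psi> j)" "\<And>j. j < k \<Longrightarrow> range (m' j) \<subseteq> M"
          "\<And>j. j < k \<Longrightarrow> fv (\<psi> j) \<subseteq> ?Y \<union> {l. odd l}"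
          "\<And>j a. j < k \<Longrightarrow> true_in U (\<psi> j) (override_on (m' j) a ?Y) \<longleftrightarrow> a \<in> D j" by simp_all
      let ?D = "\<lambda>j. {b. interleave n m b \<in> D j}"
      have app': "step_approx U M {1..n} ?f \<epsilon>' k ?D r"
        unfolding f_eq by (rule step_approx_interleave[OF app m])
      have steps: "\<exists>k D r. step_approx U M {1..n} ?f \<delta> k D r" if "\<delta> > 0" for \<delta>
      proof -
        obtain k D r where "step_approx U M ?Y (\<lambda>b. \<mu> (fiber U \<theta>x 0 b)) \<delta> k D r"
          by (rule definable_over_step_approx[OF U_monster definable \<theta>x(1) \<open>\<delta> > 0\<close>]) (rule that)
        from step_approx_interleave[OF this m] show ?thesis unfolding f_eq by blast
      qed
      have 1: "\<bar>measure P (event U ?E) - (\<Sum>j<k. r j * measure ?N (clopen U M {1..n} (?D j)))\<bar> \<le> \<epsilon>'"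
        unfolding rhs
        by (rule integral_step_approx[OF U_monster smallM finite_atLeastAtMost Np sets_marginal steps app'])
      have 2: "\<bar>p (\<lambda>d. Pr \<theta>x (?g(0 := d))) - (\<Sum>j<k. r j * Pr (\<psi> j) (override_on (const_rv (m' j)) ?g ?Y))\<bar> \<le> \<epsilon>'"
        by (rule p_step_approx[OF \<theta>x(1) refl app \<psi>(1,2,4)])
      have "Pr (\<psi> j) (override_on (const_rv (m' j)) ?g ?Y) = measure ?N (clopen U M {1..n} (?D j))" if j: "j < k" for j
      proof -
        let ?m = "override_on (m' j) m ?Y"
        have "Pr (\<psi> j) (override_on (const_rv (m' j)) ?g ?Y) = Pr (\<psi> j) (interleave n (const_rv ?m) c)"
          by (rule Pr_cong[OF \<psi>(1)[OF j]]) (simp only: const_rv_override interleave_override[OF \<psi>(3)[OF j]])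
        also have "\<dots> = measure P (event U {a. true_in U (\<psi> j) (interleave n ?m a)})"
          by (rule Suc.IH) (use \<psi>(1-3)[OF j] m in \<open>auto simp: override_on_def\<close>)
        also have "{a. true_in U (\<psi> j) (interleave n ?m a)} = ?D j"
        proof -
          have "true_in U (\<psi> j) (interleave n ?m a) \<longleftrightarrow> true_in U (\<psi> j) (override_on (m' j) (interleave n m a) ?Y)" for a
            by (rule sat_cong) (rule interleave_override[OF \<psi>(3)[OF j]])
          then show ?thesis by (simp only: \<psi>(4)[OF j])
        qed
        also have "measure P (event U (?D j)) = measure ?N (clopen U M {1..n} (?D j))"
          using app' j by (intro clN[symmetric]) (simp add: step_approx_def)
        finally show ?thesis .
      qed
      then have "(\<Sum>j<k. r j * Pr (\<psi> j) (override_on (const_rv (m' j)) ?g ?Y)) =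
          (\<Sum>j<k. r j * measure ?N (clopen U M {1..n} (?D j)))"
        by (intro sum.cong refl) (simp only: lessThan_iff)
      then show ?thesis using 1 2 unfolding \<epsilon>'_def by linarith
    qed
    then have "\<bar>p (\<lambda>d. Pr \<theta>x (?g(0 := d))) - measure P (event U ?E)\<bar> \<le> 0"
      by (rule field_le_epsilon[of _ 0, unfolded add_0])
    then have "p (\<lambda>d. Pr \<theta>x (?g(0 := d))) = measure P (event U ?E)" by linarith
    then show ?thesis by (simp only: lhs)
  qed
qed

end

section \<open>Shattering and chains give orders\<close>

text \<open>
  The sets \<open>{i. i > j}\<close> are among those cut out by shattering.
\<close>

lemma shatter_set_subset: "shatter_set U \<phi> x k \<subseteq> order_set U \<phi> x k"
proof
  fix a assume a: "a \<in> shatter_set U \<phi> x k"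
  have "\<exists>b. \<forall>i\<in>{1..k}. true_in U \<phi> (b(x := a i)) \<longleftrightarrow> i > j" for j
  proof -
    have "{i \<in> {1..k}. i > j} \<subseteq> {1..k}" by auto
    then obtain b where "\<forall>i\<in>{1..k}. true_in U \<phi> (b(x := a i)) \<longleftrightarrow> i \<in> {i \<in> {1..k}. i > j}"
      using a unfolding shatter_set_def by blast
    then show ?thesis by (intro exI[of _ b]) simp
  qed
  then obtain b where "\<And>j. \<forall>i\<in>{1..k}. true_in U \<phi> ((b j)(x := a i)) \<longleftrightarrow> i > j" by metis
  then show "a \<in> order_set U \<phi> x k" unfolding order_set_def by blast
qed

text \<open>
  An element of the \<open>(j+1)\<close>-st set outside of the \<open>j\<close>-th one lies in the \<open>i\<close>-th set exactly for \<open>i > j\<close>.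
  The last witness requires one more set in the chain.
\<close>

lemma chain_set_subset: "chain_set U \<phi> x (Suc k) \<subseteq> order_set U \<phi> x k"
proof
  fix a assume a: "a \<in> chain_set U \<phi> x (Suc k)"
  define S where "S i = {b :: nat \<Rightarrow> 'a. true_in U \<phi> (b(x := a i))}" for i
  have step: "S i \<subset> S (Suc i)" if "i \<in> {1..<Suc k}" for i
    using a that unfolding chain_set_def S_def by blast
  have mono: "S i \<subseteq> S i'" if "1 \<le> i" "i \<le> i'" "i' \<le> Suc k" for i i'
    using that(2,1,3)
  proof (induction i' rule: dec_induct)
    case (step n)
    then show ?case using \<open>\<And>i. i \<in> {1..<Suc k} \<Longrightarrow> S i \<subset> S (Suc i)\<close>[of n] by auto
  qed simp
  have "\<forall>j. \<exists>b. j \<in> {1..k} \<longrightarrow> b \<in> S (Suc j) - S j"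
    using step by (metis atLeastAtMost_iff atLeastLessThan_iff less_Suc_eq_le psubset_imp_ex_mem)
  then obtain b where b: "\<And>j. j \<in> {1..k} \<Longrightarrow> b j \<in> S (Suc j) - S j" by metis
  have "true_in U \<phi> ((b j)(x := a i)) \<longleftrightarrow> i > j" if "i \<in> {1..k}" "j \<in> {1..k}" for i j
  proof (cases "i > j")
    case True
    then have "S (Suc j) \<subseteq> S i" using that by (intro mono) auto
    then show ?thesis using True b[OF that(2)] by (auto simp: S_def)
  next
    case False
    then have "S i \<subseteq> S j" using that by (intro mono) auto
    then show ?thesis using False b[OF that(2)] by (auto simp: S_def)
  qed
  then show "a \<in> order_set U \<phi> x k" unfolding order_set_def by blast
qed

lemma event_mono:
  assumes "D \<subseteq> E" "E \<in> Def U {} {1..k}"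
  shows "event U D \<subseteq> event U E"
proof -
  have "E \<in> Def U UNIV {1..}" using Def_mono[of "{}" UNIV "{1..k}" "{1..}" U] assms(2) by auto
  then show ?thesis using types_up[of _ U UNIV "{1..}" D E] assms(1) unfolding clopen_def by blast
qed

lemma I_event_subset: "L_formula U \<phi> \<Longrightarrow> I_event U \<phi> x \<subseteq> O_event U \<phi> x"
  unfolding I_event_def O_event_def
  by (rule INF_mono) (erule bexI[rotated], rule event_mono[OF shatter_set_subset order_set_Def])

lemma L_event_subset: "L_formula U \<phi> \<Longrightarrow> L_event U \<phi> x \<subseteq> O_event U \<phi> x"
  unfolding L_event_def O_event_def
proof (rule INF_mono)
  fix k :: nat assume "L_formula U \<phi>" "k \<in> {1..}"
  then show "\<exists>n\<in>{1..}. event U (chain_set U \<phi> x n) \<subseteq> event U (order_set U \<phi> x k)"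
    by (intro bexI[of _ "Suc k"] event_mono[OF chain_set_subset order_set_Def]) auto
qed

lemma event_sets:
  assumes "sets P = sets (borel_of (type_space U UNIV {1..}))" "D \<in> Def U {} {1..k}"
  shows "event U D \<in> sets P"
proof -
  have "D \<in> Def U UNIV {1..}" using Def_mono[of "{}" UNIV "{1..k}" "{1..}" U] assms(2) by auto
  then show ?thesis by (simp add: assms(1) open_sets_borel_of openin_clopen)
qed

lemma model_events_sets:
  assumes "sets P = sets (borel_of (type_space U UNIV {1..}))" "L_formula U \<phi>"
  shows "O_event U \<phi> x \<in> sets P" "I_event U \<phi> x \<in> sets P" "L_event U \<phi> x \<in> sets P"
  unfolding O_event_def I_event_def L_event_def
  using event_sets[OF assms(1)] order_set_Def[OF assms(2)] shatter_set_Def[OF assms(2)] chain_set_Def[OF assms(2)]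
  by (auto intro!: sets.countable_INT'')

section \<open>Countably many formulas\<close>

instance trm :: (countable, countable) countable
  by countable_datatype

instance fm :: (countable, countable, countable) countable
  by countable_datatype

lemma trm_symbols: "trm_over U {} t \<Longrightarrow> set1_trm t \<subseteq> fst ` funs U \<and> set2_trm t = {}"
  by (induction t) (auto intro: rev_image_eqI)

lemma fm_symbols:
  "L_formula U \<phi> \<Longrightarrow> set1_fm \<phi> \<subseteq> fst ` funs U \<and> set2_fm \<phi> \<subseteq> fst ` rels U \<and> set3_fm \<phi> = {}"
proof (induction \<phi>)
  case (FEq s t)
  then show ?case using trm_symbols[of U s] trm_symbols[of U t] by simp
next
  case (FRel R ts)
  then show ?case using trm_symbols[of U] by (fastforce intro: rev_image_eqI)
qed auto

text \<open>
  An \<open>L\<close>-formula contains no constants and only symbols of the language, so it can be coded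
  injectively by a formula over a countable vocabulary.
\<close>

lemma countable_L_formulas:
  fixes U :: "('f, 'r, 'u) model"
  assumes "countable_language U"
  shows "countable {\<phi>. L_formula U \<phi>}"
proof -
  define f where "f = to_nat_on (fst ` funs U)"
  define g where "g = to_nat_on (fst ` rels U)"
  have f: "inj_on f (fst ` funs U)" and g: "inj_on g (fst ` rels U)"
    using assms unfolding countable_language_def f_def g_def by (auto intro: inj_on_to_nat_on)
  have "inj_on (map_fm f g (\<lambda>_::'u. 0::nat)) {\<phi>. L_formula U \<phi>}"
  proof (rule inj_onI)
    fix \<phi> \<psi> :: "('f, 'r, 'u) fm"
    assume a: "\<phi> \<in> {\<phi>. L_formula U \<phi>}" "\<psi> \<in> {\<phi>. L_formula U \<phi>}"
      "map_fm f g (\<lambda>_. 0::nat) \<phi> = map_fm f g (\<lambda>_. 0) \<psi>"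
    show "\<phi> = \<psi>"
      by (rule fm.inj_map_strong[OF _ _ _ a(3)])
        (use fm_symbols[of U \<phi>] fm_symbols[of U \<psi>] a(1,2) f g in \<open>auto dest: inj_onD\<close>)
  qed
  then show ?thesis by (rule countableI')
qed

section \<open>Orders of positive probability contradict generic stability\<close>

context canonical_extension
begin

text \<open>
  The argument described at the beginning.  The variables are allocated as follows: \<open>0\<close> for \<open>x\<close>, the
  even numbers \<open>2i\<close> for \<open>x\<^sub>i\<close>, \<open>4l + 1\<close> for the \<open>l\<close>-th variable of \<open>y\<close>, and \<open>3\<close> and \<open>7\<close> for \<open>z\<close> and \<open>z'\<close>.
\<close>

lemma order_event_null:
  assumes P: "is_morley_power_omega U \<kappa> \<mu> P" and stable: "generically_stable U Pr N p"
    and L: "L_formula U \<phi>"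
  shows "O_event U \<phi> x \<in> null_sets P"
proof (rule ccontr)
  assume nonnull: "O_event U \<phi> x \<notin> null_sets P"
  have Pp: "prob_space P" "sets P = sets (borel_of (type_space U UNIV {1..}))"
    using P unfolding is_morley_power_omega_def regular_borel_prob_def by blast+
  interpret P: prob_space P by fact
  define \<epsilon> where "\<epsilon> = measure P (O_event U \<phi> x)"
  have "\<epsilon> \<noteq> 0"
    using nonnull model_events_sets(1)[OF Pp(2) L] by (auto simp: \<epsilon>_def P.emeasure_eq_measure null_sets_def)
  then have \<epsilon>: "\<epsilon> > 0" using measure_nonneg[of P "O_event U \<phi> x"] unfolding \<epsilon>_def by linarith
  have ev: "\<epsilon> \<le> measure P (event U (order_set U \<phi> x k))" if "k \<ge> 1" for k
    unfolding \<epsilon>_def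
    by (rule P.finite_measure_mono[OF _ event_sets[OF Pp(2) order_set_Def[OF L]]])
      (use that in \<open>auto simp: O_event_def\<close>)
  \<comment> \<open>An order of length \<open>2\<close> has two distinct points, so \<open>z \<noteq> z'\<close> is possible.\<close>
  obtain u1 u2 :: 'u where u: "u1 \<noteq> u2"
  proof -
    have "event U (order_set U \<phi> x 2) \<noteq> {}" using ev[of 2] \<epsilon> by auto
    then obtain q where "q \<in> types U UNIV {1..}" "order_set U \<phi> x 2 \<in> q" by (auto simp: clopen_def)
    then have "order_set U \<phi> x 2 \<noteq> {}" using types_empty by metis
    then obtain a b where "\<forall>i\<in>{1..2::nat}. \<forall>j\<in>{1..2::nat}. true_in U \<phi> ((b j)(x := a i)) \<longleftrightarrow> i > j"
      by (auto simp: order_set_def)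
    then have "true_in U \<phi> ((b 1)(x := a 2))" "\<not> true_in U \<phi> ((b 1)(x := a 1))" by auto
    then have "a 1 \<noteq> a 2" by metis
    then show ?thesis by (rule that)
  qed
  obtain \<alpha> c where \<alpha>: "morley_sequence U Pr N p \<alpha>"
    "\<And>i. twin 0 (2 * Suc i) (\<alpha> i) (c (Suc i))"
    "\<And>i. crealizes U Pr (\<alpha> i) p (N \<union> c ` {1..i})"
    by (rule morley_sequence_with_twins) (rule that)
  let ?r = "\<lambda>l. if l = x then 0 else 4 * l + 1"
  obtain \<phi>0 where \<phi>0: "L_formula U \<phi>0" "fv \<phi>0 \<subseteq> ?r ` fv \<phi>"
    "\<And>a. true_in U \<phi>0 a \<longleftrightarrow> true_in U \<phi> (\<lambda>l. a (?r l))"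
    by (rule ex_subst_fv[OF L, of ?r]) (rule that)
  define \<theta>0 where "\<theta>0 = FConj \<phi>0 (FEq (Var 3) (Var 7))"
  have \<theta>0: "L_formula U \<theta>0" "fv \<theta>0 \<subseteq> {0} \<union> {l. odd l}"
    "\<And>a. true_in U \<theta>0 a \<longleftrightarrow> true_in U \<phi> (\<lambda>l. a (?r l)) \<and> a 3 = a 7"
  proof -
    show "L_formula U \<theta>0" using \<phi>0(1) by (simp add: \<theta>0_def)
    have "?r l = 0 \<or> odd (?r l)" for l by simp
    then show "fv \<theta>0 \<subseteq> {0} \<union> {l. odd l}" using \<phi>0(2) by (auto simp: \<theta>0_def)
    show "true_in U \<theta>0 a \<longleftrightarrow> true_in U \<phi> (\<lambda>l. a (?r l)) \<and> a 3 = a 7" for a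
      by (simp only: \<theta>0_def sat.simps tval.simps \<phi>0(3))
  qed
  let ?s = "\<lambda>i l :: nat. if l = 0 then 2 * i else l"
  have "\<forall>i. \<exists>\<theta>. L_formula U \<theta> \<and> fv \<theta> \<subseteq> ?s i ` fv \<theta>0 \<and>
    (\<forall>a. true_in U \<theta> a \<longleftrightarrow> true_in U \<theta>0 (\<lambda>l. a (?s i l)))"
  proof
    fix i
    obtain \<theta> where "L_formula U \<theta>" "fv \<theta> \<subseteq> ?s i ` fv \<theta>0"
      "\<And>a. true_in U \<theta> a \<longleftrightarrow> true_in U \<theta>0 (\<lambda>l. a (?s i l))"
      by (rule ex_subst_fv[OF \<theta>0(1), of "?s i"]) (rule that)
    then show "\<exists>\<theta>. L_formula U \<theta> \<and> fv \<theta> \<subseteq> ?s i ` fv \<theta>0 \<and>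
      (\<forall>a. true_in U \<theta> a \<longleftrightarrow> true_in U \<theta>0 (\<lambda>l. a (?s i l)))" by (intro exI[of _ \<theta>] conjI allI)
  qed
  from choice[OF this] obtain \<theta> where \<theta>': "\<forall>i. L_formula U (\<theta> i) \<and> fv (\<theta> i) \<subseteq> ?s i ` fv \<theta>0 \<and>
    (\<forall>a. true_in U (\<theta> i) a \<longleftrightarrow> true_in U \<theta>0 (\<lambda>l. a (?s i l)))" ..
  have \<theta>: "\<And>i. L_formula U (\<theta> i)" "\<And>i. fv (\<theta> i) \<subseteq> ?s i ` fv \<theta>0"
    "\<And>i a. true_in U (\<theta> i) a \<longleftrightarrow> true_in U \<theta>0 (\<lambda>l. a (?s i l))"
    using \<theta>' by blast+
  have \<theta>_true: "true_in U (\<theta> i) a \<longleftrightarrow> true_in U \<phi> (\<lambda>l. if l = x then a (2 * i) else a (4 * l + 1)) \<and> a 3 = a 7" for i a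
  proof -
    have "(\<lambda>l. a (if ?r l = 0 then 2 * i else ?r l)) = (\<lambda>l. if l = x then a (2 * i) else a (4 * l + 1))"
      by auto
    then show ?thesis unfolding \<theta>(3) \<theta>0(3) by simp
  qed
  define W where "W = {3, 7} \<union> (\<lambda>l. 4 * l + 1) ` fv \<phi>"
  have finW: "finite W" by (simp add: W_def finite_fv)
  have Wodd: "odd l" if "l \<in> W" for l using that by (auto simp: W_def)
  have Weven: "2 * l \<notin> W" for l using Wodd[of "2 * l"] by auto
  obtain ws where ws: "set ws = W" using finite_list[OF finW] by blast
  have "\<forall>k. \<exists>\<theta>. L_formula U \<theta> \<and> fv \<theta> \<subseteq> (\<lambda>l. 2 * l) ` {1..k} \<and>
    (\<forall>a. true_in U \<theta> a \<longleftrightarrow> (\<lambda>l. a (2 * l)) \<in> order_set U \<phi> x k)"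
  proof
    fix k
    obtain \<xi> where \<xi>: "L_formula U \<xi>" "fv \<xi> \<subseteq> {1..k}" "\<And>a. true_in U \<xi> a \<longleftrightarrow> a \<in> order_set U \<phi> x k"
      by (rule Def_obtain[OF order_set_Def[OF L]]) (rule that)
    obtain \<theta> where "L_formula U \<theta>" "fv \<theta> \<subseteq> (\<lambda>l. 2 * l) ` fv \<xi>"
      "\<And>a. true_in U \<theta> a \<longleftrightarrow> true_in U \<xi> (\<lambda>l. a (2 * l))"
      by (rule ex_subst_fv[OF \<xi>(1), of "\<lambda>l. 2 * l"]) (rule that)
    moreover have "(\<lambda>l. 2 * l) ` fv \<xi> \<subseteq> (\<lambda>l. 2 * l) ` {1..k}" by (rule image_mono[OF \<xi>(2)])
    ultimately show "\<exists>\<theta>. L_formula U \<theta> \<and> fv \<theta> \<subseteq> (\<lambda>l. 2 * l) ` {1..k} \<and>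
      (\<forall>a. true_in U \<theta> a \<longleftrightarrow> (\<lambda>l. a (2 * l)) \<in> order_set U \<phi> x k)"
      by (intro exI[of _ \<theta>] conjI allI) (simp_all only: \<xi>(3) subset_trans)
  qed
  from choice[OF this] obtain ord where ord': "\<forall>k. L_formula U (ord k) \<and> fv (ord k) \<subseteq> (\<lambda>l. 2 * l) ` {1..k} \<and>
    (\<forall>a. true_in U (ord k) a \<longleftrightarrow> (\<lambda>l. a (2 * l)) \<in> order_set U \<phi> x k)" ..
  have ord: "\<And>k. L_formula U (ord k)" "\<And>k. fv (ord k) \<subseteq> (\<lambda>l. 2 * l) ` {1..k}"
    "\<And>k a. true_in U (ord k) a \<longleftrightarrow> (\<lambda>l. a (2 * l)) \<in> order_set U \<phi> x k"
    using ord' by blast+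
  obtain m0 where m0: "m0 \<in> M" using M_nonempty by auto
  define m where "m = (\<lambda>_::nat. m0)"
  have m: "range m \<subseteq> M" using m0 by (auto simp: m_def)
  define v where "v l = (if even l then c (l div 2) else const_rv m l)" for l
  have ord_prob: "\<epsilon> \<le> Pr (ord k) (override_on v w W)" if "k \<ge> 1" for k w
  proof -
    have "Pr (ord k) (override_on v w W) = Pr (ord k) (interleave k (const_rv m) c)"
    proof (rule Pr_cong[OF ord(1)])
      fix l assume "l \<in> fv (ord k)"
      then obtain i where "l = 2 * i" "i \<in> {1..k}" using ord(2)[of k] by auto
      then show "override_on v w W l = interleave k (const_rv m) c l"
        using Wodd[of l] by (auto simp: override_on_def v_def interleave_def)
    qed
    also have "\<dots> = measure P (event U {a. true_in U (ord k) (interleave k m a)})"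
      by (rule morley_power_distribution[OF P \<alpha>(2,3) ord(1) _ m]) (use ord(2)[of k] in auto)
    also have "{a. true_in U (ord k) (interleave k m a)} = order_set U \<phi> x k"
    proof -
      have "(\<lambda>l. interleave k m a (2 * l)) \<in> order_set U \<phi> x k \<longleftrightarrow> a \<in> order_set U \<phi> x k" for a
        by (rule Def_cong[OF order_set_Def[OF L]]) (auto simp: interleave_def)
      then show ?thesis by (simp add: ord(3))
    qed
    finally show ?thesis using ev[OF that] by simp
  qed
  \<comment> \<open>For given \<open>j\<close>, the formula \<open>\<Psi>\<close> describes good parameters, on and off the event \<open>O\<^sub>k\<close>.\<close>
  have \<Psi>_ex: "\<exists>\<Psi>. L_formula U \<Psi> \<and> (\<forall>a. true_in U \<Psi> a \<longleftrightarrow>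
    (\<forall>i\<in>{1..k}. true_in U (\<theta> i) a \<longleftrightarrow> i > j \<and> true_in U (ord k) a))" for j k
  proof -
    let ?X = "\<lambda>i. {a. true_in U (\<theta> i) a}" and ?O = "{a. true_in U (ord k) a}"
    have X: "?X i \<in> Def U {} UNIV" for i by (rule Def_formula[OF \<theta>(1)])
    have O: "?O \<in> Def U {} UNIV" by (rule Def_formula[OF ord(1)])
    have "{a. true_in U (\<theta> i) a \<longleftrightarrow> i > j \<and> true_in U (ord k) a} \<in> Def U {} UNIV" for i
    proof (cases "i > j")
      case True
      then have "{a. true_in U (\<theta> i) a \<longleftrightarrow> i > j \<and> true_in U (ord k) a} = (?X i \<inter> ?O) \<union> (- ?X i \<inter> - ?O)" by auto
      then show ?thesis using X O by (simp only: Def_Un Def_Int Def_Compl)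
    next
      case False
      then have "{a. true_in U (\<theta> i) a \<longleftrightarrow> i > j \<and> true_in U (ord k) a} = - ?X i" by auto
      then show ?thesis using X by (simp only: Def_Compl)
    qed
    then have "(\<Inter>i\<in>{1..k}. {a. true_in U (\<theta> i) a \<longleftrightarrow> i > j \<and> true_in U (ord k) a}) \<in> Def U {} UNIV"
      by (intro Def_INT) auto
    then show ?thesis by (elim Def_obtain) auto
  qed
  have \<Psi>_witness: "\<exists>b. \<forall>i\<in>{1..k}. true_in U (\<theta> i) (override_on a b W) \<longleftrightarrow>
      i > j \<and> true_in U (ord k) (override_on a b W)" if j: "j \<in> {1..k}" for j k a
  proof -
    have ord_W: "true_in U (ord k) (override_on a b W) \<longleftrightarrow> (\<lambda>l. a (2 * l)) \<in> order_set U \<phi> x k" for b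
    proof -
      have "(\<lambda>l. override_on a b W (2 * l)) = (\<lambda>l. a (2 * l))"
        using Weven by (simp add: override_on_def)
      then show ?thesis unfolding ord(3) by simp
    qed
    show ?thesis
    proof (cases "(\<lambda>l. a (2 * l)) \<in> order_set U \<phi> x k")
      case True
      then obtain d where d: "\<forall>i\<in>{1..k}. \<forall>j\<in>{1..k}. true_in U \<phi> ((d j)(x := a (2 * i))) \<longleftrightarrow> i > j"
        by (auto simp: order_set_def)
      define b where "b l = (if l \<in> {3, 7} then u1 else d j (l div 4))" for l
      have "true_in U (\<theta> i) (override_on a b W) \<longleftrightarrow> i > j" if i: "i \<in> {1..k}" for i
      proof -
        let ?a = "override_on a b W"
        have "true_in U \<phi> (\<lambda>l. if l = x then ?a (2 * i) else ?a (4 * l + 1)) \<longleftrightarrow> true_in U \<phi> ((d j)(x := a (2 * i)))"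
        proof (rule sat_cong)
          fix l assume "l \<in> fv \<phi>"
          then have "4 * l + 1 \<in> W" by (auto simp: W_def)
          moreover have "4 * l + 1 \<noteq> 3" "4 * l + 1 \<noteq> 7" by presburger+
          moreover have "(4 * l + 1) div 4 = l" by simp
          moreover note Weven[of i]
          ultimately show "(if l = x then ?a (2 * i) else ?a (4 * l + 1)) = ((d j)(x := a (2 * i))) l"
            unfolding override_on_def b_def by (simp only: fun_upd_def if_True if_False simp_thms insert_iff empty_iff)
        qed
        moreover have "?a 3 = ?a 7" by (simp add: override_on_def b_def W_def)
        ultimately show ?thesis using d i j unfolding \<theta>_true by blast
      qed
      then show ?thesis using True ord_W by blast
    next
      case False
      define b where "b l = (if l = 3 then u1 else u2)" for l :: nat
      have "override_on a b W 3 \<noteq> override_on a b W 7" using u by (simp add: override_on_def b_def W_def)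
      then have "\<not> true_in U (\<theta> i) (override_on a b W)" for i unfolding \<theta>_true by blast
      then show ?thesis using False ord_W by blast
    qed
  qed
  have main: "\<exists>w. \<forall>i\<ge>1. (i \<le> j \<longrightarrow> Pr (\<theta> i) (override_on v w W) \<le> 0) \<and>
      (i > j \<longrightarrow> Pr (\<theta> i) (override_on v w W) \<ge> \<epsilon>)" if j: "j \<ge> 1" for j
  proof -
    define g where "g i t = (if Suc i \<le> j then t else max 0 (\<epsilon> - t))" for i and t :: real
    have g_nonneg: "g i t \<ge> 0" if "t \<ge> 0" for i t using that by (simp add: g_def)
    have g_cont: "continuous_on UNIV (\<lambda>t :: nat \<Rightarrow> real. g i (t i))" for i
      unfolding g_def by (cases "Suc i \<le> j") (auto intro!: continuous_intros)
    \<comment> \<open>The formula \<open>\<psi> n\<close> measures how far the first \<open>n\<close> conditions on the parameters are violated.\<close>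
    define \<psi> where "\<psi> n = CConn (\<lambda>t. min 1 (\<Sum>i<n. g i (t i))) (map (\<lambda>i. CProb (\<theta> (Suc i))) [0..<n])" for n
    have wf: "cfm_wf U (\<psi> n)" for n
    proof -
      have "continuous_on UNIV (\<lambda>t :: nat \<Rightarrow> real. min 1 (\<Sum>i<n. g i (t i)))"
        by (intro continuous_intros g_cont)
      then have "continuous_on {t. \<forall>i. t i \<in> {0..1}} (\<lambda>t :: nat \<Rightarrow> real. min 1 (\<Sum>i<n. g i (t i)))"
        by (rule continuous_on_subset) simp
      then show ?thesis unfolding \<psi>_def using \<theta>(1) g_nonneg by (auto simp: sum_nonneg)
    qed
    have val: "cvalue Pr (\<psi> n) w = min 1 (\<Sum>i<n. g i (Pr (\<theta> (Suc i)) w))" for n w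
    proof -
      have "cvalue Pr (\<psi> n) w = min 1 (\<Sum>i<n. g i (if i < n then Pr (\<theta> (Suc i)) w else 0))"
        unfolding \<psi>_def cval.simps cval_CConn_arg by (simp cong: if_cong)
      also have "(\<Sum>i<n. g i (if i < n then Pr (\<theta> (Suc i)) w else 0)) = (\<Sum>i<n. g i (Pr (\<theta> (Suc i)) w))"
        by (intro sum.cong) auto
      finally show ?thesis .
    qed
    have pos: "0 \<le> g i (Pr (\<theta> (Suc i)) w)" for i w using Pr_bounds[OF \<theta>(1)] g_nonneg by blast
    have mono: "cvalue Pr (\<psi> n) w \<le> cvalue Pr (\<psi> n') w" if "n \<le> n'" for n n' w
      unfolding val using that by (intro min.mono order_refl sum_mono2) (auto simp: pos)
    have zero: "cvalue Pr (foldr CInf ws (\<psi> n)) v = 0" for n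
    proof -
      \<comment> \<open>The witness for \<open>j\<close> is taken from an order whose length is at least \<open>j\<close>.\<close>
      define k where "k = max n j"
      have k: "k \<ge> n" "j \<in> {1..k}" "k \<ge> 1" using j by (auto simp: k_def)
      obtain \<Psi> where \<Psi>: "L_formula U \<Psi>" "\<And>a. true_in U \<Psi> a \<longleftrightarrow>
          (\<forall>i\<in>{1..k}. true_in U (\<theta> i) a \<longleftrightarrow> i > j \<and> true_in U (ord k) a)"
        using \<Psi>_ex[of k j] by blast
      have full: "cvalue Pr (foldr CInf ws (one_minus \<Psi>)) v = 0"
        by (rule fullness[OF \<Psi>(1)]) (use \<Psi>_witness[OF k(2)] in \<open>simp only: \<Psi>(2) ws\<close>)
      have le: "cvalue Pr (foldr CInf ws (\<psi> n)) v \<le> real n * \<delta>" if "\<delta> > 0" for \<delta>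
      proof -
        have "cval Pr UNIV (foldr CInf ws (one_minus \<Psi>)) v < \<delta>" using full that by simp
        then obtain w where "cvalue Pr (one_minus \<Psi>) (override_on v w (set ws)) < \<delta>"
          by (rule CInfs_less_witness[OF one_minus_wf[OF \<Psi>(1)] UNIV_not_empty]) (rule that)
        then have w: "Pr \<Psi> (override_on v w W) > 1 - \<delta>" by (simp add: one_minus_value ws)
        let ?a = "override_on v w W"
        \<comment> \<open>As \<open>\<Psi>\<close> fails with probability less than \<open>\<delta>\<close>, each condition is violated by at most \<open>\<delta>\<close>.\<close>
        have "g i (Pr (\<theta> (Suc i)) ?a) \<le> \<delta>" if i: "i < n" for i
        proof -
          have i': "Suc i \<in> {1..k}" using i k(1) by auto
          show ?thesis
          proof (cases "Suc i \<le> j")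
            case True
            have "(\<Sum>(c, \<theta>)\<leftarrow>[(1, \<Psi>), (1, \<theta> (Suc i))]. c * Pr \<theta> ?a) \<le> 1"
              by (rule Pr_linear) (use \<Psi> \<theta>(1) True i' in auto)
            then show ?thesis using w True by (simp add: g_def)
          next
            case False
            have "(\<Sum>(c, \<theta>)\<leftarrow>[(1, \<Psi>), (1, ord k), (-1, \<theta> (Suc i))]. c * Pr \<theta> ?a) \<le> 1"
              by (rule Pr_linear) (use \<Psi> \<theta>(1) ord(1) False i' in auto)
            then show ?thesis using w False ord_prob[OF k(3), of w] \<open>\<delta> > 0\<close> by (simp add: g_def)
          qed
        qed
        then have "(\<Sum>i<n. g i (Pr (\<theta> (Suc i)) ?a)) \<le> (\<Sum>i<n. \<delta>)" by (intro sum_mono) simp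
        then have "cvalue Pr (\<psi> n) ?a \<le> real n * \<delta>" unfolding val by simp
        then show ?thesis using CInfs_le_cvalue[OF wf, of ws n v w] by (simp add: ws)
      qed
      have "cvalue Pr (foldr CInf ws (\<psi> n)) v \<le> \<eta>" if "\<eta> > 0" for \<eta>
      proof -
        have "real n * (\<eta> / (real n + 1)) \<le> \<eta>" using that by (simp add: field_simps)
        then show ?thesis using le[of "\<eta> / (real n + 1)"] that by (smt (verit) divide_pos_pos of_nat_0_le_iff)
      qed
      then have "cvalue Pr (foldr CInf ws (\<psi> n)) v \<le> 0" by (rule field_le_epsilon[of _ 0, unfolded add_0])
      then show ?thesis using cval_bounds[of "foldr CInf ws (\<psi> n)" UNIV v] wf by (simp add: cfm_wf_CInfs)
    qed
    obtain w where w: "\<And>n. cvalue Pr (\<psi> n) (override_on v w W) = 0"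
      using saturated_sequence[of \<psi> ws v, OF wf mono zero] ws by auto
    have "g i (Pr (\<theta> (Suc i)) (override_on v w W)) = 0" for i
    proof -
      have "(\<Sum>i<Suc i. g i (Pr (\<theta> (Suc i)) (override_on v w W))) = 0"
        using w[of "Suc i"] unfolding val by (simp add: min_def split: if_splits)
      moreover have "0 \<le> (\<Sum>i<i. g i (Pr (\<theta> (Suc i)) (override_on v w W)))" by (intro sum_nonneg pos)
      ultimately show ?thesis
        using pos[of i "override_on v w W"] unfolding sum.lessThan_Suc by linarith
    qed
    then have *: "g (i - 1) (Pr (\<theta> i) (override_on v w W)) = 0" if "i \<ge> 1" for i
      using that by (cases i) simp_all
    show ?thesis
    proof (intro exI[of _ w] allI impI conjI)
      fix i :: nat assume i: "1 \<le> i"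
      show "Pr (\<theta> i) (override_on v w W) \<le> 0" if "i \<le> j" using *[OF i] i that by (simp add: g_def)
      show "\<epsilon> \<le> Pr (\<theta> i) (override_on v w W)" if "i > j" using *[OF i] i that by (simp add: g_def max_def split: if_splits)
    qed
  qed
  have "\<forall>j. \<exists>w. \<forall>i\<ge>1. (i \<le> Suc j \<longrightarrow> Pr (\<theta> i) (override_on v w W) \<le> 0) \<and>
      (i > Suc j \<longrightarrow> Pr (\<theta> i) (override_on v w W) \<ge> \<epsilon>)" using main by simp
  from choice[OF this] obtain w where w: "\<forall>j. \<forall>i\<ge>1. (i \<le> Suc j \<longrightarrow> Pr (\<theta> i) (override_on v (w j) W) \<le> 0) \<and>
      (i > Suc j \<longrightarrow> Pr (\<theta> i) (override_on v (w j) W) \<ge> \<epsilon>)" ..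
  \<comment> \<open>Morley sequences are indexed from \<open>0\<close> and orders from \<open>1\<close>; both indices are shifted by one.\<close>
  define b where "b j = override_on v (w j) W" for j
  have eq: "Pr \<theta>0 ((b j)(0 := \<alpha> i)) = Pr (\<theta> (Suc i)) (b j)" for i j
  proof (rule Pr_rename[OF \<theta>0(1) \<theta>(1) \<theta>(3)])
    fix k assume "k \<in> fv \<theta>0" "k \<in> fv (\<theta> (Suc i))"
    then have "k \<noteq> 0" using \<theta>(2)[of "Suc i"] by (auto split: if_splits)
    then show "((b j)(0 := \<alpha> i)) k = b j k" by simp
  next
    fix l :: nat assume "(if l = 0 then 2 * Suc i else l) \<noteq> l"
    then have l: "l = 0" by (simp split: if_splits)
    have "2 * Suc i \<notin> fv \<theta>0" using \<theta>0(2) by auto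
    moreover note Weven[of "Suc i"]
    then have "b j (2 * Suc i) = c (Suc i)" by (simp add: b_def override_on_def v_def)
    ultimately show "(if l = 0 then 2 * Suc i else l) \<notin> fv \<theta>0 \<and> twin l (if l = 0 then 2 * Suc i else l)
        (((b j)(0 := \<alpha> i)) l) (b j (if l = 0 then 2 * Suc i else l))"
      using \<alpha>(2)[of i] l by simp
  qed
  have "(i \<le> j \<longrightarrow> cvalue Pr (CProb \<theta>0) ((b j)(0 := \<alpha> i)) \<le> 0) \<and>
      (i > j \<longrightarrow> cvalue Pr (CProb \<theta>0) ((b j)(0 := \<alpha> i)) \<ge> \<epsilon>)" for i j
    unfolding cval.simps eq using spec[OF spec[OF w, of j], of "Suc i"] by (simp add: b_def)
  then have "cfm_wf U (CProb \<theta>0) \<and> morley_sequence U Pr N p \<alpha> \<and> 0 < \<epsilon> \<and>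
    (\<forall>i j. (i \<le> j \<longrightarrow> cvalue Pr (CProb \<theta>0) ((b j)(0 := \<alpha> i)) \<le> 0) \<and>
      (i > j \<longrightarrow> cvalue Pr (CProb \<theta>0) ((b j)(0 := \<alpha> i)) \<ge> \<epsilon>))"
    using \<theta>0(1) \<alpha>(1) \<epsilon> by (intro conjI allI) simp_all
  then have "\<exists>\<psi> x a (b :: nat \<Rightarrow> nat \<Rightarrow> 'c) r s. cfm_wf U \<psi> \<and> morley_sequence U Pr N p a \<and> r < s \<and>
      (\<forall>i j. (i \<le> j \<longrightarrow> cvalue Pr \<psi> ((b j)(x := a i)) \<le> r) \<and>
        (i > j \<longrightarrow> cvalue Pr \<psi> ((b j)(x := a i)) \<ge> s))"
    by (intro exI)
  then show False using stable unfolding generically_stable_def by (elim conjE notE)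
qed

end

theorem theorem5p4:
  fixes U :: "('f, 'r, 'u) model" and \<kappa> :: "'k rel" and M :: "'u set" and \<mu> :: "'u set \<Rightarrow> real"
    and \<Omega> :: "'w measure" and Pr :: "('f, 'r, 'u, 'c) rstruct" and \<kappa>' :: "'l rel"
    and e :: "('w \<Rightarrow> 'u) \<Rightarrow> 'c"
    and P :: "(nat \<Rightarrow> 'u) set set measure"
  assumes "countable_language U"
    and "monster U \<kappa>"
    and "keisler_measure U \<mu>"
    and "irgs_over U \<kappa> \<Omega> Pr \<kappa>' e M \<mu>"
    and "is_morley_power_omega U \<kappa> \<mu> P"
  shows "(\<forall>\<phi> x. L_formula U \<phi> \<longrightarrow>
            O_event U \<phi> x \<in> null_sets P \<and>
            I_event U \<phi> x \<in> null_sets P \<and>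
            L_event U \<phi> x \<in> null_sets P) \<and>
         (\<Union>\<phi>\<in>{\<phi>. L_formula U \<phi>}. \<Union>x. O_event U \<phi> x) \<in> null_sets P \<and>
         (\<Union>\<phi>\<in>{\<phi>. L_formula U \<phi>}. \<Union>x. I_event U \<phi> x) \<in> null_sets P \<and>
         (\<Union>\<phi>\<in>{\<phi>. L_formula U \<phi>}. \<Union>x. L_event U \<phi> x) \<in> null_sets P"
proof -
  note irgs = assms(4)[unfolded irgs_over_def]
  have \<mu>: "definable_over U \<kappa> M \<mu>" and \<Omega>: "prob_space \<Omega>" and C: "cmonster U Pr \<kappa>'"
    "randomization_embedding U Pr \<Omega> e" and small: "small \<kappa>' (randomization Pr \<Omega> e M)"
    using irgs by simp_all
  have "\<exists>p. is_canonical_extension U Pr \<Omega> e M \<mu> p \<and>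
      generically_stable U Pr (randomization Pr \<Omega> e M) p"
    using irgs by (elim conjE)
  then obtain p where p: "is_canonical_extension U Pr \<Omega> e M \<mu> p"
    "generically_stable U Pr (randomization Pr \<Omega> e M) p"
    by (elim exE conjE) (rule that)
  have elem: "celem_sub U Pr (randomization Pr \<Omega> e M)"
    using p(2) unfolding generically_stable_def by (elim conjE)
  have rs: "rstructure U Pr" using C(1) unfolding cmonster_def by (elim conjE)
  interpret canonical_extension U Pr \<Omega> e \<kappa>' \<kappa> M \<mu> p
    by (intro canonical_extension.intro random_monster.intro random_structure.intro
        canonical_extension_axioms.intro random_monster_axioms.intro rs assms(2) \<mu> \<Omega> C small p(1) elem)
  have sets: "sets P = sets (borel_of (type_space U UNIV {1..}))"
    using assms(5) unfolding is_morley_power_omega_def regular_borel_prob_def by blast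
  have O: "O_event U \<phi> x \<in> null_sets P" if "L_formula U \<phi>" for \<phi> x
    by (rule order_event_null[OF assms(5) p(2) that])
  have I: "I_event U \<phi> x \<in> null_sets P" if "L_formula U \<phi>" for \<phi> x
    by (rule null_sets_subset[OF O[OF that] model_events_sets(2)[OF sets that] I_event_subset[OF that]])
  have L: "L_event U \<phi> x \<in> null_sets P" if "L_formula U \<phi>" for \<phi> x
    by (rule null_sets_subset[OF O[OF that] model_events_sets(3)[OF sets that] L_event_subset[OF that]])
  have UN: "(\<Union>\<phi>\<in>{\<phi>. L_formula U \<phi>}. \<Union>x. E \<phi> x) \<in> null_sets P"
    if "\<And>\<phi> x. L_formula U \<phi> \<Longrightarrow> E \<phi> x \<in> null_sets P" for E :: "_ \<Rightarrow> nat \<Rightarrow> _"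
    using that by (intro null_sets_UN' countable_L_formulas[OF assms(1)]) auto
  show ?thesis using O I L UN[of "O_event U"] UN[of "I_event U"] UN[of "L_event U"] by blast
qed

end
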